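(* Let the strings $e'$ and $e''$ composed of the characters $\mathtt f$, $\mathtt g$, and $\mathtt h$ be flips of each other. Then the fundamental direction cycle $\Phi(e')$ of descent $e'$ and the two second fundamental direction cycles $\Phi^{\mathrm{II}}_{\mathtt g}(e'')$ and $\Phi^{\mathrm{II}}_{\mathtt h}(e'')$ of descent $e''$ are equivalent.
   Context: Flip. Let $\overline{\mathtt f}=\mathtt g$, $\overline{\mathtt g}=\mathtt f$, $\overline{\mathtt h}=\mathtt h$. The flip of a string $e_1e_2\ldots e_l$ is $\overline{e_l}\,\overline{e_{l-1}}\ldots\overline{e_1}$. Leapers. A square is a unit square of the infinite chessboard. A $(p,q)$-leaper is a piece that moves from a square $a$ to any of $a+(\pm p,\pm q)$, $a+(\pm q,\pm p)$. The leaper graph of $L$ over a set of squares $B$ has the squares of $B$ as vertices, two being adjacent when a move of $L$ joins them; a cycle of $L$ within $B$ is a simple cycle in this graph. The leaper is basic if $p+q$ is odd and $\gcd(p,q)=1$, and skew if $p,q$ are nonzero and distinct. Frames. Let $m<n$ be coprime positive integers with $m+n$ odd. Identify squares with their centers, the centers being the points of $\mathbb Z^2$. The $(m,n)$-frame $F$ is the set of squares $(x,y)$ with $\frac{n-m}2<\max(|x|,|y|)<\frac{m+n}2$, i.e. an $(m+n)\times(m+n)$ board with an $(n-m)\times(n-m)$ central hole. Its section $F_{\mathtt E}$ consists of the squares with $\frac{n-m}2<x<\frac{m+n}2$, $|y|<\frac{n-m}2$; its section $F_{\mathtt{NE}}$ of those with $\frac{n-m}2<x,y<\frac{m+n}2$;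 the sections $F_{\mathtt N},F_{\mathtt{NW}},F_{\mathtt W},F_{\mathtt{SW}},F_{\mathtt S},F_{\mathtt{SE}}$ are obtained by counterclockwise rotations by multiples of $90^\circ$ about the origin. In the leaper graph of the $(m,n)$-leaper over the $(m+n)\times(m+n)$ board the squares of the hole are isolated and all squares of $F$ have degree two, so a cycle is determined by its vertex set. Lifting. The lifting transformations $\mathtt f,\mathtt g,\mathtt h$ take $S\subseteq F$ to the disjoint union of $(S+v_i)\cap H_i$ over the eight directions $i$, where $H$ is respectively the $(m,2m+n)$-, $(n,2n-m)$-, $(n,m+2n)$-frame, and for $\mathtt f$: $v_{\mathtt E}=(m+n,0)$, $v_{\mathtt{NE}}=(m,m)$; for $\mathtt g$: $v_{\mathtt E}=(n-m,0)$, $v_{\mathtt{NE}}=(n,n)$; for $\mathtt h$: $v_{\mathtt E}=(m+n,0)$, $v_{\mathtt{NE}}=(n,n)$; the other $v_i$ are obtained by $90^\circ$ rotations. Each maps the vertex set of a cycle of the $(m,n)$-leaper within $F$ to the vertex set of a cycle of the leaper with the proportions of $H$ within $H$; this defines the lift of a cycle. Shell. Let $n\le3m$. If $2m\ge n$, the shell of $F$ is the union of eight $(n-m)\times(n-m)$ subboards: the four corners of $F$ and the four adjacent by side to the central hole. If $2m\le n\le3m$, it is the union of eight $(3m-n)\times(3m-n)$ subboards: one in the middle of each outer side and four adjacent by corner to the central hole. (When $n=2m$ both give all of $F$.) The shell is a union of eight-square cycles of the $(m,n)$-leaper, called shell cycles; each visits exactly one square in each section. Descents. The descent of a skew basic $(p,q)$-leaper,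 $p<q$, is the unique string $e_1\ldots e_l$ of characters $\mathtt f,\mathtt g,\mathtt h$ such that successively applying lifting transformations of types $e_l,\ldots,e_1$ to a $(1,2)$-frame gives a $(p,q)$-frame. The descent of a cycle $C$ of $L$ within a $(p+q)\times(p+q)$ board is the prefix $e_1\ldots e_j$ of the descent of $L$ such that $C$ is obtained from a shell cycle $C'$ of the frame $F'$ whose leaper has descent $e_{j+1}\ldots e_l$ by successively applying lifting transformations of types $e_j,\ldots,e_1$. Either $j=l$ and $F'$ is a $(1,2)$-frame, or $j<l$ and $e_{j+1}\in\{\mathtt g,\mathtt h\}$. Canonical second leaper cycles. Let $L$ be a skew basic $(p,q)$-leaper, $p<q$, of descent $e_1\ldots e_l$, let $C$ be a cycle of $L$ of descent $e_1\ldots e_j$ within a $(p+q)\times(p+q)$ board, let $F'$ be the frame whose leaper has descent $e_{j+1}\ldots e_l$, and let $C'$ be the shell cycle of $F'$ from which $C$ is obtained by successively applying lifting transformations of types $e_j,\ldots,e_1$. The canonical second leaper $M$ associated with $C$ is the $(0,1)$-leaper if $j=l$, and the skew basic leaper of descent $e_{j+2}\ldots e_l$ if $j<l$. The canonical second leaper cycle over the squares of $C'$ is the cycle of $M$ visiting the eight squares of $C'$ in the order of their sections $\mathtt E,\mathtt{NE},\mathtt N,\mathtt{NW},\mathtt W,\mathtt{SW},\mathtt S,\mathtt{SE}$, written as a concatenation $a_0a_1\ldots a_7$ of eight one-square paths. Number the directions $\mathtt E,\mathtt{NE},\ldots,\mathtt{SE}$ by $0,\ldots,7$ modulo $8$,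 let $u_0=(1,0)$, $u_1=(1,1)$, $u_2=(0,1)$, $u_3=(-1,1)$, $u_{i+4}=-u_i$, and let $-w$ be the path $w$ traversed backwards. A cycle $a_0a_1\ldots a_7$ of $M$ within an $(m,n)$-frame, split into eight paths with $a_i$ in the section of direction $i$, is lifted to $b_0b_1\ldots b_7$ within the larger frame by the rules: $\mathtt f$: $b_i=(-a_{i+5})(-a_{i+4})(-a_{i+3})+(m+n)u_i$ for $i$ even, $b_i=a_i+mu_i$ for $i$ odd; $\mathtt g$: $b_i=a_i+(n-m)u_i$ for $i$ even, $b_i=(-a_{i+5})(-a_{i+4})(-a_{i+3})+nu_i$ for $i$ odd; $\mathtt h$: $b_i=(-a_{i+6})(-a_{i+5})(-a_{i+4})(-a_{i+3})(-a_{i+2})+(m+n)u_i$ for $i$ even, $b_i=a_{i-1}a_ia_{i+1}+nu_i$ for $i$ odd. The canonical second leaper cycle $D$ over the squares of $C$ is obtained from the one over the squares of $C'$ by successively applying the lifts of types $e_j,\ldots,e_1$; it is a Hamiltonian cycle of $M$ over the squares of $C$. When $M$ is skew (so $j<l$), the descent of $D$ is $e_1\ldots e_j$ and the origin of $D$ is $e_{j+1}\in\{\mathtt g,\mathtt h\}$. Direction graphs. Let $A_1=\begin{pmatrix}0&1\\1&0\end{pmatrix}$, $A_2=\begin{pmatrix}1&0\\0&1\end{pmatrix}$, $A_3=\begin{pmatrix}-1&0\\0&1\end{pmatrix}$, $A_4=\begin{pmatrix}0&-1\\1&0\end{pmatrix}$, and $A_{i+4}=-A_i$ for $i=1,\ldots,4$.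 A move of a skew $(r,s)$-leaper, $r<s$, by a translation $v$ has (skew) direction $i\in\{1,\ldots,8\}$ and direction matrix $A_i$ if $v^T=A_i\binom rs$. A direction graph is a symmetric directed graph whose arcs are labeled with skew directions so that the sum of the associated direction matrices over every simple directed cycle (including two-cycles) is zero. Two direction graphs are the same if there is a label-preserving isomorphism between them. The direction graph extracted from a cycle of a skew leaper whose direction matrices sum to zero has the squares of the cycle as vertices and, for each pair of consecutive squares $a,b$, an arc from $a$ to $b$ and an arc from $b$ to $a$, each labeled with the direction of the corresponding move. Fundamental direction cycles. $\Phi(e)$ is the direction graph extracted from a cycle of descent $e$ of a skew basic $(p,q)$-leaper within a $(p+q)\times(p+q)$ chessboard; it exists and depends only on $e$. For $o\in\{\mathtt g,\mathtt h\}$, $\Phi^{\mathrm{II}}_o(e)$ is the direction graph extracted from a canonical second leaper cycle of descent $e$ and origin $o$ of a skew basic canonical second leaper; it exists and depends only on $e$ and $o$. Equivalence. A permutation $\pi$ of the eight skew directions is an equivalence permutation if there are real $2\times2$ matrices $P,Q$ with $A_{\pi(i)}=PA_iQ$ for all $i$. $\pi(\Phi)$ is obtained from $\Phi$ by applying $\pi$ to every arc label. Two direction graphs $\Phi_1,\Phi_2$ are equivalent if $\pi(\Phi_1)=\Phi_2$ for some equivalence permutation $\pi$. *)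

theory Defs
  imports
    "HOL-Analysis.Analysis"
    "HOL-Combinatorics.Permutations"
    "Graph_Theory.Graph_Theory"
begin

type_synonym square = "int \<times> int"

datatype lift_type = LF | LG | LH

fun flip_char :: "lift_type \<Rightarrow> lift_type" where
  "flip_char LF = LG"
| "flip_char LG = LF"
| "flip_char LH = LH"

definition flip :: "lift_type list \<Rightarrow> lift_type list" where
  "flip e = rev (map flip_char e)"

text \<open>The proportions of a leaper are nonnegative; they are integers only to avoid coercions.\<close>

definition basic_leaper :: "int \<Rightarrow> int \<Rightarrow> bool" where
  "basic_leaper p q \<longleftrightarrow> odd (p + q) \<and> coprime p q"

definition skew_leaper :: "int \<Rightarrow> int \<Rightarrow> bool" where
  "skew_leaper p q \<longleftrightarrow> 0 < p \<and> 0 < q \<and> p \<noteq> q"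

definition leaper_moves :: "int \<Rightarrow> int \<Rightarrow> square set" where
  "leaper_moves p q =
     {(s * p, t * q) | s t. s \<in> {-1, 1} \<and> t \<in> {-1, 1}} \<union>
     {(s * q, t * p) | s t. s \<in> {-1, 1} \<and> t \<in> {-1, 1}}"

definition cyclic_arcs :: "'v list \<Rightarrow> ('v \<times> 'v) set" where
  "cyclic_arcs xs = {(xs ! k, xs ! (Suc k mod length xs)) | k. k < length xs}"

definition leaper_cycle :: "int \<Rightarrow> int \<Rightarrow> square set \<Rightarrow> square list \<Rightarrow> bool" where
  "leaper_cycle p q B xs \<longleftrightarrow>
     3 \<le> length xs \<and> distinct xs \<and> set xs \<subseteq> B \<and>
     (\<forall>(a, b) \<in> cyclic_arcs xs. b - a \<in> leaper_moves p q)"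

text \<open>
  The board of odd side \<open>N\<close> is centered at the origin. All inequalities between coordinates and
  half-integers are multiplied by two, here and below.
\<close>

definition board :: "int \<Rightarrow> square set" where
  "board N = {(x, y). 2 * \<bar>x\<bar> < N \<and> 2 * \<bar>y\<bar> < N}"

text \<open>
  An \<open>(m, n)\<close>-frame is given by the pair \<open>(m, n)\<close>. The directions E, NE, N, NW, W, SW, S, SE are
  numbered 0 to 7.
\<close>

definition rot90 :: "square \<Rightarrow> square" where
  "rot90 v = (- snd v, fst v)"

definition unit_dir :: "nat \<Rightarrow> square" where
  "unit_dir i = (rot90 ^^ (i div 2)) (if even i then (1, 0) else (1, 1))"

definition scale :: "int \<Rightarrow> square \<Rightarrow> square" where
  "scale c v = (c * fst v, c * snd v)"

fun frame_section :: "int \<times> int \<Rightarrow> nat \<Rightarrow> square set" where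
  "frame_section (m, n) i = (rot90 ^^ (i div 2)) `
     (if even i
      then {(x, y). n - m < 2 * x \<and> 2 * x < m + n \<and> 2 * \<bar>y\<bar> < n - m}
      else {(x, y). n - m < 2 * x \<and> 2 * x < m + n \<and> n - m < 2 * y \<and> 2 * y < m + n})"

fun lift_frame :: "lift_type \<Rightarrow> int \<times> int \<Rightarrow> int \<times> int" where
  "lift_frame LF (m, n) = (m, 2 * m + n)"
| "lift_frame LG (m, n) = (n, 2 * n - m)"
| "lift_frame LH (m, n) = (n, m + 2 * n)"

text \<open>\<open>frame_of e = (p, q)\<close> means that \<open>e\<close> is the descent of the \<open>(p, q)\<close>-leaper.\<close>

primrec frame_of :: "lift_type list \<Rightarrow> int \<times> int" where
  "frame_of [] = (1, 2)"
| "frame_of (x # e) = lift_frame x (frame_of e)"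

fun lift_shift :: "lift_type \<Rightarrow> int \<times> int \<Rightarrow> nat \<Rightarrow> square" where
  "lift_shift LF (m, n) i = scale (if even i then m + n else m) (unit_dir i)"
| "lift_shift LG (m, n) i = scale (if even i then n - m else n) (unit_dir i)"
| "lift_shift LH (m, n) i = scale (if even i then m + n else n) (unit_dir i)"

definition lift_set :: "lift_type \<Rightarrow> int \<times> int \<Rightarrow> square set \<Rightarrow> square set" where
  "lift_set x F S =
     (\<Union>i<8. (\<lambda>a. a + lift_shift x F i) ` S \<inter> frame_section (lift_frame x F) i)"

text \<open>
  Successive lifts of types \<open>e\<^sub>j, \<dots>, e\<^sub>1\<close>, where \<open>e = e\<^sub>1 \<dots> e\<^sub>j\<close>, starting from a set of squares of
  the frame of descent \<open>w\<close>.
\<close>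

primrec lift_set_word :: "lift_type list \<Rightarrow> lift_type list \<Rightarrow> square set \<Rightarrow> square set" where
  "lift_set_word [] w S = S"
| "lift_set_word (x # e) w S = lift_set x (frame_of (e @ w)) (lift_set_word e w S)"

text \<open>
  For each of the two positions of a subboard, the east (or northeast) one is given explicitly and
  the other three are its rotations.
\<close>

fun shell :: "int \<times> int \<Rightarrow> square set" where
  "shell (m, n) = (\<Union>k<4. (rot90 ^^ k) `
     (if n \<le> 2 * m
      then {(x, y). 3 * m - n < 2 * x \<and> 2 * x < m + n \<and> 3 * m - n < 2 * y \<and> 2 * y < m + n} \<union>
           {(x, y). n - m < 2 * x \<and> 2 * x < 3 * (n - m) \<and> 2 * \<bar>y\<bar> < n - m}
      else {(x, y). 3 * n - 5 * m < 2 * x \<and> 2 * x < m + n \<and> 2 * \<bar>y\<bar> < 3 * m - n} \<union>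
           {(x, y). n - m < 2 * x \<and> 2 * x < 5 * m - n \<and> n - m < 2 * y \<and> 2 * y < 5 * m - n}))"

text \<open>
  Squares of a frame have degree two in its leaper graph, so the eight-square cycles which make up
  the shell are all the eight-square cycles within it.
\<close>

fun shell_cycle :: "int \<times> int \<Rightarrow> square list \<Rightarrow> bool" where
  "shell_cycle (m, n) xs \<longleftrightarrow> n \<le> 3 * m \<and> leaper_cycle m n (shell (m, n)) xs \<and> length xs = 8"

text \<open>
  \<open>C\<close> is a cycle of the leaper of descent \<open>e w\<close>, obtained by lifts of types \<open>e\<close> from the shell cycle
  \<open>C'\<close> of the frame of descent \<open>w\<close>. Lifts of cycles are defined by their vertex sets.
\<close>

definition lifted_from ::
  "int \<Rightarrow> int \<Rightarrow> square list \<Rightarrow> lift_type list \<Rightarrow> lift_type list \<Rightarrow> square list \<Rightarrow> bool" where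
  "lifted_from p q C e w C' \<longleftrightarrow>
     leaper_cycle p q (board (p + q)) C \<and> frame_of (e @ w) = (p, q) \<and>
     shell_cycle (frame_of w) C' \<and> set C = lift_set_word e w (set C')"

definition cycle_descent :: "int \<Rightarrow> int \<Rightarrow> square list \<Rightarrow> lift_type list \<Rightarrow> bool" where
  "cycle_descent p q C e \<longleftrightarrow> (\<exists>w C'. lifted_from p q C e w C')"

text \<open>\<open>w\<close> is the part \<open>e\<^sub>j\<^sub>+\<^sub>1 \<dots> e\<^sub>l\<close> of the descent of the first leaper.\<close>

fun second_leaper :: "lift_type list \<Rightarrow> int \<times> int" where
  "second_leaper [] = (0, 1)"
| "second_leaper (x # w) = frame_of w"

text \<open>
  A cycle split into eight paths is a function from directions to paths; indices outside \<open>{0..7}\<close>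
  are irrelevant.
\<close>

definition section_paths :: "int \<times> int \<Rightarrow> square set \<Rightarrow> nat \<Rightarrow> square list" where
  "section_paths F S i = [THE a. a \<in> S \<inter> frame_section F i]"

fun join_paths :: "lift_type \<Rightarrow> (nat \<Rightarrow> square list) \<Rightarrow> nat \<Rightarrow> square list" where
  "join_paths LF a i =
     (if even i
      then rev (a ((i + 5) mod 8)) @ rev (a ((i + 4) mod 8)) @ rev (a ((i + 3) mod 8))
      else a i)"
| "join_paths LG a i =
     (if even i
      then a i
      else rev (a ((i + 5) mod 8)) @ rev (a ((i + 4) mod 8)) @ rev (a ((i + 3) mod 8)))"
| "join_paths LH a i =
     (if even i
      then rev (a ((i + 6) mod 8)) @ rev (a ((i + 5) mod 8)) @ rev (a ((i + 4) mod 8)) @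
           rev (a ((i + 3) mod 8)) @ rev (a ((i + 2) mod 8))
      else a ((i + 7) mod 8) @ a i @ a ((i + 1) mod 8))"

definition lift_paths ::
  "lift_type \<Rightarrow> int \<times> int \<Rightarrow> (nat \<Rightarrow> square list) \<Rightarrow> nat \<Rightarrow> square list" where
  "lift_paths x F a i = map (\<lambda>b. b + lift_shift x F i) (join_paths x a i)"

primrec second_paths ::
  "lift_type list \<Rightarrow> lift_type list \<Rightarrow> square set \<Rightarrow> nat \<Rightarrow> square list" where
  "second_paths [] w S = section_paths (frame_of w) S"
| "second_paths (x # e) w S = lift_paths x (frame_of (e @ w)) (second_paths e w S)"

definition second_cycle :: "lift_type list \<Rightarrow> lift_type list \<Rightarrow> square list \<Rightarrow> square list" where
  "second_cycle e w C' = concat (map (second_paths e w (set C')) [0..<8])"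

definition mat2 :: "real \<Rightarrow> real \<Rightarrow> real \<Rightarrow> real \<Rightarrow> real^2^2" where
  "mat2 a b c d = vector [vector [a, b], vector [c, d]]"

definition dir_matrix :: "nat \<Rightarrow> real^2^2" where
  "dir_matrix i =
     (let A = (\<lambda>k::nat. if k = 1 then mat2 0 1 1 0
                        else if k = 2 then mat2 1 0 0 1
                        else if k = 3 then mat2 (-1) 0 0 1
                        else mat2 0 (-1) 1 0)
      in if i \<le> 4 then A i else - A (i - 4))"

definition move_direction :: "int \<Rightarrow> int \<Rightarrow> square \<Rightarrow> nat" where
  "move_direction r s v =
     (THE i. i \<in> {1..8} \<and>
        vector [of_int (fst v), of_int (snd v)] =
          dir_matrix i *v (vector [of_int r, of_int s] :: real^2))"

record 'v labelled_graph =
  graph :: "'v pair_pre_digraph"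
  label :: "'v \<times> 'v \<Rightarrow> nat"

text \<open>The library's \<open>pre_digraph.cycle\<close> is a nonempty list of arcs and includes two-cycles.\<close>

definition direction_graph :: "'v labelled_graph \<Rightarrow> bool" where
  "direction_graph G \<longleftrightarrow>
     pair_pseudo_graph (graph G) \<and>
     (\<forall>a \<in> parcs (graph G). label G a \<in> {1..8}) \<and>
     (\<forall>c. pre_digraph.cycle (with_proj (graph G)) c \<longrightarrow>
          (\<Sum>a\<leftarrow>c. dir_matrix (label G a)) = 0)"

definition same_graph :: "'v labelled_graph \<Rightarrow> 'w labelled_graph \<Rightarrow> bool" where
  "same_graph G H \<longleftrightarrow>
     (\<exists>f. bij_betw f (pverts (graph G)) (pverts (graph H)) \<and>
       (\<forall>a \<in> pverts (graph G). \<forall>b \<in> pverts (graph G).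
          (a, b) \<in> parcs (graph G) \<longleftrightarrow> (f a, f b) \<in> parcs (graph H)) \<and>
       (\<forall>(a, b) \<in> parcs (graph G). label H (f a, f b) = label G (a, b)))"

definition equivalence_permutation :: "(nat \<Rightarrow> nat) \<Rightarrow> bool" where
  "equivalence_permutation \<pi> \<longleftrightarrow>
     \<pi> permutes {1..8} \<and>
     (\<exists>P Q :: real^2^2. \<forall>i \<in> {1..8}. dir_matrix (\<pi> i) = P ** dir_matrix i ** Q)"

definition relabel :: "(nat \<Rightarrow> nat) \<Rightarrow> 'v labelled_graph \<Rightarrow> 'v labelled_graph" where
  "relabel \<pi> G = G\<lparr>label := \<pi> \<circ> label G\<rparr>"

definition equivalent_graphs :: "'v labelled_graph \<Rightarrow> 'w labelled_graph \<Rightarrow> bool" where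
  "equivalent_graphs G H \<longleftrightarrow>
     direction_graph G \<and> direction_graph H \<and>
     (\<exists>\<pi>. equivalence_permutation \<pi> \<and> same_graph (relabel \<pi> G) H)"

text \<open>
  Applied to an \<open>(r, s)\<close>-leaper cycle with \<open>0 < r < s\<close>. That the direction matrices of the cycle
  sum to zero is not assumed; it is part of the extracted graph being a \<open>direction_graph\<close>, which
  \<open>equivalent_graphs\<close> asserts.
\<close>

definition extracted_graph :: "int \<Rightarrow> int \<Rightarrow> square list \<Rightarrow> square labelled_graph" where
  "extracted_graph r s xs =
     \<lparr>graph = \<lparr>pverts = set xs, parcs = cyclic_arcs xs \<union> (cyclic_arcs xs)\<inverse>\<rparr>,
      label = (\<lambda>(a, b). move_direction r s (b - a))\<rparr>"

definition is_fundamental :: "lift_type list \<Rightarrow> square labelled_graph \<Rightarrow> bool" where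
  "is_fundamental e G \<longleftrightarrow>
     (\<exists>p q C. skew_leaper p q \<and> basic_leaper p q \<and> p < q \<and>
        cycle_descent p q C e \<and> G = extracted_graph p q C)"

definition is_second_fundamental ::
  "lift_type \<Rightarrow> lift_type list \<Rightarrow> square labelled_graph \<Rightarrow> bool" where
  "is_second_fundamental org e G \<longleftrightarrow>
     (\<exists>p q C w C' r s.
        skew_leaper p q \<and> basic_leaper p q \<and> p < q \<and>
        lifted_from p q C e w C' \<and>
        w \<noteq> [] \<and> hd w = org \<and>
        second_leaper w = (r, s) \<and> skew_leaper r s \<and> basic_leaper r s \<and> r < s \<and>
        G = extracted_graph r s (second_cycle e w C'))"

end

theory Submission
  imports Defs
begin

text \<open>
  Index the eight skew directions of a leaper by \<open>0, \<dots>, 7\<close> in a suitable cyclic order. Along every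
  cycle of the theorem, consecutive moves have neighbouring indices, so the directions form a walk
  around an octagon. The edges of the octagon alternate between two types, and the type word of the
  walk, a word over two letters, determines all directions once one of them is given. In terms of
  direction matrices a step of either type is right multiplication by a fixed reflection, one for each
  type. The octagon is a Cayley graph of the dihedral group of order eight, so two cycles with equal
  type words have equivalent direction graphs. The same holds if the two types are exchanged, because
  the two pairs of reflections are conjugate in the orthogonal group (\<open>labelling_equiv_g\<close>,
  \<open>labelling_equiv_h\<close>, \<open>equivalent_first_second\<close>). The direction matrices around a cycle sum to zero
  because its type word is a fourth power of a word which turns the direction by 90 degrees
  (\<open>sum_fourfold\<close>). What remains is a statement about type words.

  On a first cycle the section of a square and the move by which it is entered determine the move by
  which it is left, since a square of a frame has only two neighbours. The type of a square is the
  parity of its section, and a lift replaces each square by a path of one, three or five squares of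
  prescribed types. Hence the type word arises from that of a shell cycle by substitutions, one for
  each letter of the descent (\<open>lift_trail\<close>, \<open>lifted_from_trail\<close>). The cycle itself is determined by
  its set of squares (\<open>extracted_graph_determined\<close>).

  On a second cycle the paths in the even sections share one type word and those in the odd sections
  another one, and a lift expresses the new pair of words in terms of the old one
  (\<open>frame_runs_lift\<close>, \<open>second_cycle_trail\<close>).

  The images of the two letters under the substitutions of the descent \<open>e x\<close> are products of their
  images under those of \<open>e\<close>, and the pair of words of a second cycle of descent \<open>x e\<close> is composed of
  the pair of descent \<open>e\<close>. So both pairs satisfy recursions of the same shape, except that the letter
  is added at the end of one descent and at the beginning of the other; this is why the
  flip reverses the order of the letters. By induction, the words of the first cycle of descent \<open>e\<close>
  and of the second cycle of descent \<open>flip e\<close> are conjugate after an exchange of the types, with an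
  explicit conjugating element (\<open>linked\<close>, \<open>linked_words\<close>). So the two cyclic type words agree up to
  that exchange (\<open>second_word_rotation\<close>).
\<close>

section \<open>Walks on direction indices\<close>

text \<open>
  Directions are indexed by \<open>0, \<dots>, 7\<close>. A walk moves between neighbouring indices modulo 8; a step
  of type \<open>False\<close> exchanges \<open>2j\<close> and \<open>2j + 1\<close>, a step of type \<open>True\<close> exchanges \<open>2j - 1\<close> and \<open>2j\<close>.
  These two involutions make the indices a Cayley graph of the dihedral group of order eight.
\<close>

definition step :: "bool \<Rightarrow> nat \<Rightarrow> nat" where
  "step t k = (if even k = t then k + 7 else k + 1) mod 8"

text \<open>The indices after each step of a walk which starts at \<open>d\<close> and has the types \<open>ts\<close>.\<close>

primrec dirs :: "nat \<Rightarrow> bool list \<Rightarrow> nat list" where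
  "dirs d [] = []"
| "dirs d (t # ts) = step t d # dirs (step t d) ts"

primrec dir_end :: "nat \<Rightarrow> bool list \<Rightarrow> nat" where
  "dir_end d [] = d"
| "dir_end d (t # ts) = dir_end (step t d) ts"

text \<open>
  The squares visited from \<open>a\<close>, one for each type: the square with type \<open>t\<close> is left by the move
  with index \<open>step t d\<close>, where \<open>d\<close> is the index of the move by which it is entered and \<open>v\<close> gives
  the moves. The square reached by the last move is not listed; it is \<open>sq_end\<close>.
\<close>

primrec squares :: "(nat \<Rightarrow> 'a::ab_group_add) \<Rightarrow> 'a \<Rightarrow> nat \<Rightarrow> bool list \<Rightarrow> 'a list" where
  "squares v a d [] = []"
| "squares v a d (t # ts) = a # squares v (a + v (step t d)) (step t d) ts"

primrec sq_end :: "(nat \<Rightarrow> 'a::ab_group_add) \<Rightarrow> 'a \<Rightarrow> nat \<Rightarrow> bool list \<Rightarrow> 'a" where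
  "sq_end v a d [] = a"
| "sq_end v a d (t # ts) = sq_end v (a + v (step t d)) (step t d) ts"

lemma step_less [simp]: "step t k < 8"
  by (simp add: step_def)

lemma step_step [simp]: "k < 8 \<Longrightarrow> step t (step t k) = k"
proof -
  assume "k < 8"
  then have "k \<in> {0,1,2,3,4,5,6,7}" by auto
  then show ?thesis by (auto simp: step_def)
qed

lemma length_dirs [simp]: "length (dirs d ts) = length ts"
  by (induction ts arbitrary: d) auto

lemma length_squares [simp]: "length (squares v a d ts) = length ts"
  by (induction ts arbitrary: a d) auto

lemma squares_eq_Nil_iff [simp]: "squares v a d ts = [] \<longleftrightarrow> ts = []"
  by (cases ts) auto

lemma hd_squares [simp]: "ts \<noteq> [] \<Longrightarrow> hd (squares v a d ts) = a"
  by (cases ts) auto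

lemma dirs_append: "dirs d (ts @ ts') = dirs d ts @ dirs (dir_end d ts) ts'"
  by (induction ts arbitrary: d) auto

lemma dir_end_append [simp]: "dir_end d (ts @ ts') = dir_end (dir_end d ts) ts'"
  by (induction ts arbitrary: d) auto

lemma squares_append:
  "squares v a d (ts @ ts') = squares v a d ts @ squares v (sq_end v a d ts) (dir_end d ts) ts'"
  by (induction ts arbitrary: a d) auto

lemma sq_end_append: "sq_end v a d (ts @ ts') = sq_end v (sq_end v a d ts) (dir_end d ts) ts'"
  by (induction ts arbitrary: a d) auto

lemma dir_end_less: "d < 8 \<Longrightarrow> dir_end d ts < 8"
  by (induction ts arbitrary: d) auto

lemma set_dirs: "set (dirs d ts) \<subseteq> {..<8}"
  by (induction ts arbitrary: d) auto

lemma squares_shift: "squares v (a + c) d ts = map (\<lambda>b. b + c) (squares v a d ts)"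
proof (induction ts arbitrary: a d)
  case (Cons t ts)
  then show ?case using Cons[of "a + v (step t d)" "step t d"] by (simp add: ac_simps)
qed simp

lemma sq_end_shift: "sq_end v (a + c) d ts = sq_end v a d ts + c"
proof (induction ts arbitrary: a d)
  case (Cons t ts)
  then show ?case using Cons[of "a + v (step t d)" "step t d"] by (simp add: ac_simps)
qed simp

lemma squares_nth_Suc:
  "k < length ts \<Longrightarrow>
   (squares v a d ts @ [sq_end v a d ts]) ! Suc k - (squares v a d ts @ [sq_end v a d ts]) ! k =
     v (dirs d ts ! k)"
proof (induction ts arbitrary: a d k)
  case (Cons t ts)
  show ?case
  proof (cases k)
    case 0
    then show ?thesis by (cases ts) auto
  next
    case (Suc j)
    then show ?thesis using Cons.IH[of j "a + v (step t d)" "step t d"] Cons.prems by simp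
  qed
qed simp

lemma squares_nth_cyclic:
  assumes "sq_end v a d ts = a" and "k < length ts"
  shows "squares v a d ts ! (Suc k mod length ts) - squares v a d ts ! k = v (dirs d ts ! k)"
proof -
  have 0: "squares v a d ts ! 0 = a" using assms(2) by (cases ts) auto
  have "(squares v a d ts @ [a]) ! Suc k = squares v a d ts ! (Suc k mod length ts)"
  proof (cases "Suc k = length ts")
    case True
    then show ?thesis using 0 by (simp add: nth_append)
  next
    case False
    then show ?thesis using assms(2) by (simp add: nth_append)
  qed
  then show ?thesis
    using squares_nth_Suc[OF assms(2), of v a d] assms by (simp add: nth_append)
qed

section \<open>Direction graphs of cycles\<close>

text \<open>The translation of an \<open>(r, s)\<close>-leaper in the skew direction \<open>i\<close>, for \<open>1 \<le> i \<le> 8\<close>.\<close>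

definition dvec :: "int \<Rightarrow> int \<Rightarrow> nat \<Rightarrow> square" where
  "dvec r s i = [(s, r), (r, s), (- r, s), (- s, r), (- s, - r), (- r, - s), (r, - s), (s, - r)] ! (i - 1)"

lemma one_to_eight: "{1..8::nat} = {1, 2, 3, 4, 5, 6, 7, 8}"
  by auto

lemma below_eight: "i < (8::nat) \<longleftrightarrow> i \<in> {0, 1, 2, 3, 4, 5, 6, 7}"
  by auto

lemma mat2_mult:
  "mat2 a b c d ** mat2 a' b' c' d' =
     mat2 (a * a' + b * c') (a * b' + b * d') (c * a' + d * c') (c * b' + d * d')"
  by (simp add: mat2_def matrix_matrix_mult_def vec_eq_iff forall_2 sum_2)

lemma mat2_uminus: "- mat2 a b c d = mat2 (- a) (- b) (- c) (- d)"
  by (simp add: mat2_def vec_eq_iff forall_2)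

lemma mat2_eq_iff: "mat2 a b c d = mat2 a' b' c' d' \<longleftrightarrow> a = a' \<and> b = b' \<and> c = c' \<and> d = d'"
  by (auto simp: mat2_def vec_eq_iff forall_2)

lemma mat2_mult_vector: "mat2 a b c d *v vector [x, y] = vector [a * x + b * y, c * x + d * y]"
  by (simp add: mat2_def matrix_vector_mult_def vec_eq_iff forall_2 sum_2)

lemma vector2_eq_iff: "(vector [a, b] :: real^2) = vector [a', b'] \<longleftrightarrow> a = a' \<and> b = b'"
  by (auto simp: vec_eq_iff forall_2)

lemma dir_matrix_simps:
  "dir_matrix (Suc 0) = mat2 0 1 1 0" "dir_matrix 1 = mat2 0 1 1 0" "dir_matrix 2 = mat2 1 0 0 1"
  "dir_matrix 3 = mat2 (-1) 0 0 1" "dir_matrix 4 = mat2 0 (-1) 1 0"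
  "dir_matrix 5 = mat2 0 (-1) (-1) 0" "dir_matrix 6 = mat2 (-1) 0 0 (-1)"
  "dir_matrix 7 = mat2 1 0 0 (-1)" "dir_matrix 8 = mat2 0 1 (-1) 0"
  by (simp_all add: dir_matrix_def mat2_uminus)

lemma dir_matrix_inj: "inj_on dir_matrix {1..8}"
  unfolding inj_on_def one_to_eight by (auto simp: dir_matrix_simps mat2_eq_iff)

text \<open>The label of the opposite direction.\<close>

definition opp_label :: "nat \<Rightarrow> nat" where
  "opp_label i = (if i \<le> 4 then i + 4 else i - 4)"

lemma opp_label_in: "i \<in> {1..8} \<Longrightarrow> opp_label i \<in> {1..8}"
  by (auto simp: opp_label_def)

lemma dir_matrix_opp: "i \<in> {1..8} \<Longrightarrow> dir_matrix (opp_label i) = - dir_matrix i"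
  unfolding one_to_eight by (auto simp: opp_label_def dir_matrix_simps mat2_uminus)

lemma dvec_opp: "i \<in> {1..8} \<Longrightarrow> dvec r s (opp_label i) = - dvec r s i"
  unfolding one_to_eight by (auto simp: opp_label_def dvec_def)

lemma dir_matrix_dvec:
  "i \<in> {1..8} \<Longrightarrow>
   dir_matrix i *v vector [of_int r, of_int s] =
     vector [of_int (fst (dvec r s i)), of_int (snd (dvec r s i))]"
  unfolding one_to_eight by (auto simp: dir_matrix_simps mat2_mult_vector dvec_def vector2_eq_iff)

lemma dvec_inj: "0 < r \<Longrightarrow> r < s \<Longrightarrow> inj_on (dvec r s) {1..8}"
  unfolding inj_on_def one_to_eight by (auto simp: dvec_def)

lemma move_direction_dvec:
  assumes "0 < r" "r < s" "i \<in> {1..8}"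
  shows "move_direction r s (dvec r s i) = i"
  unfolding move_direction_def
proof (rule the_equality)
  show "i \<in> {1..8} \<and> vector [real_of_int (fst (dvec r s i)), real_of_int (snd (dvec r s i))] =
      dir_matrix i *v vector [real_of_int r, real_of_int s]"
    using assms dir_matrix_dvec by simp
next
  fix j
  assume j: "j \<in> {1..8} \<and> vector [real_of_int (fst (dvec r s i)), real_of_int (snd (dvec r s i))] =
      dir_matrix j *v vector [real_of_int r, real_of_int s]"
  then have "dir_matrix i *v vector [of_int r, of_int s] = dir_matrix j *v (vector [of_int r, of_int s] :: real^2)"
    using assms(3) dir_matrix_dvec by simp
  then have "(vector [of_int (fst (dvec r s i)), of_int (snd (dvec r s i))] :: real^2) =
      vector [of_int (fst (dvec r s j)), of_int (snd (dvec r s j))]"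
    using j assms(3) by (simp only: dir_matrix_dvec)
  then have "dvec r s i = dvec r s j"
    by (simp only: vector2_eq_iff prod_eq_iff of_int_eq_iff)
  then show "j = i" using dvec_inj[OF assms(1,2)] assms(3) j by (auto dest: inj_onD)
qed

text \<open>The cycle \<open>xs\<close> of an \<open>(r, s)\<close>-leaper whose moves have the directions \<open>ls\<close>, in order.\<close>

definition realizes :: "int \<Rightarrow> int \<Rightarrow> square list \<Rightarrow> nat list \<Rightarrow> bool" where
  "realizes r s xs ls \<longleftrightarrow> 0 < r \<and> r < s \<and> distinct xs \<and> 3 \<le> length xs \<and> length ls = length xs \<and>
     set ls \<subseteq> {1..8} \<and>
     (\<forall>k<length xs. xs ! (Suc k mod length xs) - xs ! k = dvec r s (ls ! k))"

lemma cyclic_arcs_map: "cyclic_arcs (map f xs) = map_prod f f ` cyclic_arcs xs"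
proof -
  have "Suc k mod length xs < length xs" if "k < length xs" for k
    using that by (metis mod_less_divisor not_less_zero gr0I)
  then show ?thesis by (force simp: cyclic_arcs_def image_def)
qed

lemma cyclic_arcs_rotate1: "cyclic_arcs (rotate1 xs) = cyclic_arcs xs"
proof (cases xs)
  case (Cons x ys)
  define n where "n = length xs"
  have n: "0 < n" using Cons n_def by simp
  have r: "rotate1 xs ! k = xs ! (Suc k mod n)" if "k < n" for k
    using that nth_rotate[of k xs 1] by (simp add: n_def)
  have "cyclic_arcs (rotate1 xs) = {(xs ! (Suc k mod n), xs ! (Suc (Suc k mod n) mod n)) |k. k < n}"
    unfolding cyclic_arcs_def by (force simp: r n simp flip: n_def)
  also have "\<dots> = {(xs ! k, xs ! (Suc k mod n)) |k. k < n}"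
  proof -
    have "(\<lambda>k. Suc k mod n) ` {..<n} = {..<n}"
    proof (intro equalityI subsetI)
      fix j assume j: "j \<in> {..<n}"
      show "j \<in> (\<lambda>k. Suc k mod n) ` {..<n}"
      proof (cases j)
        case 0
        have "Suc (n - 1) mod n = j" using n 0 by simp
        then show ?thesis using n by (metis diff_less imageI lessThan_iff zero_less_one)
      next
        case (Suc i)
        then have "Suc i mod n = j" "i < n" using j by auto
        then show ?thesis by (metis imageI lessThan_iff)
      qed
    qed (use n in auto)
    then have "(\<lambda>k. (xs ! k, xs ! (Suc k mod n))) ` ((\<lambda>k. Suc k mod n) ` {..<n}) =
        (\<lambda>k. (xs ! k, xs ! (Suc k mod n))) ` {..<n}" by simp
    then show ?thesis unfolding image_image by (simp add: setcompr_eq_image lessThan_def)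
  qed
  finally show ?thesis by (simp add: cyclic_arcs_def n_def)
qed (simp add: cyclic_arcs_def)

lemma extracted_graph_rotate: "extracted_graph r s (rotate k xs) = extracted_graph r s xs"
proof -
  have "cyclic_arcs (rotate k xs) = cyclic_arcs xs"
    by (induction k) (auto simp: cyclic_arcs_rotate1)
  then show ?thesis by (simp add: extracted_graph_def)
qed

lemma realizes_label:
  assumes "realizes r s xs ls" and "k < length xs"
  shows "label (extracted_graph r s xs) (xs ! k, xs ! (Suc k mod length xs)) = ls ! k"
    and "label (extracted_graph r s xs) (xs ! (Suc k mod length xs), xs ! k) = opp_label (ls ! k)"
proof -
  have "ls ! k \<in> set ls" "set ls \<subseteq> {1..8}" using assms by (simp_all add: realizes_def)
  then have i: "ls ! k \<in> {1..8}" by blast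
  have rs: "0 < r" "r < s"
    and d: "xs ! (Suc k mod length xs) - xs ! k = dvec r s (ls ! k)"
    using assms by (auto simp: realizes_def)
  then show "label (extracted_graph r s xs) (xs ! k, xs ! (Suc k mod length xs)) = ls ! k"
    using move_direction_dvec[OF rs i] by (simp add: extracted_graph_def)
  have "xs ! k - xs ! (Suc k mod length xs) = dvec r s (opp_label (ls ! k))"
    using d dvec_opp[OF i] by (metis minus_diff_eq)
  then show "label (extracted_graph r s xs) (xs ! (Suc k mod length xs), xs ! k) = opp_label (ls ! k)"
    using move_direction_dvec[OF rs opp_label_in[OF i]] by (simp add: extracted_graph_def)
qed

lemma Suc_mod_less: "k < n \<Longrightarrow> Suc k mod n < n"
  by (metis mod_less_divisor not_less_zero gr0I)

lemma realizes_arcE: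
  assumes "realizes r s xs ls" and "(a, b) \<in> parcs (graph (extracted_graph r s xs))"
  obtains k where "k < length xs" "a = xs ! k" "b = xs ! (Suc k mod length xs)"
      "label (extracted_graph r s xs) (a, b) = ls ! k"
  | k where "k < length xs" "b = xs ! k" "a = xs ! (Suc k mod length xs)"
      "label (extracted_graph r s xs) (a, b) = opp_label (ls ! k)"
  using assms(2) realizes_label[OF assms(1)]
  by (auto simp: extracted_graph_def cyclic_arcs_def)

lemma sum_potential_cycle:
  assumes "\<forall>(a, b) \<in> set c. f (a, b) = g b - (g a :: 'b::ab_group_add)"
    and "pre_digraph.cas (with_proj G) u c w"
  shows "(\<Sum>a\<leftarrow>c. f a) = g w - g u"
  using assms
proof (induction c arbitrary: u)
  case Nil
  then show ?case by (simp add: pre_digraph.cas.simps)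
next
  case (Cons e c)
  then show ?case by (cases e) (simp add: pre_digraph.cas.simps)
qed

lemma direction_graph_extracted:
  assumes R: "realizes r s xs ls" and Z: "(\<Sum>i\<leftarrow>ls. dir_matrix i) = 0"
  shows "direction_graph (extracted_graph r s xs)"
proof -
  let ?G = "extracted_graph r s xs"
  let ?n = "length xs"
  have di: "distinct xs" and n: "3 \<le> ?n" and ln: "length ls = ?n" and l8: "set ls \<subseteq> {1..8}"
    using R by (auto simp: realizes_def)
  \<comment> \<open>partial sums of direction matrices are a potential on the squares; the vanishing total sum makes
    it well defined around the cycle, and every arc is labelled with its potential difference\<close>
  define pot where "pot k = (\<Sum>i\<leftarrow>take k ls. dir_matrix i)" for k
  define g where "g a = pot (THE k. k < ?n \<and> xs ! k = a)" for a
  have g: "g (xs ! k) = pot k" if "k < ?n" for k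
  proof -
    have "(THE j. j < ?n \<and> xs ! j = xs ! k) = k"
      using that di by (intro the_equality) (auto simp: nth_eq_iff_index_eq)
    then show ?thesis by (simp add: g_def)
  qed
  have gs: "g (xs ! (Suc k mod ?n)) = pot k + dir_matrix (ls ! k)" if "k < ?n" for k
  proof -
    have S: "pot (Suc k) = pot k + dir_matrix (ls ! k)"
      using that ln by (simp add: pot_def take_Suc_conv_app_nth)
    show ?thesis
    proof (cases "Suc k = ?n")
      case True
      then have "pot (Suc k) = 0" using Z ln by (simp add: pot_def)
      moreover have "g (xs ! 0) = 0" using g[of 0] n by (fastforce simp: pot_def)
      ultimately show ?thesis using True S by simp
    next
      case False
      then show ?thesis using that S g[of "Suc k"] by simp
    qed
  qed
  have arc: "label ?G (a, b) \<in> {1..8} \<and> dir_matrix (label ?G (a, b)) = g b - g a"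
    if "(a, b) \<in> parcs (graph ?G)" for a b
    using R that
  proof (cases rule: realizes_arcE)
    case (1 k)
    then show ?thesis using g gs l8 ln by (auto simp: subset_iff)
  next
    case (2 k)
    then have "ls ! k \<in> {1..8}" using l8 ln by (auto simp: subset_iff)
    then show ?thesis using 2 g gs opp_label_in dir_matrix_opp by auto
  qed
  have av: "a \<in> set xs \<and> b \<in> set xs" if "(a, b) \<in> parcs (graph ?G)" for a b
    using R that by (cases rule: realizes_arcE) (auto simp: Suc_mod_less)
  have "pair_pseudo_graph (graph ?G)"
  proof
    show "fst e \<in> pverts (graph ?G)" "snd e \<in> pverts (graph ?G)" if "e \<in> parcs (graph ?G)" for e
      using av[of "fst e" "snd e"] that by (auto simp: extracted_graph_def)
    show "finite (pverts (graph ?G))" by (simp add: extracted_graph_def)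
    have "parcs (graph ?G) \<subseteq> set xs \<times> set xs" using av by auto
    then show "finite (parcs (graph ?G))" by (rule finite_subset) simp
    show "symmetric (with_proj (graph ?G))"
      by (auto simp: symmetric_def extracted_graph_def intro!: symI)
  qed
  moreover have "(\<Sum>a\<leftarrow>c. dir_matrix (label ?G a)) = 0"
    if c: "pre_digraph.cycle (with_proj (graph ?G)) c" for c
  proof -
    obtain u where u: "set c \<subseteq> parcs (graph ?G)" "pre_digraph.cas (with_proj (graph ?G)) u c u"
      using c unfolding pre_digraph.cycle_def pre_digraph.awalk_def with_proj_simps by auto
    then have "\<forall>(a, b)\<in>set c. dir_matrix (label ?G (a, b)) = g b - g a" using arc by auto
    from sum_potential_cycle[OF this u(2)] show ?thesis by simp
  qed
  ultimately show ?thesis using arc by (auto simp: direction_graph_def)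
qed

lemma matrix_add_rdistrib: "(A + B) ** C = A ** C + (B ** C :: real^2^2)"
  by (simp add: matrix_matrix_mult_def vec_eq_iff distrib_right sum.distrib)

text \<open>
  Two cycles whose direction words correspond, letter by letter, under an equivalence permutation
  have equivalent direction graphs.
\<close>

lemma equivalent_extracted:
  assumes R: "realizes r s xs ls" and R': "realizes r' s' ys (map \<pi> ls)"
    and Z: "(\<Sum>i\<leftarrow>ls. dir_matrix i) = 0"
    and \<pi>: "\<pi> permutes {1..8}" and PQ: "\<forall>i\<in>{1..8}. dir_matrix (\<pi> i) = P ** dir_matrix i ** Q"
  shows "equivalent_graphs (extracted_graph r s xs) (extracted_graph r' s' ys)"
proof -
  let ?G = "extracted_graph r s xs" and ?H = "extracted_graph r' s' ys" and ?n = "length xs"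
  have n: "3 \<le> ?n" and ln: "length ls = ?n" "length ys = ?n" and l8: "set ls \<subseteq> {1..8}"
    and di: "distinct xs" "distinct ys"
    using R R' by (auto simp: realizes_def)
  have "(\<Sum>i\<leftarrow>map \<pi> ls. dir_matrix i) = (\<Sum>i\<leftarrow>ls. P ** dir_matrix i ** Q)"
    using l8 PQ by (simp add: comp_def subset_iff cong: map_cong)
  also have "\<dots> = P ** (\<Sum>i\<leftarrow>ls. dir_matrix i) ** Q"
    proof (induction ls)
    case Nil
    have "P ** 0 ** Q = 0" by (simp add: matrix_matrix_mult_def vec_eq_iff)
    then show ?case by simp
  next
    case (Cons i ls)
    then show ?case by (simp add: matrix_add_ldistrib matrix_add_rdistrib)
  qed
  finally have Z': "(\<Sum>i\<leftarrow>map \<pi> ls. dir_matrix i) = 0" using Z by simp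
  have opp_label: "\<pi> (opp_label i) = opp_label (\<pi> i)" if "i \<in> {1..8}" for i
  proof -
    have in8: "\<pi> i \<in> {1..8}" "\<pi> (opp_label i) \<in> {1..8}"
      using permutes_in_image[OF \<pi>] opp_label_in[OF that] that by blast+
    have "dir_matrix (\<pi> (opp_label i)) = P ** (- dir_matrix i) ** Q"
      using PQ opp_label_in[OF that] dir_matrix_opp[OF that] by metis
    also have "\<dots> = - (P ** dir_matrix i ** Q)"
      by (simp add: matrix_matrix_mult_def vec_eq_iff sum_negf)
    also have "\<dots> = dir_matrix (opp_label (\<pi> i))"
      using PQ that dir_matrix_opp[OF in8(1)] by metis
    finally show ?thesis using dir_matrix_inj in8 opp_label_in[OF in8(1)] by (meson inj_onD)
  qed
  define f where "f a = ys ! (THE k. k < ?n \<and> xs ! k = a)" for a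
  have f: "f (xs ! k) = ys ! k" if "k < ?n" for k
  proof -
    have "(THE j. j < ?n \<and> xs ! j = xs ! k) = k"
      using that di by (intro the_equality) (auto simp: nth_eq_iff_index_eq)
    then show ?thesis by (simp add: f_def)
  qed
  have fm: "map f xs = ys" using f ln by (intro nth_equalityI) auto
  have inj: "inj_on f (set xs)" using di fm by (metis distinct_map)
  have bij: "bij_betw f (set xs) (set ys)" using inj fm by (metis bij_betw_def set_map)
  have arcs: "(a, b) \<in> parcs (graph ?G) \<longleftrightarrow> (f a, f b) \<in> parcs (graph ?H)"
    if "a \<in> set xs" "b \<in> set xs" for a b
  proof -
    have sub: "cyclic_arcs xs \<subseteq> set xs \<times> set xs" by (auto simp: cyclic_arcs_def Suc_mod_less)
    have "cyclic_arcs ys = map_prod f f ` cyclic_arcs xs"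
      using cyclic_arcs_map fm by metis
    moreover have "(f x, f y) \<in> map_prod f f ` cyclic_arcs xs \<longleftrightarrow> (x, y) \<in> cyclic_arcs xs"
      if "x \<in> set xs" "y \<in> set xs" for x y
    proof
      assume "(f x, f y) \<in> map_prod f f ` cyclic_arcs xs"
      then obtain x' y' where *: "(x', y') \<in> cyclic_arcs xs" "f x = f x'" "f y = f y'" by auto
      then have "x = x'" "y = y'" using sub that inj by (auto dest: inj_onD)
      then show "(x, y) \<in> cyclic_arcs xs" using * by simp
    qed force
    ultimately show ?thesis using that by (simp add: extracted_graph_def)
  qed
  have lab: "label ?H (f a, f b) = \<pi> (label ?G (a, b))" if "(a, b) \<in> parcs (graph ?G)" for a b
    using R that
  proof (cases rule: realizes_arcE)
    case (1 k)
    then show ?thesis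
      using realizes_label(1)[OF R', of k] f[of k] f[of "Suc k mod ?n"] ln Suc_mod_less[of k ?n]
      by simp
  next
    case (2 k)
    then have "ls ! k \<in> {1..8}" using l8 ln by (auto simp: subset_iff)
    then show ?thesis
      using 2 realizes_label(2)[OF R', of k] f[of k] f[of "Suc k mod ?n"] ln Suc_mod_less[of k ?n]
      by (simp add: opp_label)
  qed
  have "same_graph (relabel \<pi> ?G) ?H"
    unfolding same_graph_def
  proof (intro exI[of _ f] conjI)
    show "bij_betw f (pverts (graph (relabel \<pi> ?G))) (pverts (graph ?H))"
      using bij by (simp add: relabel_def extracted_graph_def)
    show "\<forall>a\<in>pverts (graph (relabel \<pi> ?G)). \<forall>b\<in>pverts (graph (relabel \<pi> ?G)).
        (a, b) \<in> parcs (graph (relabel \<pi> ?G)) \<longleftrightarrow> (f a, f b) \<in> parcs (graph ?H)"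
      using arcs by (auto simp: relabel_def extracted_graph_def)
    show "\<forall>(a, b)\<in>parcs (graph (relabel \<pi> ?G)).
        label ?H (f a, f b) = label (relabel \<pi> ?G) (a, b)"
      using lab by (auto simp: relabel_def)
  qed
  moreover have "equivalence_permutation \<pi>"
    using \<pi> PQ by (auto simp: equivalence_permutation_def)
  ultimately show ?thesis
    using direction_graph_extracted[OF R Z] direction_graph_extracted[OF R' Z']
    unfolding equivalent_graphs_def by blast
qed

section \<open>Type words\<close>

text \<open>
  The type of a square of the first cycle is \<open>True\<close> in the sections E, N, W, S and \<open>False\<close> in the
  corner sections. A lift replaces each square by one, three or five squares, of the types given by
  \<open>phi\<close>; \<open>first_word e\<close> is the effect of successive lifts.
\<close>

fun phi :: "lift_type \<Rightarrow> bool \<Rightarrow> bool list" where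
  "phi LF t = (if t then [True] else [True, False, True])"
| "phi LG t = (if t then [False, True, False] else [False])"
| "phi LH t = (if t then [True, False, True, False, True] else [True, False, True])"

primrec first_word :: "lift_type list \<Rightarrow> bool list \<Rightarrow> bool list" where
  "first_word [] ts = ts"
| "first_word (x # e) ts = concat (map (phi x) (first_word e ts))"

lemma first_word_append: "first_word e (ts @ ts') = first_word e ts @ first_word e ts'"
  by (induction e) auto

lemma first_word_snoc: "first_word (e @ [x]) ts = first_word e (concat (map (phi x) ts))"
  by (induction e) auto

text \<open>
  The paths of a second cycle have one type word in the even sections and another one in the odd
  sections. If a path between two others is put together with them, then the two outermost steps
  change their type to the first type of the middle path.
\<close>

definition surround :: "bool list \<Rightarrow> bool list \<Rightarrow> bool list" where
  "surround a b = hd b # tl a @ b @ butlast a @ [hd b]"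

text \<open>
  The pair of type words is a function \<open>T\<close>, with \<open>T True\<close> for the even sections. For
  nonempty words, the value of \<open>LH\<close> in the even sections is
  \<open>surround (T True) (T False @ T True @ T False)\<close>.
\<close>

fun join_word :: "lift_type \<Rightarrow> (bool \<Rightarrow> bool list) \<Rightarrow> bool \<Rightarrow> bool list" where
  "join_word LF T t = (if t then surround (T False) (T True) else T False)"
| "join_word LG T t = (if t then T True else surround (T True) (T False))"
| "join_word LH T t =
     (if t then hd (T False) # tl (T True) @ T False @ T True @ T False @ butlast (T True) @ [hd (T False)]
      else T True @ T False @ T True)"

primrec second_word :: "lift_type list \<Rightarrow> bool \<Rightarrow> bool list" where
  "second_word [] = (\<lambda>t. [t])"
| "second_word (x # e) = join_word x (second_word e)"

text \<open>
  The relation between the words \<open>Xe\<close>, \<open>Xo\<close> of the types \<open>True\<close> and \<open>False\<close> after the first lifts of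
  descent \<open>e\<close> and the words \<open>Se\<close>, \<open>So\<close> obtained from the second cycle of descent \<open>flip e\<close> by
  exchanging the types (and hence also the two words). In the free group it says that
  \<open>Se = u Xe u'\<close>, \<open>Xo = u' So u\<close> and \<open>u Xe = p u\<close>, where \<open>u'\<close> is the reversal of \<open>u\<close> and \<open>p\<close> is
  \<open>So\<close> with its first letter replaced by that of \<open>Se\<close>. Then \<open>Se So = u (Xe Xo) u\<^sup>-\<^sup>1\<close>. The second
  alternative is the case in which \<open>v = u\<^sup>-\<^sup>1\<close> is a word instead of \<open>u\<close>.
\<close>

definition linked :: "bool list \<Rightarrow> bool list \<Rightarrow> bool list \<Rightarrow> bool list \<Rightarrow> bool" where
  "linked Xe Xo Se So \<longleftrightarrow> rev Xe = Xe \<and> rev Xo = Xo \<and> rev Se = Se \<and> rev So = So \<and> Se \<noteq> [] \<and> So \<noteq> [] \<and>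
     ((\<exists>u. Se = u @ Xe @ rev u \<and> Xo = rev u @ So @ u \<and> u @ Xe = hd Se # tl So @ u) \<or>
      (\<exists>v. Xe = v @ Se @ rev v \<and> So = rev v @ Xo @ v \<and> Xe @ v = v @ hd Se # tl So))"

lemma append_eq_append: "a @ b = c \<Longrightarrow> a @ b @ w = c @ w"
  by (metis append_assoc)

text \<open>The two cases, with the words decomposed and the equations oriented for rewriting.\<close>

lemma linkedE [consumes 1, case_names pos neg]:
  assumes "linked Xe Xo Se So"
  obtains u s ye yo where "rev Xe = Xe" "rev So = So"
      "Se = u @ Xe @ rev u" "Xo = rev u @ So @ u" "So = yo # s" "hd Se = ye"
      "ye # s @ u = u @ Xe" "rev u @ rev s @ [ye] = Xe @ rev u"
  | v z ye yo where "rev Xo = Xo" "rev Se = Se"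
      "Xe = v @ Se @ rev v" "So = rev v @ Xo @ v" "Se = ye # z" "hd So = yo" 
      "yo # z @ rev v = rev v @ Xo" "v @ rev z @ [yo] = Xo @ v"
      "hd Se # tl So = Se @ rev v @ v"
proof -
  obtain ye z where z: "Se = ye # z" using assms by (cases Se) (auto simp: linked_def)
  obtain yo s where s: "So = yo # s" using assms by (cases So) (auto simp: linked_def)
  have pal: "rev Xe = Xe" "rev Xo = Xo" "rev Se = Se" "rev So = So" using assms by (auto simp: linked_def)
  from assms consider
    (P) u where "Se = u @ Xe @ rev u" "Xo = rev u @ So @ u" "u @ Xe = ye # s @ u"
  | (N) v where "Xe = v @ Se @ rev v" "So = rev v @ Xo @ v" "Xe @ v = v @ ye # s"
    using z s by (auto simp: linked_def)
  then show ?thesis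
  proof cases
    case P
    then have "rev (u @ Xe) = rev (ye # s @ u)" by simp
    then have r: "rev u @ rev s @ [ye] = Xe @ rev u" using pal by simp
    have "hd Se = ye" using z by simp
    from that(1)[OF pal(1,4) P(1,2) s this P(3)[symmetric] r] show ?thesis .
  next
    case N
    then have "ye # s = Se @ rev v @ v" by simp
    then have s': "s = z @ rev v @ v" using z by simp
    then have a: "yo # z @ rev v = rev v @ Xo" using N(2) s by simp
    then have "rev (yo # z @ rev v) = rev (rev v @ Xo)" by simp
    then have b: "v @ rev z @ [yo] = Xo @ v" using pal by simp
    have "hd So = yo" "hd Se # tl So = Se @ rev v @ v" using s z s' by simp_all
    from that(2)[OF pal(2,3) N(1,2) z this(1) a b this(2)] show ?thesis .
  qed
qed

lemma surround_pal:
  assumes "rev a = a" "a \<noteq> []"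
  shows "hd b # tl a @ w @ butlast a @ [hd b] = (hd b # tl a) @ w @ rev (hd b # tl a)"
  using assms by (metis append.assoc append_Cons butlast_rev rev.simps(2))

text \<open>
  The conjugating element \<open>u\<close> becomes \<open>u Xe\<close> under \<open>LF\<close>, \<open>u Xo\<^sup>-\<^sup>1\<close> under \<open>LG\<close>, and the inverse
  of \<open>Xe u'\<close> under \<open>LH\<close>, where \<open>u'\<close> is the reversal of \<open>u\<close>. Each of these is again a word or the
  inverse of a word.
\<close>

lemma linked_LF:
  assumes "linked Xe Xo Se So"
  shows "linked Xe (Xe @ Xo @ Xe) (surround So Se) So"
proof -
  have pal: "rev Xe = Xe" "rev Xo = Xo" "rev Se = Se" "rev So = So" "Se \<noteq> []" "So \<noteq> []"
    using assms by (auto simp: linked_def)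
  let ?p = "hd Se # tl So"
  have p: "surround So Se = ?p @ Se @ rev ?p"
    unfolding surround_def using surround_pal pal by metis
  have ex: "\<exists>u. surround So Se = u @ Xe @ rev u \<and> Xe @ Xo @ Xe = rev u @ So @ u \<and>
      u @ Xe = hd (surround So Se) # tl So @ u"
    using assms
  proof (cases rule: linkedE)
    case (pos u s ye yo)
    have p': "?p = ye # s" using pos(5,6) by simp
    have e: "ye # s @ u @ w = u @ Xe @ w" "rev u @ rev s @ ye # w = Xe @ rev u @ w" for w
      using append_eq_append[of "ye # s" u] append_eq_append[of "rev u" "rev s @ [ye]"] pos(7,8) by simp_all
    have h: "hd ((ye # s) @ Se @ rev (ye # s)) # tl So @ u @ Xe = ye # s @ u @ Xe"
      using pos(5) by simp
    show ?thesis unfolding p p'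
      by (rule exI[of _ "u @ Xe"], unfold h) (simp only: append_Nil2 pos(1,3,4,7,8) e append_assoc append.simps rev_append rev.simps rev_rev_ident list.sel simp_thms)
  next
    case (neg v z ye yo)
    have h: "hd ((Se @ rev v @ v) @ Se @ rev (Se @ rev v @ v)) # tl So = Se @ rev v @ v"
      using neg(5,9) by simp
    have h': "w # tl So @ x = (w # tl So) @ x" for w x by simp
    show ?thesis unfolding p neg(9)
      by (rule exI[of _ "Se @ rev v"], unfold h' h) (simp only: neg(2,3,4) append_assoc append.simps rev_append rev.simps rev_rev_ident simp_thms)
  qed
  have r1: "rev (surround So Se) = surround So Se" "surround So Se \<noteq> []" by (simp_all only: p rev_append rev.simps rev_rev_ident pal append_assoc append.simps list.distinct simp_thms)
  have r2: "rev (Xe @ Xo @ Xe) = Xe @ Xo @ Xe" by (simp only: rev_append pal append_assoc)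
  show ?thesis unfolding linked_def 
    by (intro conjI disjI1 ex) (fact pal r1 r2)+
qed

lemma linked_LG:
  assumes "linked Xe Xo Se So"
  shows "linked (Xo @ Xe @ Xo) Xo Se (surround Se So)"
proof -
  have pal: "rev Xe = Xe" "rev Xo = Xo" "rev Se = Se" "rev So = So" "Se \<noteq> []" "So \<noteq> []"
    using assms by (auto simp: linked_def)
  let ?q = "hd So # tl Se"
  have q: "surround Se So = ?q @ So @ rev ?q"
    unfolding surround_def using surround_pal pal by metis
  have ex: "\<exists>v. Xo @ Xe @ Xo = v @ Se @ rev v \<and> surround Se So = rev v @ Xo @ v \<and>
      (Xo @ Xe @ Xo) @ v = v @ hd Se # tl (surround Se So)"
    using assms
  proof (cases rule: linkedE)
    case (pos u s ye yo)
    have e: "ye # s @ u @ w = u @ Xe @ w" for w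
      using append_eq_append[of "ye # s" u] pos(7) by simp
    have "ye # tl Se = Se" using pos(6) pal(5) list.collapse by blast
    also have "\<dots> = u @ Xe @ rev u" by (fact pos(3))
    also have "\<dots> = ye # s @ u @ rev u" by (rule e[symmetric])
    finally have q': "?q = So @ u @ rev u" using pos(5) by simp
    have "hd Se # tl ((So @ u @ rev u) @ So @ rev (So @ u @ rev u)) =
        ye # s @ u @ rev u @ So @ rev (So @ u @ rev u)"
      unfolding pos(6) by (simp add: pos(5))
    also have "\<dots> = u @ Xe @ rev u @ So @ u @ rev u @ So"
      unfolding e by (simp only: rev_append rev_rev_ident append_assoc pos(2))
    finally have h: "hd Se # tl ((So @ u @ rev u) @ So @ rev (So @ u @ rev u)) =
        u @ Xe @ rev u @ So @ u @ rev u @ So" .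
    show ?thesis unfolding q q' h
      by (rule exI[of _ "rev u @ So"]) (simp only: pos(1,2,3,4) append_assoc append.simps rev_append rev.simps rev_rev_ident simp_thms)
  next
    case (neg v z ye yo)
    have q': "?q = yo # z" using neg(5,6) by simp
    have e: "yo # z @ rev v @ w = rev v @ Xo @ w" "v @ rev z @ yo # w = Xo @ v @ w" for w
      using append_eq_append[of "yo # z" "rev v"] append_eq_append[of v "rev z @ [yo]"] neg(7,8) by simp_all
    have h: "hd Se # tl ((yo # z) @ So @ rev (yo # z)) = Se @ So @ rev (yo # z)" using neg(5) by simp
    show ?thesis unfolding q q' h
      by (rule exI[of _ "Xo @ v"]) (simp only: append_Nil2 neg(1,2,3,4,7,8) e append_assoc append.simps rev_append rev.simps rev_rev_ident simp_thms)
  qed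
  have r1: "rev (surround Se So) = surround Se So" "surround Se So \<noteq> []" by (simp_all only: q rev_append rev.simps rev_rev_ident pal append_assoc append.simps list.distinct simp_thms)
  have r2: "rev (Xo @ Xe @ Xo) = Xo @ Xe @ Xo" by (simp only: rev_append pal append_assoc)
  show ?thesis unfolding linked_def 
    by (intro conjI disjI2 ex) (fact pal r1 r2)+
qed

lemma linked_LH:
  assumes "linked Xe Xo Se So"
  shows "linked (Xe @ Xo @ Xe @ Xo @ Xe) (Xe @ Xo @ Xe) (So @ Se @ So)
    (hd Se # tl So @ Se @ So @ Se @ butlast So @ [hd Se])"
proof -
  have pal: "rev Xe = Xe" "rev Xo = Xo" "rev Se = Se" "rev So = So" "Se \<noteq> []" "So \<noteq> []"
    using assms by (auto simp: linked_def)
  let ?p = "hd Se # tl So"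
  have p: "hd Se # tl So @ Se @ So @ Se @ butlast So @ [hd Se] = ?p @ (Se @ So @ Se) @ rev ?p"
    using surround_pal[OF pal(4,6), of Se "Se @ So @ Se"] by (simp only: append_assoc)
  have ex: "\<exists>v. Xe @ Xo @ Xe @ Xo @ Xe = v @ (So @ Se @ So) @ rev v \<and>
      ?p @ (Se @ So @ Se) @ rev ?p = rev v @ (Xe @ Xo @ Xe) @ v \<and>
      (Xe @ Xo @ Xe @ Xo @ Xe) @ v = v @ hd (So @ Se @ So) # tl (?p @ (Se @ So @ Se) @ rev ?p)"
    using assms
  proof (cases rule: linkedE)
    case (pos u s ye yo)
    have p': "?p = ye # s" using pos(5,6) by simp
    have e: "ye # s @ u @ w = u @ Xe @ w" "rev u @ rev s @ ye # w = Xe @ rev u @ w" for w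
      using append_eq_append[of "ye # s" u] append_eq_append[of "rev u" "rev s @ [ye]"] pos(7,8) by simp_all
    have h: "hd (So @ Se @ So) # tl ((ye # s) @ (Se @ So @ Se) @ rev (ye # s)) =
        So @ (Se @ So @ Se) @ rev (ye # s)" using pos(5) by simp
    show ?thesis unfolding p' h
      by (rule exI[of _ "Xe @ rev u"]) (simp only: append_Nil2 pos(1,2,3,4,7,8) e append_assoc append.simps rev_append rev.simps rev_rev_ident simp_thms)
  next
    case (neg v z ye yo)
    have "hd (So @ Se @ So) # tl (?p @ (Se @ So @ Se) @ rev ?p) = So @ (Se @ So @ Se) @ rev ?p"
      using pal by (cases So) auto
    note h = this[unfolded neg(9)]
    show ?thesis unfolding neg(9) h
      by (rule exI[of _ "v @ Se"]) (simp only: neg(1,2,3,4) append_assoc append.simps rev_append rev.simps rev_rev_ident simp_thms)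
  qed
  have r1: "rev (?p @ (Se @ So @ Se) @ rev ?p) = ?p @ (Se @ So @ Se) @ rev ?p"
    "?p @ (Se @ So @ Se) @ rev ?p \<noteq> []" "rev (So @ Se @ So) = So @ Se @ So" "So @ Se @ So \<noteq> []"
    using pal(5,6) by (simp_all only: rev_append rev.simps rev_rev_ident pal append_assoc append.simps list.distinct append_is_Nil_conv simp_thms)
  have r2: "rev (Xe @ Xo @ Xe) = Xe @ Xo @ Xe" "rev (Xe @ Xo @ Xe @ Xo @ Xe) = Xe @ Xo @ Xe @ Xo @ Xe"
    by (simp_all only: rev_append pal append_assoc)
  show ?thesis unfolding linked_def p
    by (intro conjI disjI2 ex) (fact pal r1 r2)+
qed

lemma map_Not_surround: "a \<noteq> [] \<Longrightarrow> b \<noteq> [] \<Longrightarrow>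
    map Not (surround a b) = surround (map Not a) (map Not b)"
  by (simp add: surround_def hd_map map_tl map_butlast)

lemma flip_snoc: "flip (e @ [x]) = flip_char x # flip e"
  by (simp add: flip_def)

lemma flip_flip: "flip (flip e) = e"
proof -
  have "flip_char (flip_char x) = x" for x by (cases x) auto
  then show ?thesis by (induction e) (auto simp: flip_def rev_map)
qed

text \<open>
  A new last letter of \<open>e\<close> is a new first letter of \<open>flip e\<close>: the innermost lift of the first cycle
  corresponds to the outermost lift of the second one.
\<close>

lemma linked_words:
  "linked (first_word e [True]) (first_word e [False]) (map Not (second_word (flip e) False)) (map Not (second_word (flip e) True))"
proof (induction e rule: rev_induct)
  case Nil
  then show ?case by (simp add: linked_def flip_def exI[of _ "[]"])
next
  case (snoc x e)
  let ?Xe = "first_word e [True]" and ?Xo = "first_word e [False]" and ?T = "second_word (flip e)"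
  have ne: "?T True \<noteq> []" "?T False \<noteq> []" using snoc by (auto simp: linked_def)
  have Xs: "first_word e (t # ts) = first_word e [t] @ first_word e ts" for t ts
    using first_word_append[of e "[t]" ts] by simp
  show ?case
  proof (cases x)
    case LF
    then show ?thesis using linked_LF[OF snoc] ne
      by (simp add: first_word_snoc flip_snoc map_Not_surround Xs[of _ "_ # _"])
  next
    case LG
    then show ?thesis using linked_LG[OF snoc] ne
      by (simp add: first_word_snoc flip_snoc map_Not_surround Xs[of _ "_ # _"])
  next
    case LH
    then show ?thesis using linked_LH[OF snoc] ne
      by (simp add: first_word_snoc flip_snoc Xs[of _ "_ # _"] hd_map map_tl map_butlast)
  qed
qed

lemma map_Not_eq_iff: "map Not a = map Not b \<longleftrightarrow> a = b"
  by (simp add: inj_map_eq_map inj_def)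

lemma second_word_ne: "second_word e t \<noteq> []"
  using linked_words[of "flip e"] by (cases t) (auto simp: linked_def flip_flip)

lemma second_word_pal: "rev (second_word e t) = second_word e t"
proof -
  have "map Not (rev (second_word e t)) = map Not (second_word e t)"
    using linked_words[of "flip e"] by (cases t) (auto simp: linked_def flip_flip rev_map)
  then show ?thesis by (simp only: map_Not_eq_iff)
qed

lemma rotate_concat_replicate:
  "rotate (length a) (concat (replicate n (a @ b))) = concat (replicate n (b @ a))"
proof (cases n)
  case (Suc m)
  have c: "concat (replicate k (a @ b)) @ a = a @ concat (replicate k (b @ a))" for k
    by (induction k) auto
  have "rotate (length a) (a @ (b @ concat (replicate m (a @ b)))) =
      (b @ concat (replicate m (a @ b))) @ a" by (rule rotate_append)
  also have "\<dots> = concat (replicate n (b @ a))" using Suc c[of m] by simp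
  finally show ?thesis using Suc by simp
qed simp

lemma first_word_replicate: "first_word e (concat (replicate n ts)) = concat (replicate n (first_word e ts))"
proof (induction n)
  case 0
  show ?case by (induction e) auto
qed (simp add: first_word_append)

lemma second_word_rotation:
  "\<exists>k. concat (replicate n (second_word (flip e) True @ second_word (flip e) False)) =
     map Not (rotate k (first_word e (concat (replicate n [True, False]))))"
proof -
  define Xe Xo where "Xe = first_word e [True]" and "Xo = first_word e [False]"
  define Se So where "Se = map Not (second_word (flip e) False)" and "So = map Not (second_word (flip e) True)"
  have X: "first_word e [True, False] = Xe @ Xo" using first_word_append[of e "[True]" "[False]"] by (simp add: Xe_def Xo_def)
  have "linked Xe Xo Se So" unfolding Xe_def Xo_def Se_def So_def by (rule linked_words)
  then have "\<exists>a b. Xe @ Xo = a @ b \<and> So @ Se = b @ a"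
  proof (cases rule: linkedE)
    case (pos u s ye yo)
    then show ?thesis by (intro exI[of _ "Xe @ rev u"] exI[of _ "So @ u"]) simp
  next
    case (neg v z ye yo)
    have "Xe @ Xo = (v @ Se) @ (rev v @ Xo)" "So @ Se = (rev v @ Xo) @ (v @ Se)"
      using neg(3,4) by simp_all
    then show ?thesis by blast
  qed
  then obtain a b where ab: "Xe @ Xo = a @ b" "So @ Se = b @ a" by blast
  have "map Not (concat (replicate n (second_word (flip e) True @ second_word (flip e) False))) =
      concat (replicate n (So @ Se))"
    by (simp add: So_def Se_def map_concat)
  also have "\<dots> = rotate (length a) (first_word e (concat (replicate n [True, False])))"
    by (simp only: ab first_word_replicate X rotate_concat_replicate)
  finally have "map Not (map Not (concat (replicate n (second_word (flip e) True @ second_word (flip e) False)))) =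
      map Not (rotate (length a) (first_word e (concat (replicate n [True, False]))))" by simp
  moreover have "map Not (map Not w) = w" for w by (simp add: comp_def)
  ultimately show ?thesis by metis
qed

section \<open>Equivalent labellings\<close>

text \<open>
  The labels of the direction indices for first cycles, and for second cycles of origins g and h.
\<close>

definition first_label :: "nat \<Rightarrow> nat" where "first_label k = [5, 2, 7, 4, 1, 6, 3, 8] ! k"
definition second_label_g :: "nat \<Rightarrow> nat" where "second_label_g k = [2, 5, 4, 7, 6, 1, 8, 3] ! k"
definition second_label_h :: "nat \<Rightarrow> nat" where "second_label_h k = [3, 4, 5, 6, 7, 8, 1, 2] ! k"

lemmas label_defs = first_label_def second_label_g_def second_label_h_def

text \<open>
  The eight isometries of the cycle of indices which exchange the two types of steps. They act
  transitively on the indices.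
\<close>

definition kappa :: "nat \<Rightarrow> nat \<Rightarrow> nat" where
  "kappa c k = (if odd c then k + c else c + 8 - k) mod 8"

lemma lessThan_eight: "{..<8::nat} = {0, 1, 2, 3, 4, 5, 6, 7}"
  by auto

lemma All_less_eight: "(\<forall>k<8. P k) \<longleftrightarrow> P 0 \<and> P 1 \<and> P 2 \<and> P 3 \<and> P 4 \<and> P 5 \<and> P 6 \<and> P (7::nat)"
  using lessThan_eight by (metis (no_types, lifting) insertE insertI1 insertI2 lessThan_iff singletonD)

lemma bij_label: "bij_betw first_label {..<8} {1..8}" "bij_betw second_label_g {..<8} {1..8}" "bij_betw second_label_h {..<8} {1..8}"
  unfolding bij_betw_def inj_on_def lessThan_eight one_to_eight by (auto simp: label_defs)

lemma kappa_step:
  assumes "c < 8" "k < 8"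
  shows "kappa c (step t k) = step (\<not> t) (kappa c k)"
proof -
  have "\<forall>c<8. \<forall>k<8. kappa c (step t k) = step (\<not> t) (kappa c k)"
    unfolding All_less_eight by (cases t) (simp_all add: kappa_def step_def)
  then show ?thesis using assms by blast
qed

lemma bij_kappa: "c < 8 \<Longrightarrow> bij_betw (kappa c) {..<8} {..<8}"
proof -
  have "\<forall>c<8. bij_betw (kappa c) {..<8} {..<8}"
    unfolding All_less_eight bij_betw_def inj_on_def lessThan_eight by (auto simp: kappa_def)
  then show "c < 8 \<Longrightarrow> ?thesis" by blast
qed

lemma kappa_transitive:
  assumes "k < 8" "j < 8"
  obtains c where "c < 8" "kappa c k = j"
proof -
  have "\<forall>k<8. \<forall>j<8. kappa (if odd (j + k) then (j + 8 - k) mod 8 else (j + k) mod 8) k = j"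
    unfolding All_less_eight by (simp add: kappa_def)
  moreover have "(if odd (j + k) then (j + 8 - k) mod 8 else (j + k) mod 8) < 8" by simp
  ultimately show ?thesis using that assms by blast
qed

definition labelling_equiv :: "(nat \<Rightarrow> nat) \<Rightarrow> (nat \<Rightarrow> nat) \<Rightarrow> (nat \<Rightarrow> nat) \<Rightarrow> bool" where
  "labelling_equiv lab lab' \<kappa> \<longleftrightarrow>
     (\<exists>P Q :: real^2^2. \<forall>k<8. dir_matrix (lab' (\<kappa> k)) = P ** dir_matrix (lab k) ** Q)"

text \<open>
  In terms of direction matrices, a step is right multiplication by one of two reflections. The
  matrices \<open>P\<close> and \<open>Q\<close> are multiples of symmetries of a regular octagon, and not of a square, so that
  they do not occur among the direction matrices; conjugation by \<open>Q\<close>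
  takes the two reflections of a first cycle to those of a second cycle with the types exchanged,
  and \<open>P\<close> is then determined by the image of a single index.
\<close>

lemma labelling_equiv_g: "c < 8 \<Longrightarrow> labelling_equiv first_label second_label_g (kappa c)"
proof -
  have "\<forall>c<8. \<forall>k<8. dir_matrix (second_label_g (kappa c k)) =
      dir_matrix (second_label_g c) ** mat2 (-1/2) (-1/2) (-1/2) (1/2) ** dir_matrix (first_label k) ** mat2 1 (-1) 1 1"
    unfolding All_less_eight by (simp add: label_defs kappa_def dir_matrix_simps mat2_mult)
  then show "c < 8 \<Longrightarrow> ?thesis" unfolding labelling_equiv_def by blast
qed

lemma labelling_equiv_h: "c < 8 \<Longrightarrow> labelling_equiv first_label second_label_h (kappa c)"
proof -
  have "\<forall>c<8. \<forall>k<8. dir_matrix (second_label_h (kappa c k)) =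
      dir_matrix (second_label_h c) ** mat2 (-1/2) (-1/2) (1/2) (-1/2) ** dir_matrix (first_label k) ** mat2 1 1 1 (-1)"
    unfolding All_less_eight by (simp add: label_defs kappa_def dir_matrix_simps mat2_mult)
  then show "c < 8 \<Longrightarrow> ?thesis" unfolding labelling_equiv_def by blast
qed

lemma labelling_equiv_gh: "labelling_equiv second_label_g second_label_h id"
proof -
  have "\<forall>k<8. dir_matrix (second_label_h (id k)) =
      mat2 1 0 0 1 ** dir_matrix (second_label_g k) ** mat2 (-1) 0 0 1"
    unfolding All_less_eight by (simp add: label_defs dir_matrix_simps mat2_mult)
  then show ?thesis unfolding labelling_equiv_def by blast
qed

text \<open>A closed walk of an \<open>(r, s)\<close>-leaper without repeated squares.\<close>

definition closed_trail ::
  "int \<Rightarrow> int \<Rightarrow> (nat \<Rightarrow> nat) \<Rightarrow> square \<Rightarrow> nat \<Rightarrow> bool list \<Rightarrow> bool" where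
  "closed_trail r s lab a d ts \<longleftrightarrow> 0 < r \<and> r < s \<and> d < 8 \<and> 3 \<le> length ts \<and> dir_end d ts = d \<and>
     sq_end (dvec r s \<circ> lab) a d ts = a \<and> distinct (squares (dvec r s \<circ> lab) a d ts)"

lemma closed_trail_realizes:
  assumes "closed_trail r s lab a d ts" and "bij_betw lab {..<8} {1..8}"
  shows "realizes r s (squares (dvec r s \<circ> lab) a d ts) (map lab (dirs d ts))"
proof -
  have "set (map lab (dirs d ts)) \<subseteq> {1..8}"
    using set_dirs[of d ts] assms(2) by (auto simp: bij_betw_def)
  then show ?thesis
    using assms(1) squares_nth_cyclic[of "dvec r s \<circ> lab" a d ts]
    unfolding closed_trail_def realizes_def by simp
qed

lemma closed_trail_rotate:
  assumes "closed_trail r s lab a d ts"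
  shows "\<exists>a' d'. closed_trail r s lab a' d' (rotate k ts) \<and>
    squares (dvec r s \<circ> lab) a' d' (rotate k ts) = rotate k (squares (dvec r s \<circ> lab) a d ts) \<and>
    mset (dirs d' (rotate k ts)) = mset (dirs d ts)"
proof (induction k)
  case 0
  show ?case using assms by (intro exI[of _ a] exI[of _ d]) simp
next
  case (Suc k)
  let ?v = "dvec r s \<circ> lab"
  from Suc obtain a' d' where IH: "closed_trail r s lab a' d' (rotate k ts)"
    "squares ?v a' d' (rotate k ts) = rotate k (squares ?v a d ts)"
    "mset (dirs d' (rotate k ts)) = mset (dirs d ts)" by blast
  obtain t ts' where ts': "rotate k ts = t # ts'"
    using IH(1) by (cases "rotate k ts") (auto simp: closed_trail_def)
  let ?d = "step t d'"
  let ?a = "a' + ?v ?d"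
  have e: "dir_end ?d ts' = d'" "sq_end ?v ?a ?d ts' = a'"
    using IH(1) ts' by (auto simp: closed_trail_def)
  have sq: "squares ?v ?a ?d (rotate (Suc k) ts) = rotate (Suc k) (squares ?v a d ts)"
    using IH(2)[symmetric] ts' e by (simp add: squares_append)
  have "closed_trail r s lab ?a ?d (rotate (Suc k) ts)"
    using IH(1) ts' e sq assms distinct_rotate[of "Suc k"]
    unfolding closed_trail_def by (simp add: sq_end_append)
  moreover have "mset (dirs ?d (rotate (Suc k) ts)) = mset (dirs d ts)"
    using IH(3) ts' e by (simp add: dirs_append)
  ultimately show ?case using sq by blast
qed

lemma dirs_map:
  assumes "\<And>t k. k < 8 \<Longrightarrow> \<kappa> (step t k) = step (\<nu> t) (\<kappa> k)" and "d < 8"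
  shows "dirs (\<kappa> d) (map \<nu> ts) = map \<kappa> (dirs d ts)"
  using assms(2)
proof (induction ts arbitrary: d)
  case (Cons t ts)
  then show ?case using assms(1)[of d t] Cons.IH[of "step t d"] by simp
qed simp

lemma equivalent_trails:
  assumes T: "closed_trail r s lab a d ts" and T': "closed_trail r' s' lab' a' (\<kappa> d) (map \<nu> ts)"
    and lab: "bij_betw lab {..<8} {1..8}" "bij_betw lab' {..<8} {1..8}" "bij_betw \<kappa> {..<8} {..<8}"
    and eq: "labelling_equiv lab lab' \<kappa>"
    and \<kappa>: "\<And>t k. k < 8 \<Longrightarrow> \<kappa> (step t k) = step (\<nu> t) (\<kappa> k)"
    and Z: "(\<Sum>k\<leftarrow>dirs d ts. dir_matrix (lab k)) = 0"
  shows "equivalent_graphs (extracted_graph r s (squares (dvec r s \<circ> lab) a d ts))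
    (extracted_graph r' s' (squares (dvec r' s' \<circ> lab') a' (\<kappa> d) (map \<nu> ts)))"
proof -
  \<comment> \<open>the permutation of labels induced by the permutation \<open>\<kappa>\<close> of indices\<close>
  define \<pi> where "\<pi> i = (if i \<in> {1..8} then lab' (\<kappa> (the_inv_into {..<8} lab i)) else i)" for i
  have \<pi>: "\<pi> (lab k) = lab' (\<kappa> k)" if "k < 8" for k
    using that lab(1) by (auto simp: \<pi>_def bij_betw_def the_inv_into_f_f)
  have "bij_betw (lab' \<circ> \<kappa> \<circ> the_inv_into {..<8} lab) {1..8} {1..8}"
    using lab bij_betw_the_inv_into bij_betw_trans by (metis (no_types, lifting))
  then have "bij_betw \<pi> {1..8} {1..8}"
    by (rule iffD1[OF bij_betw_cong, rotated]) (simp add: \<pi>_def)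
  then have perm: "\<pi> permutes {1..8}"
    by (rule bij_imp_permutes) (auto simp: \<pi>_def)
  obtain P Q where PQ: "\<forall>k<8. dir_matrix (lab' (\<kappa> k)) = P ** dir_matrix (lab k) ** Q"
    using eq by (auto simp: labelling_equiv_def)
  have PQ': "\<forall>i\<in>{1..8}. dir_matrix (\<pi> i) = P ** dir_matrix i ** Q"
  proof
    fix i :: nat
    assume "i \<in> {1..8}"
    then have "i \<in> lab ` {..<8}" using lab(1) by (simp only: bij_betw_def)
    then obtain k where "k < 8" "i = lab k" by auto
    then show "dir_matrix (\<pi> i) = P ** dir_matrix i ** Q" using PQ \<pi> by simp
  qed
  have d: "d < 8" using T by (simp add: closed_trail_def)
  have "map lab' (dirs (\<kappa> d) (map \<nu> ts)) = map \<pi> (map lab (dirs d ts))"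
  proof -
    have "dirs (\<kappa> d) (map \<nu> ts) = map \<kappa> (dirs d ts)" by (rule dirs_map[OF \<kappa> d])
    then show ?thesis using \<pi> set_dirs[of d ts] by (auto simp: subset_iff)
  qed
  then have R': "realizes r' s' (squares (dvec r' s' \<circ> lab') a' (\<kappa> d) (map \<nu> ts)) (map \<pi> (map lab (dirs d ts)))"
    using closed_trail_realizes[OF T' lab(2)] by simp
  show ?thesis
    by (rule equivalent_extracted[OF closed_trail_realizes[OF T lab(1)] R' _ perm PQ'])
      (use Z in \<open>simp add: comp_def\<close>)
qed

lemma equivalent_first_second:
  assumes T: "closed_trail r s first_label a d ts" and T': "closed_trail r' s' lab' a' d' (map Not (rotate k ts))"
    and lab': "bij_betw lab' {..<8} {1..8}" "\<And>c. c < 8 \<Longrightarrow> labelling_equiv first_label lab' (kappa c)"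
    and Z: "(\<Sum>k\<leftarrow>dirs d ts. dir_matrix (first_label k)) = 0"
  shows "equivalent_graphs (extracted_graph r s (squares (dvec r s \<circ> first_label) a d ts))
    (extracted_graph r' s' (squares (dvec r' s' \<circ> lab') a' d' (map Not (rotate k ts))))"
proof -
  obtain b e where b: "closed_trail r s first_label b e (rotate k ts)"
    "squares (dvec r s \<circ> first_label) b e (rotate k ts) = rotate k (squares (dvec r s \<circ> first_label) a d ts)"
    "mset (dirs e (rotate k ts)) = mset (dirs d ts)"
    using closed_trail_rotate[OF T] by blast
  have "e < 8" "d' < 8" using b T' by (auto simp: closed_trail_def)
  \<comment> \<open>any relabelling that matches the two initial directions matches all of them\<close>
  then obtain c where c: "c < 8" "kappa c e = d'" using kappa_transitive by blast
  have "(\<Sum>k\<leftarrow>dirs e (rotate k ts). dir_matrix (first_label k)) = 0"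
    using Z b(3) by (metis mset_map sum_mset_sum_list)
  then have "equivalent_graphs (extracted_graph r s (squares (dvec r s \<circ> first_label) b e (rotate k ts)))
    (extracted_graph r' s' (squares (dvec r' s' \<circ> lab') a' (kappa c e) (map Not (rotate k ts))))"
    using equivalent_trails[OF b(1) _ bij_label(1) lab'(1) bij_kappa[OF c(1)] lab'(2)[OF c(1)] kappa_step[OF c(1)]]
      T' c(2) by simp
  then show ?thesis unfolding b(2) c(2) extracted_graph_rotate .
qed

text \<open>The effect of a rotation of the board by 90 degrees on direction indices.\<close>

abbreviation quarter :: "nat \<Rightarrow> nat" where "quarter k \<equiv> (k + 2) mod 8"

lemma step_quarter: "k < 8 \<Longrightarrow> quarter (step t k) = step t (quarter k)"
proof -
  have "\<forall>k<8. quarter (step t k) = step t (quarter k)"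
    unfolding All_less_eight by (cases t) (simp_all add: step_def)
  then show "k < 8 \<Longrightarrow> ?thesis" by blast
qed

lemma dir_end_map:
  assumes "\<And>t k. k < 8 \<Longrightarrow> \<kappa> (step t k) = step (\<nu> t) (\<kappa> k)" and "d < 8"
  shows "dir_end (\<kappa> d) (map \<nu> ts) = \<kappa> (dir_end d ts)"
  using assms(2)
proof (induction ts arbitrary: d)
  case (Cons t ts)
  then show ?case using assms(1)[of d t] Cons.IH[of "step t d"] by simp
qed simp

lemma dir_end_quarter: "d < 8 \<Longrightarrow> dir_end (quarter d) ts = quarter (dir_end d ts)"
  using dir_end_map[of quarter id d ts] step_quarter by simp

lemma dirs_quarter: "d < 8 \<Longrightarrow> dirs (quarter d) ts = map quarter (dirs d ts)"
  using dirs_map[of quarter id d ts] step_quarter by simp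

lemma quarter_lab:
  assumes "lab \<in> {first_label, second_label_g, second_label_h}" "k < 8"
  shows "dir_matrix (lab (quarter k)) = mat2 0 (-1) 1 0 ** dir_matrix (lab k)"
proof -
  have "\<forall>k<8. dir_matrix (lab (quarter k)) = mat2 0 (-1) 1 0 ** dir_matrix (lab k)"
    using assms(1) unfolding All_less_eight
    by (auto simp: label_defs dir_matrix_simps mat2_mult)
  then show ?thesis using assms(2) by blast
qed

text \<open>
  A word whose walk ends at the quarter turn of its start contributes \<open>S + R S + R\<^sup>2 S + R\<^sup>3 S = 0\<close>
  when repeated four times, where \<open>R\<close> is the rotation by 90 degrees.
\<close>

lemma sum_fourfold:
  assumes lab: "lab \<in> {first_label, second_label_g, second_label_h}" and d: "d < 8" and w: "dir_end d w = quarter d"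
  shows "(\<Sum>k\<leftarrow>dirs d (concat (replicate 4 w)). dir_matrix (lab k)) = 0"
proof -
  let ?R = "mat2 0 (-1) 1 0"
  define S where "S k = (\<Sum>j\<leftarrow>dirs k w. dir_matrix (lab j))" for k
  have q: "dir_end k w = quarter k \<Longrightarrow> dir_end (quarter k) w = quarter (quarter k)" if "k < 8" for k
    using dir_end_quarter[OF that] by simp
  have S: "S (quarter k) = ?R ** S k" if "k < 8" for k
  proof -
    have "?R ** (\<Sum>j\<leftarrow>ks. dir_matrix (lab j)) = (\<Sum>j\<leftarrow>ks. dir_matrix (lab (quarter j)))"
      if "set ks \<subseteq> {..<8}" for ks
      using that
    proof (induction ks)
      case Nil
      show ?case by (simp add: matrix_matrix_mult_def vec_eq_iff)
    next
      case (Cons k ks)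
      then show ?case using quarter_lab[OF lab, of k] by (simp add: matrix_add_ldistrib)
    qed
    from this[OF set_dirs] show ?thesis
      unfolding S_def dirs_quarter[OF that] by (simp add: comp_def)
  qed
  define d1 d2 d3 where "d1 = quarter d" and "d2 = quarter d1" and "d3 = quarter d2"
  have less: "d1 < 8" "d2 < 8" "d3 < 8" by (auto simp: d1_def d2_def d3_def)
  have ends: "dir_end d w = d1" "dir_end d1 w = d2" "dir_end d2 w = d3"
    using w q[OF d] q[of d1] less by (auto simp: d1_def d2_def d3_def)
  have "concat (replicate 4 w) = w @ w @ w @ w" by (simp add: numeral_eq_Suc)
  then have "(\<Sum>k\<leftarrow>dirs d (concat (replicate 4 w)). dir_matrix (lab k)) = S d + (S d1 + (S d2 + S d3))"
    by (simp add: dirs_append ends S_def)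
  also have "\<dots> = S d + (?R ** S d + (?R ** (?R ** S d) + ?R ** (?R ** (?R ** S d))))"
    using S[OF d] S[OF less(1)] S[OF less(2)] by (simp only: d1_def d2_def d3_def)
  also have "\<dots> = 0"
    by (simp add: mat2_def matrix_matrix_mult_def vec_eq_iff forall_2 sum_2)
  finally show ?thesis .
qed

section \<open>Sections of frames\<close>

text \<open>
  The position of one coordinate relative to an \<open>(m, n)\<close>-frame: \<open>c = 0\<close> for the range of the hole,
  \<open>c = 1\<close> and \<open>c = - 1\<close> for the ranges on its two sides. The coordinates of \<open>unit_dir i\<close> are the
  positions for the section \<open>i\<close>.
\<close>

definition strip :: "int \<Rightarrow> int \<Rightarrow> int \<Rightarrow> int \<Rightarrow> bool" where
  "strip m n x c \<longleftrightarrow>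
     (if c = 0 then 2 * \<bar>x\<bar> < n - m else n - m < 2 * (c * x) \<and> 2 * (c * x) < m + n)"

lemma rot90_image_iff: "(x, y) \<in> rot90 ` S \<longleftrightarrow> (y, - x) \<in> S"
proof
  assume "(y, - x) \<in> S"
  then have "rot90 (y, - x) \<in> rot90 ` S" by (rule imageI)
  then show "(x, y) \<in> rot90 ` S" by (simp add: rot90_def)
qed (auto simp: rot90_def)

lemma rot90_power_image_iff:
  "(rot90 ^^ 0) ` S = S"
  "(x, y) \<in> (rot90 ^^ 1) ` S \<longleftrightarrow> (y, - x) \<in> S"
  "(x, y) \<in> (rot90 ^^ Suc 0) ` S \<longleftrightarrow> (y, - x) \<in> S"
  "(x, y) \<in> (rot90 ^^ 2) ` S \<longleftrightarrow> (- x, - y) \<in> S"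
  "(x, y) \<in> (rot90 ^^ 3) ` S \<longleftrightarrow> (- y, x) \<in> S"
proof -
  have im: "(rot90 ^^ Suc k) ` S = rot90 ` (rot90 ^^ k) ` S" for k by auto
  show "(rot90 ^^ 0) ` S = S" by simp
  show 1: "(x, y) \<in> (rot90 ^^ 1) ` S \<longleftrightarrow> (y, - x) \<in> S" for x y
    using im[of 0] by (simp add: rot90_image_iff)
  then show "(x, y) \<in> (rot90 ^^ Suc 0) ` S \<longleftrightarrow> (y, - x) \<in> S" by simp
  show 2: "(x, y) \<in> (rot90 ^^ 2) ` S \<longleftrightarrow> (- x, - y) \<in> S" for x y
    using im[of 1] 1[of y "- x"] by (simp only: rot90_image_iff numeral_2_eq_2 One_nat_def)
  show "(x, y) \<in> (rot90 ^^ 3) ` S \<longleftrightarrow> (- y, x) \<in> S"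
    using im[of 2] 2[of y "- x"] by (simp only: rot90_image_iff numeral_3_eq_3 numeral_2_eq_2 minus_minus)
qed

lemma rot90_power:
  "(rot90 ^^ 1) v = (- snd v, fst v)" "(rot90 ^^ 2) v = (- fst v, - snd v)" "(rot90 ^^ 3) v = (snd v, - fst v)"
  "(rot90 ^^ Suc 0) v = (- snd v, fst v)"
  by (simp_all add: rot90_def numeral_2_eq_2 numeral_3_eq_3)

lemma unit_dir_simps:
  "unit_dir 0 = (1, 0)" "unit_dir (Suc 0) = (1, 1)" "unit_dir 1 = (1, 1)" "unit_dir 2 = (0, 1)"
  "unit_dir 3 = (- 1, 1)" "unit_dir 4 = (- 1, 0)" "unit_dir 5 = (- 1, - 1)" "unit_dir 6 = (0, - 1)"
  "unit_dir 7 = (1, - 1)"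
  by (simp_all add: unit_dir_def rot90_power, simp_all add: rot90_def)

lemma in_frame_section:
  assumes "i < 8"
  shows "(x, y) \<in> frame_section (m, n) i \<longleftrightarrow>
    strip m n x (fst (unit_dir i)) \<and> strip m n y (snd (unit_dir i))"
proof -
  have "(x, y) \<in> frame_section (m, n) i \<longleftrightarrow>
      strip m n x (fst (unit_dir i)) \<and> strip m n y (snd (unit_dir i))"
    if "i \<in> {0, 1, 2, 3, 4, 5, 6, 7}"
    using that
    by (elim insertE emptyE) (simp_all add: rot90_image_iff rot90_power_image_iff unit_dir_simps strip_def, auto)
  then show ?thesis using assms by (simp only: below_eight)
qed

declare frame_section.simps [simp del]

lemma frame_section_disjoint:
  assumes "0 < m" "m < n" "i < 8" "j < 8"
    and "a \<in> frame_section (m, n) i" "a \<in> frame_section (m, n) j"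
  shows "i = j"
proof (cases a)
  case (Pair x y)
  have "strip m n z c \<Longrightarrow> strip m n z c' \<Longrightarrow> c \<in> {-1, 0, 1} \<Longrightarrow> c' \<in> {-1, 0, 1} \<Longrightarrow> c = c'" for z c c'
    using assms(1,2) by (auto simp: strip_def)
  moreover have "fst (unit_dir i) \<in> {-1, 0, 1} \<and> snd (unit_dir i) \<in> {-1, 0, 1}" if "i < 8" for i
    using that unfolding below_eight by (elim insertE emptyE) (simp_all add: unit_dir_simps)
  ultimately have "unit_dir i = unit_dir j"
    using assms Pair by (metis in_frame_section prod_eq_iff)
  then show ?thesis using assms(3,4) unfolding below_eight
    by (elim insertE emptyE) (simp_all add: unit_dir_simps)
qed

text \<open>
  The sections of the old frame which contribute to the section \<open>i\<close> of the lifted frame, in the order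
  in which the lifts of second cycles use them.
\<close>

fun sources :: "lift_type \<Rightarrow> nat \<Rightarrow> nat list" where
  "sources LF i = (if even i then [(i + 5) mod 8, (i + 4) mod 8, (i + 3) mod 8] else [i])"
| "sources LG i = (if even i then [i] else [(i + 5) mod 8, (i + 4) mod 8, (i + 3) mod 8])"
| "sources LH i =
     (if even i then [(i + 6) mod 8, (i + 5) mod 8, (i + 4) mod 8, (i + 3) mod 8, (i + 2) mod 8]
      else [(i + 7) mod 8, i, (i + 1) mod 8])"

lemma strip_LF:
  assumes "strip m n x c" "0 < m" "m < n" "c \<in> {-1, 0, 1}" "k \<in> {-1, 0, 1}"
  shows "strip m (2 * m + n) (x + (m + n) * k) k \<longleftrightarrow> k = 0 \<or> c = - k"
    "k \<noteq> 0 \<Longrightarrow> strip m (2 * m + n) (x + m * k) k \<longleftrightarrow> c = k"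
  using assms by (auto simp: strip_def)

lemma strip_LG:
  assumes "strip m n x c" "0 < m" "m < n" "c \<in> {-1, 0, 1}" "k \<in> {-1, 0, 1}"
  shows "strip n (2 * n - m) (x + (n - m) * k) k \<longleftrightarrow> (if k = 0 then c = 0 else c \<noteq> - k)"
    "k \<noteq> 0 \<Longrightarrow> strip n (2 * n - m) (x + n * k) k \<longleftrightarrow> c \<noteq> k"
    "strip n (2 * n - m) x 0 \<longleftrightarrow> c = 0"
  using assms by (auto simp: strip_def)

lemma strip_LH:
  assumes "strip m n x c" "0 < m" "m < n" "c \<in> {-1, 0, 1}" "k \<in> {-1, 0, 1}"
  shows "strip n (m + 2 * n) (x + (m + n) * k) k \<longleftrightarrow> k = 0 \<or> c \<noteq> k"
    "k \<noteq> 0 \<Longrightarrow> strip n (m + 2 * n) (x + n * k) k \<longleftrightarrow> c \<noteq> - k"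
  using assms by (auto simp: strip_def)

lemma unit_dir_cases:
  assumes "i < 8"
  shows "(i, fst (unit_dir i), snd (unit_dir i)) \<in>
    {(0, 1, 0), (1, 1, 1), (2, 0, 1), (3, -1, 1), (4, -1, 0), (5, -1, -1), (6, 0, -1), (7, 1, -1)}"
  using assms unfolding below_eight by (elim insertE emptyE) (simp_all add: unit_dir_simps)

text \<open>
  In terms of the positions \<open>(c, c')\<close> and \<open>(k, l)\<close> of two sections: the translate of the first one
  lies in the second one, whose index is even if and only if \<open>e\<close> holds.
\<close>

fun reaches :: "lift_type \<Rightarrow> bool \<Rightarrow> int \<times> int \<Rightarrow> int \<times> int \<Rightarrow> bool" where
  "reaches LF e (c, c') (k, l) \<longleftrightarrow> (if e then (k = 0 \<or> c = - k) \<and> (l = 0 \<or> c' = - l) else c = k \<and> c' = l)"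
| "reaches LG e (c, c') (k, l) \<longleftrightarrow>
     (if e then (if k = 0 then c = 0 else c \<noteq> - k) \<and> (if l = 0 then c' = 0 else c' \<noteq> - l)
      else c \<noteq> k \<and> c' \<noteq> l)"
| "reaches LH e (c, c') (k, l) \<longleftrightarrow>
     (if e then (k = 0 \<or> c \<noteq> k) \<and> (l = 0 \<or> c' \<noteq> l) else c \<noteq> - k \<and> c' \<noteq> - l)"

lemma reaches_iff_sources:
  assumes "i < 8" "s < 8"
  shows "reaches x (even i) (unit_dir s) (unit_dir i) \<longleftrightarrow> s \<in> set (sources x i)"
proof -
  have "\<forall>i<8. \<forall>s<8. reaches x (even i) (unit_dir s) (unit_dir i) \<longleftrightarrow> s \<in> set (sources x i)"
    unfolding All_less_eight by (cases x) (simp_all add: unit_dir_simps)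
  then show ?thesis using assms by blast
qed

lemma lift_in_section_iff:
  assumes mn: "0 < m" "m < n" and a: "a \<in> frame_section (m, n) s" and "s < 8" "i < 8"
  shows "a + lift_shift x (m, n) i \<in> frame_section (lift_frame x (m, n)) i \<longleftrightarrow> s \<in> set (sources x i)"
proof -
  obtain u v where uv: "a = (u, v)" by (cases a)
  define c c' where "c = fst (unit_dir s)" and "c' = snd (unit_dir s)"
  define k l where "k = fst (unit_dir i)" and "l = snd (unit_dir i)"
  have st: "strip m n u c" "strip m n v c'" using a assms(4) by (simp_all add: uv in_frame_section c_def c'_def)
  have sc: "(s, c, c') \<in> {(0, 1, 0), (1, 1, 1), (2, 0, 1), (3, -1, 1), (4, -1, 0), (5, -1, -1), (6, 0, -1), (7, 1, -1)}"
    unfolding c_def c'_def using unit_dir_cases[OF assms(4)] .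
  have ik: "(i, k, l) \<in> {(0, 1, 0), (1, 1, 1), (2, 0, 1), (3, -1, 1), (4, -1, 0), (5, -1, -1), (6, 0, -1), (7, 1, -1)}"
    unfolding k_def l_def using unit_dir_cases[OF assms(5)] .
  have c: "c \<in> {-1, 0, 1}" "c' \<in> {-1, 0, 1}" "k \<in> {-1, 0, 1}" "l \<in> {-1, 0, 1}" using sc ik by auto
  have odd: "k \<noteq> 0 \<and> l \<noteq> 0" if "odd i" using ik that by auto
  have "a + lift_shift x (m, n) i \<in> frame_section (lift_frame x (m, n)) i \<longleftrightarrow>
     reaches x (even i) (c, c') (k, l)"
    using odd
    by (cases x; cases "even i") (simp_all add: uv scale_def in_frame_section[OF assms(5)] flip: k_def l_def,
      simp_all add: strip_LF[OF st(1) mn c(1,3)] strip_LF[OF st(2) mn c(2,4)]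
        strip_LG[OF st(1) mn c(1,3)] strip_LG[OF st(2) mn c(2,4)]
        strip_LH[OF st(1) mn c(1,3)] strip_LH[OF st(2) mn c(2,4)])
  also have "\<dots> \<longleftrightarrow> s \<in> set (sources x i)"
    using reaches_iff_sources[OF assms(5,4)] by (simp add: c_def c'_def k_def l_def)
  finally show ?thesis .
qed

section \<open>Lifting first cycles\<close>

text \<open>
  The section of a square of a first cycle of type \<open>t\<close> which is left by the move with index \<open>k\<close>. That
  move is possible from the two consecutive sections \<open>5k\<close> and \<open>5k + 1\<close> modulo 8 only.
\<close>

definition sect :: "bool \<Rightarrow> nat \<Rightarrow> nat" where
  "sect t k = (if even k = t then 5 * k else 5 * k + 1) mod 8"

primrec sections :: "nat \<Rightarrow> bool list \<Rightarrow> nat list" where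
  "sections d [] = []"
| "sections d (t # ts) = sect t (step t d) # sections (step t d) ts"

text \<open>The moves of the leaper of a frame, by direction index.\<close>

definition move_vec :: "int \<times> int \<Rightarrow> nat \<Rightarrow> square" where
  "move_vec F = dvec (fst F) (snd F) \<circ> first_label"

text \<open>Every square of the walk lies in the section prescribed by its type and direction.\<close>

definition placed :: "int \<times> int \<Rightarrow> square \<Rightarrow> nat \<Rightarrow> bool list \<Rightarrow> bool" where
  "placed F a d ts \<longleftrightarrow> list_all2 (\<lambda>b i. b \<in> frame_section F i) (squares (move_vec F) a d ts) (sections d ts)"

text \<open>The direction index of the lift of a move between two squares.\<close>

fun turn :: "lift_type \<Rightarrow> nat \<Rightarrow> nat" where
  "turn LF d = step True d"
| "turn LG d = step False d"
| "turn LH d = step False (step True d)"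

text \<open>
  The section of the first lifted copy of a square entered with index \<open>d\<close>. The first type of
  \<open>phi x t\<close> is \<open>x \<noteq> LG\<close> for both values of \<open>t\<close>, so this does not depend on the type of the square.
\<close>

definition start_section :: "lift_type \<Rightarrow> nat \<Rightarrow> nat" where
  "start_section x d = sect (x \<noteq> LG) (step (x \<noteq> LG) (turn x d))"

lemma sections_append: "sections d (ts @ ts') = sections d ts @ sections (dir_end d ts) ts'"
  by (induction ts arbitrary: d) auto

lemma sect_less [simp]: "sect t k < 8"
  by (simp add: sect_def)

lemma turn_less [simp]: "turn x d < 8"
  by (cases x) auto

lemma start_section_less [simp]: "start_section x d < 8"
  by (simp add: start_section_def)

lemma sections_less: "i \<in> set (sections d ts) \<Longrightarrow> i < 8"
  by (induction ts arbitrary: d) auto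

lemma lift_letter_sections:
  assumes "d < 8"
  shows "dir_end (turn x d) (phi x t) = turn x (step t d)"
    and "set (sections (turn x d) (phi x t)) = {i. i < 8 \<and> sect t (step t d) \<in> set (sources x i)}"
    and "distinct (sections (turn x d) (phi x t))"
proof -
  have "\<forall>d<8. dir_end (turn x d) (phi x t) = turn x (step t d)"
    unfolding All_less_eight by (cases x; cases t) (simp_all add: step_def)
  then show "dir_end (turn x d) (phi x t) = turn x (step t d)" using assms by blast
  have "\<forall>d<8. \<forall>i<8. i \<in> set (sections (turn x d) (phi x t)) \<longleftrightarrow> sect t (step t d) \<in> set (sources x i)"
    unfolding All_less_eight by (cases x; cases t) (simp_all add: step_def sect_def)
  then show "set (sections (turn x d) (phi x t)) = {i. i < 8 \<and> sect t (step t d) \<in> set (sources x i)}"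
    using assms sections_less by blast
  have "\<forall>d<8. distinct (sections (turn x d) (phi x t))"
    unfolding All_less_eight by (cases x; cases t) (simp_all add: step_def sect_def)
  then show "distinct (sections (turn x d) (phi x t))" using assms by blast
qed

lemma step_simps:
  "step True 0 = 7" "step True 1 = 2" "step True 2 = 1" "step True 3 = 4" "step True 4 = 3"
  "step True 5 = 6" "step True 6 = 5" "step True 7 = 0" "step False 0 = 1" "step False 1 = 0"
  "step False 2 = 3" "step False 3 = 2" "step False 4 = 5" "step False 5 = 4" "step False 6 = 7"
  "step False 7 = 6" "step True (Suc 0) = 2" "step False (Suc 0) = 0"
  by (simp_all add: step_def)

lemma sect_simps:
  "sect True 0 = 0" "sect True 1 = 6" "sect True 2 = 2" "sect True 3 = 0" "sect True 4 = 4"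
  "sect True 5 = 2" "sect True 6 = 6" "sect True 7 = 4" "sect False 0 = 1" "sect False 1 = 5"
  "sect False 2 = 3" "sect False 3 = 7" "sect False 4 = 5" "sect False 5 = 1" "sect False 6 = 7"
  "sect False 7 = 3" "sect True (Suc 0) = 6" "sect False (Suc 0) = 5"
  by (simp_all add: sect_def)

lemma move_vec_simps:
  "move_vec (m, n) 0 = (- n, - m)" "move_vec (m, n) 1 = (m, n)" "move_vec (m, n) 2 = (m, - n)"
  "move_vec (m, n) 3 = (- n, m)" "move_vec (m, n) 4 = (n, m)" "move_vec (m, n) 5 = (- m, - n)"
  "move_vec (m, n) 6 = (- m, n)" "move_vec (m, n) 7 = (n, - m)" "move_vec (m, n) (Suc 0) = (m, n)"
  by (simp_all add: move_vec_def dvec_def first_label_def)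

text \<open>
  The copies of a square in the lifted frame are consecutive squares of a walk with types \<open>phi x t\<close>,
  and the next move leads from the last of them to the first copy of the next square.
\<close>

lemma lift_letter_squares:
  assumes "d < 8"
  shows "squares (move_vec (lift_frame x F)) (a + lift_shift x F (start_section x d)) (turn x d) (phi x t) =
      map (\<lambda>i. a + lift_shift x F i) (sections (turn x d) (phi x t))"
    and "sq_end (move_vec (lift_frame x F)) (a + lift_shift x F (start_section x d)) (turn x d) (phi x t) =
      a + move_vec F (step t d) + lift_shift x F (start_section x (step t d))"
proof -
  obtain m n where F: "F = (m, n)" by (cases F)
  obtain y z where a: "a = (y, z)" by (cases a)
  have "squares (move_vec (lift_frame x F)) (a + lift_shift x F (start_section x d)) (turn x d) (phi x t) =
      map (\<lambda>i. a + lift_shift x F i) (sections (turn x d) (phi x t)) \<and>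
      sq_end (move_vec (lift_frame x F)) (a + lift_shift x F (start_section x d)) (turn x d) (phi x t) =
      a + move_vec F (step t d) + lift_shift x F (start_section x (step t d))"
    using assms unfolding below_eight F a
    by (cases x; cases t; elim insertE emptyE)
      (simp_all add: step_simps sect_simps start_section_def move_vec_simps scale_def unit_dir_simps)
  then show "squares (move_vec (lift_frame x F)) (a + lift_shift x F (start_section x d)) (turn x d) (phi x t) =
      map (\<lambda>i. a + lift_shift x F i) (sections (turn x d) (phi x t))"
    "sq_end (move_vec (lift_frame x F)) (a + lift_shift x F (start_section x d)) (turn x d) (phi x t) =
      a + move_vec F (step t d) + lift_shift x F (start_section x (step t d))" by blast+
qed

lemma lift_set_Un: "lift_set x F (S \<union> S') = lift_set x F S \<union> lift_set x F S'"
  by (auto simp: lift_set_def)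

lemma lift_set_insert: "lift_set x F (insert a S) = lift_set x F {a} \<union> lift_set x F S"
  using lift_set_Un[of x F "{a}" S] by simp

lemma lift_set_single:
  assumes "0 < m" "m < n" "a \<in> frame_section (m, n) s" "s < 8"
  shows "lift_set x (m, n) {a} = (\<lambda>i. a + lift_shift x (m, n) i) ` {i. i < 8 \<and> s \<in> set (sources x i)}"
  using lift_in_section_iff[OF assms] by (auto simp: lift_set_def)

lemma lift_frame_skew:
  "0 < m \<Longrightarrow> m < n \<Longrightarrow> lift_frame x (m, n) = (m', n') \<Longrightarrow> 0 < m' \<and> m' < n'"
  by (cases x) auto

lemma lift_trail:
  fixes x :: lift_type and F :: "int \<times> int"
  assumes mn: "0 < m" "m < n" and F: "F = (m, n)" and d: "d < 8" and p: "placed F a d ts"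
  defines "F' \<equiv> lift_frame x F" and "a' \<equiv> \<lambda>a d. a + lift_shift x F (start_section x d)"
    and "ts' \<equiv> \<lambda>ts. concat (map (phi x) ts)"
  shows "placed F' (a' a d) (turn x d) (ts' ts) \<and>
    set (squares (move_vec F') (a' a d) (turn x d) (ts' ts)) = lift_set x F (set (squares (move_vec F) a d ts)) \<and>
    dir_end (turn x d) (ts' ts) = turn x (dir_end d ts) \<and>
    sq_end (move_vec F') (a' a d) (turn x d) (ts' ts) = a' (sq_end (move_vec F) a d ts) (dir_end d ts) \<and>
    (distinct (squares (move_vec F) a d ts) \<longrightarrow> distinct (squares (move_vec F') (a' a d) (turn x d) (ts' ts)))"
  using d p
proof (induction ts arbitrary: a d)
  case Nil
  then show ?case by (simp add: ts'_def placed_def lift_set_def)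
next
  case (Cons t ts)
  obtain m' n' where F': "F' = (m', n')" by (cases F')
  have mn': "0 < m'" "m' < n'" using lift_frame_skew[OF mn] F' unfolding F'_def F by blast+
  let ?e = "step t d" and ?b = "a + move_vec F (step t d)"
  let ?block = "map (\<lambda>i. a + lift_shift x F i) (sections (turn x d) (phi x t))"
  let ?rest = "squares (move_vec F') (a' ?b ?e) (turn x ?e) (ts' ts)"
  have pl: "a \<in> frame_section F (sect t ?e)" "placed F ?b ?e ts"
    using Cons.prems by (simp_all add: placed_def)
  note C = Cons.IH[OF step_less pl(2)]
  note IH = C[THEN conjunct1] C[THEN conjunct2, THEN conjunct1]
    C[THEN conjunct2, THEN conjunct2, THEN conjunct1]
    C[THEN conjunct2, THEN conjunct2, THEN conjunct2, THEN conjunct1]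
    C[THEN conjunct2, THEN conjunct2, THEN conjunct2, THEN conjunct2]
  note L = lift_letter_sections[OF Cons.prems(1), of x t]
    lift_letter_squares[OF Cons.prems(1), of x F a t]
  have sq: "squares (move_vec F') (a' a d) (turn x d) (ts' (t # ts)) = ?block @ ?rest"
    unfolding ts'_def a'_def F'_def list.map concat.simps squares_append L(1,4,5) ..
  have se: "sections (turn x d) (ts' (t # ts)) = sections (turn x d) (phi x t) @ sections (turn x ?e) (ts' ts)"
    unfolding ts'_def list.map concat.simps sections_append L(1) ..
  have ls: "lift_set x F {a} = set ?block"
    using lift_set_single[OF mn pl(1)[unfolded F] sect_less, of x] unfolding F set_map L(2) .
  have inb: "a + lift_shift x F i \<in> frame_section F' i" if "i \<in> set (sections (turn x d) (phi x t))" for i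
    using that lift_in_section_iff[OF mn pl(1)[unfolded F] sect_less, of i x]
    unfolding L(2) F F'_def by blast
  have 1: "placed F' (a' a d) (turn x d) (ts' (t # ts))"
    unfolding placed_def sq se
  proof (rule list_all2_appendI)
    show "list_all2 (\<lambda>b i. b \<in> frame_section F' i) ?block (sections (turn x d) (phi x t))"
      using inb by (auto simp: list_all2_conv_all_nth)
  qed (rule IH(1)[unfolded placed_def])
  have 2: "set (?block @ ?rest) = lift_set x F (set (squares (move_vec F) a d (t # ts)))"
  proof -
    have "lift_set x F (insert a (set (squares (move_vec F) ?b ?e ts))) = set ?block \<union> set ?rest"
      by (subst lift_set_insert) (simp only: ls IH(2))
    then show ?thesis by simp
  qed
  have 3: "dir_end (turn x d) (ts' (t # ts)) = turn x (dir_end d (t # ts))"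
    using IH(3) by (simp add: ts'_def L(1))
  have 4: "sq_end (move_vec F') (a' a d) (turn x d) (ts' (t # ts)) = a' (sq_end (move_vec F) a d (t # ts)) (dir_end d (t # ts))"
    using IH(4) unfolding ts'_def a'_def F'_def list.map concat.simps sq_end_append L(1,5)
      sq_end.simps dir_end.simps .
  have 5: "distinct (?block @ ?rest)" if di: "distinct (squares (move_vec F) a d (t # ts))"
  proof -
    have "inj_on (\<lambda>i. a + lift_shift x F i) (set (sections (turn x d) (phi x t)))"
    proof (rule inj_onI)
      fix i j
      assume ij: "i \<in> set (sections (turn x d) (phi x t))" "j \<in> set (sections (turn x d) (phi x t))"
        "a + lift_shift x F i = a + lift_shift x F j"
      have "a + lift_shift x F i \<in> frame_section (m', n') i"
        using inb[OF ij(1)] unfolding F' .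
      moreover have "a + lift_shift x F i \<in> frame_section (m', n') j"
        using inb[OF ij(2)] unfolding F' ij(3) .
      ultimately show "i = j"
        by (rule frame_section_disjoint[OF mn' sections_less[OF ij(1)] sections_less[OF ij(2)]])
    qed
    then have "distinct ?block" using L(3) by (simp add: distinct_map)
    moreover have "set ?block \<inter> set ?rest = {}"
    proof (rule ccontr)
      assume "set ?block \<inter> set ?rest \<noteq> {}"
      then obtain i b where i: "i \<in> set (sections (turn x d) (phi x t))" and b: "b \<in> set ?rest"
        "b = a + lift_shift x F i" by auto
      from b(1) obtain j c where j: "j < 8" "c \<in> set (squares (move_vec F) ?b ?e ts)" "b = c + lift_shift x F j"
        "b \<in> frame_section F' j"
        unfolding IH(2) unfolding lift_set_def F'_def by blast
      have "b \<in> frame_section (m', n') i" using inb[OF i] unfolding F' b(2) .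
      moreover have "b \<in> frame_section (m', n') j" using j(4) unfolding F' .
      ultimately have "i = j"
        by (rule frame_section_disjoint[OF mn' sections_less[OF i] j(1)])
      then have "a = c" using b(2) j(3) by simp
      then show False using j(2) di by simp
    qed
    ultimately show ?thesis using IH(5) di by simp
  qed
  show ?case unfolding sq by (intro conjI impI 1 2 3 4 5) assumption
qed


section \<open>First cycles are determined by their squares\<close>

lemma frame_of_skew:
  assumes "frame_of e = (m, n)"
  shows "0 < m" "m < n" "odd (m + n)" "coprime m n"
proof -
  have "0 < m \<and> m < n \<and> odd (m + n) \<and> coprime m n"
    using assms
  proof (induction e arbitrary: m n)
    case Nil
    then show ?case by auto
  next
    case (Cons x e)
    obtain m' n' where F: "frame_of e = (m', n')" by fastforce
    note IH = Cons.IH[OF F]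
    have c: "coprime m n" if "\<And>d. d dvd m \<Longrightarrow> d dvd n \<Longrightarrow> d dvd m' \<and> d dvd n'"
      using that IH by (meson coprimeI coprime_common_divisor)
    have lin: "d dvd v" if "d dvd u" "d dvd a * u + b * v" "b = 1 \<or> b = - 1" for a b u v d :: int
    proof -
      have "d dvd b * v" using that(1,2) by (metis dvd_add_right_iff dvd_mult)
      then show ?thesis using that(3) by auto
    qed
    show ?case
    proof (cases x)
      case LF
      then show ?thesis using Cons.prems F IH c lin[of _ m' 2 1 n'] by auto
    next
      case LG
      then show ?thesis using Cons.prems F IH c lin[of _ n' 2 "- 1" m'] by auto
    next
      case LH
      then show ?thesis using Cons.prems F IH c lin[of _ n' 2 1 m'] by (auto simp: algebra_simps)
    qed
  qed
  then show "0 < m" "m < n" "odd (m + n)" "coprime m n" by auto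
qed

text \<open>Every square of the frame has at most two neighbours on the board.\<close>

lemma leaper_move_in_section:
  assumes mn: "0 < m" "m < n" and a: "a \<in> frame_section (m, n) s" "s < 8"
    and b: "a + d \<in> board (m + n)" and d: "d \<in> leaper_moves m n"
  shows "d \<in> {move_vec (m, n) (5 * s mod 8), move_vec (m, n) ((5 * s + 3) mod 8)}"
proof -
  obtain x y where xy: "a = (x, y)" by (cases a)
  obtain p q where pq: "d = (p, q)" by (cases d)
  have st: "strip m n x (fst (unit_dir s))" "strip m n y (snd (unit_dir s))"
    using a by (simp_all add: xy in_frame_section)
  have bd: "2 * \<bar>x + p\<bar> < m + n" "2 * \<bar>y + q\<bar> < m + n"
    using b by (simp_all add: xy pq board_def)
  have pq': "(\<bar>p\<bar> = m \<and> \<bar>q\<bar> = n) \<or> (\<bar>p\<bar> = n \<and> \<bar>q\<bar> = m)"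
    using d mn by (auto simp: pq leaper_moves_def)
  have 1: "(c = 0 \<longrightarrow> \<bar>h\<bar> \<noteq> n) \<and> (c = 1 \<longrightarrow> h < 0) \<and> (c = - 1 \<longrightarrow> 0 < h)"
    if "strip m n z c" "2 * \<bar>z + h\<bar> < m + n" "\<bar>h\<bar> = m \<or> \<bar>h\<bar> = n" for z h c
    using that mn by (auto simp: strip_def abs_if split: if_splits)
  have P: "(fst (unit_dir s) = 0 \<longrightarrow> \<bar>p\<bar> \<noteq> n) \<and> (fst (unit_dir s) = 1 \<longrightarrow> p < 0) \<and> (fst (unit_dir s) = - 1 \<longrightarrow> 0 < p)"
    using 1[OF st(1) bd(1)] pq' by auto
  have Q: "(snd (unit_dir s) = 0 \<longrightarrow> \<bar>q\<bar> \<noteq> n) \<and> (snd (unit_dir s) = 1 \<longrightarrow> q < 0) \<and> (snd (unit_dir s) = - 1 \<longrightarrow> 0 < q)"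
    using 1[OF st(2) bd(2)] pq' by auto
  show ?thesis using a(2) P Q pq' mn unfolding below_eight
    by (elim insertE emptyE) (auto simp: pq unit_dir_simps move_vec_simps)
qed

lemma cycle_neighbours:
  assumes "leaper_cycle p q B C" and "a \<in> set C"
  obtains b c where "b \<noteq> c" "(a, b) \<in> cyclic_arcs C" "(c, a) \<in> cyclic_arcs C"
proof -
  let ?n = "length C"
  have n: "3 \<le> ?n" and di: "distinct C" using assms(1) by (auto simp: leaper_cycle_def)
  obtain k where k: "k < ?n" "a = C ! k" using assms(2) by (auto simp: in_set_conv_nth)
  define j where "j = (if k = 0 then ?n - 1 else k - 1)"
  have j: "j < ?n" "Suc j mod ?n = k" using k n by (auto simp: j_def)
  have "Suc k mod ?n \<noteq> j"
  proof (cases "Suc k = ?n")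
    case True
    then show ?thesis using n by (auto simp: j_def)
  next
    case False
    then show ?thesis using n k by (auto simp: j_def)
  qed
  then have "C ! (Suc k mod ?n) \<noteq> C ! j"
    using di j(1) Suc_mod_less[OF k(1)] by (simp add: nth_eq_iff_index_eq)
  then show thesis
    using that k j unfolding cyclic_arcs_def by blast
qed

lemma leaper_moves_eq:
  "leaper_moves p q = (\<lambda>(s, t). (s * p, t * q)) ` ({-1, 1} \<times> {-1, 1}) \<union>
     (\<lambda>(s, t). (s * q, t * p)) ` ({-1, 1} \<times> {-1, 1})"
proof -
  have "{(s * a, t * b) |s t. s \<in> A \<and> t \<in> A} = (\<lambda>(s, t). (s * a, t * b)) ` (A \<times> A)"
    for a b :: int and A by auto
  then show ?thesis unfolding leaper_moves_def by (simp only:)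
qed

lemma leaper_moves_uminus: "d \<in> leaper_moves p q \<Longrightarrow> - d \<in> leaper_moves p q"
  unfolding leaper_moves_eq by auto

lemma cycle_contains_neighbours:
  assumes mn: "0 < m" "m < n" and C: "leaper_cycle m n (board (m + n)) C"
    and a: "a \<in> set C" "a \<in> frame_section (m, n) s" "s < 8"
    and d: "d \<in> {move_vec (m, n) (5 * s mod 8), move_vec (m, n) ((5 * s + 3) mod 8)}"
  shows "(a, a + d) \<in> cyclic_arcs C \<union> (cyclic_arcs C)\<inverse>"
proof -
  obtain b c where bc: "b \<noteq> c" "(a, b) \<in> cyclic_arcs C" "(c, a) \<in> cyclic_arcs C"
    using cycle_neighbours[OF C a(1)] .
  have sub: "cyclic_arcs C \<subseteq> set C \<times> set C" by (auto simp: cyclic_arcs_def Suc_mod_less)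
  have bd: "set C \<subseteq> board (m + n)" using C by (auto simp: leaper_cycle_def)
  have mv: "b - a \<in> leaper_moves m n" "a - c \<in> leaper_moves m n"
    using C bc by (auto simp: leaper_cycle_def)
  have "b - a \<in> {move_vec (m, n) (5 * s mod 8), move_vec (m, n) ((5 * s + 3) mod 8)}"
    using leaper_move_in_section[OF mn a(2,3), of "b - a"] mv(1) bc(2) sub bd by auto
  moreover have "c - a \<in> {move_vec (m, n) (5 * s mod 8), move_vec (m, n) ((5 * s + 3) mod 8)}"
    using leaper_move_in_section[OF mn a(2,3), of "c - a"] leaper_moves_uminus[OF mv(2)] bc(3) sub bd by auto
  moreover have "b - a \<noteq> c - a" using bc(1) by simp
  ultimately have "d = b - a \<or> d = c - a" using d by (metis insert_iff singletonD)
  then have "a + d = b \<or> a + d = c" by auto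
  then show ?thesis using bc(2,3) by auto
qed

lemma cyclic_arcs_of_cycle_in_frame:
  assumes mn: "0 < m" "m < n" and C: "leaper_cycle m n (board (m + n)) C"
    and fr: "\<forall>a\<in>set C. \<exists>s<8. a \<in> frame_section (m, n) s"
  shows "cyclic_arcs C \<union> (cyclic_arcs C)\<inverse> =
    {(a, b). a \<in> set C \<and> b \<in> set C \<and> b - a \<in> leaper_moves m n}"
proof (intro equalityI subsetI)
  fix e
  assume "e \<in> cyclic_arcs C \<union> (cyclic_arcs C)\<inverse>"
  moreover have "cyclic_arcs C \<subseteq> set C \<times> set C" by (auto simp: cyclic_arcs_def Suc_mod_less)
  moreover have "b - a \<in> leaper_moves m n \<and> a - b \<in> leaper_moves m n" if "(a, b) \<in> cyclic_arcs C" for a b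
  proof -
    have "b - a \<in> leaper_moves m n" using C that by (auto simp: leaper_cycle_def)
    then show ?thesis using leaper_moves_uminus[of "b - a" m n] by simp
  qed
  ultimately show "e \<in> {(a, b). a \<in> set C \<and> b \<in> set C \<and> b - a \<in> leaper_moves m n}" by auto
next
  fix e
  assume "e \<in> {(a, b). a \<in> set C \<and> b \<in> set C \<and> b - a \<in> leaper_moves m n}"
  then obtain a b where e: "e = (a, b)" "a \<in> set C" "b \<in> set C" "b - a \<in> leaper_moves m n" by auto
  obtain s where s: "s < 8" "a \<in> frame_section (m, n) s" using fr e(2) by auto
  have "b \<in> board (m + n)" using C e(3) by (auto simp: leaper_cycle_def)
  then have "b - a \<in> {move_vec (m, n) (5 * s mod 8), move_vec (m, n) ((5 * s + 3) mod 8)}"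
    using leaper_move_in_section[OF mn s(2,1), of "b - a"] e(4) by simp
  from cycle_contains_neighbours[OF mn C e(2) s(2,1) this]
  show "e \<in> cyclic_arcs C \<union> (cyclic_arcs C)\<inverse>" using e(1) by simp
qed

lemma extracted_graph_determined:
  assumes mn: "0 < m" "m < n" and C: "leaper_cycle m n (board (m + n)) C" "leaper_cycle m n (board (m + n)) D"
    and "set C = set D" and fr: "\<forall>a\<in>set C. \<exists>s<8. a \<in> frame_section (m, n) s"
  shows "extracted_graph m n C = extracted_graph m n D"
proof -
  have "\<forall>a\<in>set D. \<exists>s<8. a \<in> frame_section (m, n) s" using fr unfolding assms(5) .
  from cyclic_arcs_of_cycle_in_frame[OF mn C(1) fr] cyclic_arcs_of_cycle_in_frame[OF mn C(2) this]
  have "cyclic_arcs C \<union> (cyclic_arcs C)\<inverse> = cyclic_arcs D \<union> (cyclic_arcs D)\<inverse>"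
    unfolding assms(5) by (rule trans[OF _ sym])
  then show ?thesis unfolding extracted_graph_def assms(5) by (simp only:)
qed


section \<open>Shell cycles\<close>

lemma placed_distinct:
  assumes mn: "0 < m" "m < n" and "placed (m, n) a d ts" and "distinct (sections d ts)"
  shows "distinct (squares (move_vec (m, n)) a d ts)"
proof -
  let ?xs = "squares (move_vec (m, n)) a d ts" and ?ss = "sections d ts"
  have l: "length ?xs = length ?ss" and p: "\<And>k. k < length ?xs \<Longrightarrow> ?xs ! k \<in> frame_section (m, n) (?ss ! k)"
    using assms(3) by (auto simp: placed_def list_all2_conv_all_nth)
  have "j = k" if "j < length ?xs" "k < length ?xs" "?xs ! j = ?xs ! k" for j k
  proof -
    have "?ss ! j < 8" "?ss ! k < 8" using that(1,2) l sections_less nth_mem by metis+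
    then have "?ss ! j = ?ss ! k"
      using frame_section_disjoint[OF mn _ _ p[OF that(1)]] p[OF that(2)] that(3) by simp
    then show ?thesis using assms(4) that l by (simp add: nth_eq_iff_index_eq)
  qed
  then show ?thesis unfolding distinct_conv_nth by blast
qed

text \<open>
  The types along a shell cycle. Started in the section E with index 7, it visits the sections in
  the order \<open>0, 5, 2, 7, 4, 1, 6, 3\<close>.
\<close>

abbreviation base_word :: "bool list" where
  "base_word \<equiv> [True, False, True, False, True, False, True, False]"

lemma base_word_dirs: "dirs 7 base_word = [0, 1, 2, 3, 4, 5, 6, 7]" "dir_end 7 base_word = 7"
    "sections 7 base_word = [0, 5, 2, 7, 4, 1, 6, 3]"
  by (simp_all add: step_simps sect_simps)

lemma base_word_sq_end: "sq_end (move_vec F) a 7 base_word = a"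
proof (cases F; cases a)
  fix m n x y
  assume "F = (m, n)" "a = (x, y)"
  then show ?thesis by (simp add: step_simps move_vec_simps)
qed

text \<open>
  From a square of the shell in the section \<open>s\<close>, one of the two moves leads to the section \<open>s + 5\<close>
  (and not to \<open>s + 4\<close>). This is where the shape of the shell is used.
\<close>

lemma shell_square:
  assumes mn: "0 < m" "m < n" "n \<le> 3 * m" and a: "a \<in> shell (m, n)"
  shows "\<exists>s<8. a \<in> frame_section (m, n) s \<and>
    a + move_vec (m, n) (5 * s mod 8) \<in> frame_section (m, n) ((s + 5) mod 8)"
proof -
  obtain x y where xy: "a = (x, y)" by (cases a)
  let ?S = "if n \<le> 2 * m
      then {(x, y). 3 * m - n < 2 * x \<and> 2 * x < m + n \<and> 3 * m - n < 2 * y \<and> 2 * y < m + n} \<union>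
           {(x, y). n - m < 2 * x \<and> 2 * x < 3 * (n - m) \<and> 2 * \<bar>y\<bar> < n - m}
      else {(x, y). 3 * n - 5 * m < 2 * x \<and> 2 * x < m + n \<and> 2 * \<bar>y\<bar> < 3 * m - n} \<union>
           {(x, y). n - m < 2 * x \<and> 2 * x < 5 * m - n \<and> n - m < 2 * y \<and> 2 * y < 5 * m - n}"
  obtain k where k: "k < 4" "(x, y) \<in> (rot90 ^^ k) ` ?S" using a unfolding xy shell.simps by blast
  have key: "(n - m < 2 * u \<and> 2 * u < m + n \<and> 2 * \<bar>v\<bar> < n - m \<and>
        n - m < 2 * (n - u) \<and> 2 * (n - u) < m + n \<and> n - m < 2 * (m - v) \<and> 2 * (m - v) < m + n) \<or>
      (n - m < 2 * u \<and> 2 * u < m + n \<and> n - m < 2 * v \<and> 2 * v < m + n \<and>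
        2 * \<bar>u - m\<bar> < n - m \<and> n - m < 2 * (n - v) \<and> 2 * (n - v) < m + n)"
    if "(u, v) \<in> ?S" for u v
    using that mn by (auto simp: abs_if split: if_splits)
  have s: ?thesis
    if "strip m n x (fst (unit_dir s))" "strip m n y (snd (unit_dir s))" "s < 8"
      "strip m n (x + fst (move_vec (m, n) (5 * s mod 8))) (fst (unit_dir ((s + 5) mod 8)))"
      "strip m n (y + snd (move_vec (m, n) (5 * s mod 8))) (snd (unit_dir ((s + 5) mod 8)))" for s
    using that by (intro exI[of _ s])
      (cases "move_vec (m, n) (5 * s mod 8)", simp add: xy in_frame_section)
  have "k = 0 \<or> k = 1 \<or> k = 2 \<or> k = 3" using k(1) by auto
  then show ?thesis
  proof (elim disjE)
    assume 0: "k = 0"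
    from k(2) have "(x, y) \<in> ?S" unfolding 0 rot90_power_image_iff .
    from key[OF this] show ?thesis
      by (elim disjE) (rule s[of 0], simp_all add: unit_dir_simps move_vec_simps strip_def,
        rule s[of 1], simp_all add: unit_dir_simps move_vec_simps strip_def)
  next
    assume 1: "k = 1"
    from k(2) have "(y, - x) \<in> ?S" unfolding 1 rot90_power_image_iff .
    from key[OF this] show ?thesis
      by (elim disjE) (rule s[of 2], simp_all add: unit_dir_simps move_vec_simps strip_def,
        rule s[of 3], simp_all add: unit_dir_simps move_vec_simps strip_def)
  next
    assume 2: "k = 2"
    from k(2) have "(- x, - y) \<in> ?S" unfolding 2 rot90_power_image_iff .
    moreover have "\<bar>- x - m\<bar> = \<bar>x + m\<bar>" by simp
    ultimately show ?thesis using key[of "- x" "- y"]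
      by (elim disjE meta_impE) (assumption, rule s[of 4], simp_all add: unit_dir_simps move_vec_simps strip_def,
        rule s[of 5], simp_all add: unit_dir_simps move_vec_simps strip_def)
  next
    assume 3: "k = 3"
    from k(2) have "(- y, x) \<in> ?S" unfolding 3 rot90_power_image_iff .
    moreover have "\<bar>- y - m\<bar> = \<bar>y + m\<bar>" by simp
    ultimately show ?thesis using key[of "- y" x]
      by (elim disjE meta_impE) (assumption, rule s[of 6], simp_all add: unit_dir_simps move_vec_simps strip_def,
        rule s[of 7], simp_all add: unit_dir_simps move_vec_simps strip_def)
  qed
qed

lemma frame_section_board:
  assumes "0 < m" "m < n" "s < 8" "a \<in> frame_section (m, n) s"
  shows "a \<in> board (m + n)"
  using unit_dir_cases[of s] assms by (cases a) (auto simp: in_frame_section strip_def board_def)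

lemma shell_subset_board:
  assumes "0 < m" "m < n" "n \<le> 3 * m"
  shows "shell (m, n) \<subseteq> board (m + n)"
proof
  fix a
  assume "a \<in> shell (m, n)"
  then obtain s where "s < 8" "a \<in> frame_section (m, n) s" using shell_square[OF assms] by blast
  then show "a \<in> board (m + n)" by (rule frame_section_board[OF assms(1,2)])
qed

lemma shell_cycle_base:
  assumes mn: "0 < m" "m < n" and C: "shell_cycle (m, n) C"
  obtains a where "set C = set (squares (move_vec (m, n)) a 7 base_word)" "placed (m, n) a 7 base_word"
proof -
  have n3: "n \<le> 3 * m" and lc: "leaper_cycle m n (shell (m, n)) C" and len: "length C = 8"
    using C by auto
  have lb: "leaper_cycle m n (board (m + n)) C" and sh: "set C \<subseteq> shell (m, n)"
    using lc shell_subset_board[OF mn n3] by (auto simp: leaper_cycle_def)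
  have cyc: "cyclic_arcs C \<union> (cyclic_arcs C)\<inverse> \<subseteq> set C \<times> set C"
    by (auto simp: cyclic_arcs_def Suc_mod_less)
  have next_square: "a + move_vec (m, n) (5 * s mod 8) \<in> set C \<and>
      a + move_vec (m, n) (5 * s mod 8) \<in> frame_section (m, n) ((s + 5) mod 8)"
    if a: "a \<in> set C" "a \<in> frame_section (m, n) s" "s < 8" for a s
  proof -
    obtain s' where s': "s' < 8" "a \<in> frame_section (m, n) s'"
      "a + move_vec (m, n) (5 * s' mod 8) \<in> frame_section (m, n) ((s' + 5) mod 8)"
      using shell_square[OF mn n3] sh a(1) by blast
    have "s' = s" using frame_section_disjoint[OF mn s'(1) a(3) s'(2) a(2)] .
    then show ?thesis
      using s'(3) cycle_contains_neighbours[OF mn lb a, of "move_vec (m, n) (5 * s mod 8)"] cyc by blast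
  qed
  define R where "R s \<longleftrightarrow> (\<exists>a\<in>set C. a \<in> frame_section (m, n) s)" for s
  have R: "R s \<Longrightarrow> R ((s + 5) mod 8)" if "s < 8" for s
    using next_square that unfolding R_def by blast
  have R': "R 3 \<Longrightarrow> R 0" "R 6 \<Longrightarrow> R 3" "R 1 \<Longrightarrow> R 6" "R 4 \<Longrightarrow> R 1" "R 7 \<Longrightarrow> R 4" "R 2 \<Longrightarrow> R 7" "R 5 \<Longrightarrow> R 2"
    using R[of 3] R[of 6] R[of 1] R[of 4] R[of 7] R[of 2] R[of 5] by simp_all
  have "C ! 0 \<in> set C" using len by simp
  then obtain s where "s < 8" "R s"
    using shell_square[OF mn n3] sh unfolding R_def by blast
  then have "R 0" using R' unfolding below_eight by auto
  then obtain a where a: "a \<in> set C" "a \<in> frame_section (m, n) 0" by (auto simp: R_def)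
  define b where "b = squares (move_vec (m, n)) a 7 base_word"
  let ?v = "move_vec (m, n)"
  define a1 a2 a3 a4 a5 a6 a7 where "a1 = a + ?v 0" and "a2 = a1 + ?v 1" and "a3 = a2 + ?v 2" and
    "a4 = a3 + ?v 3" and "a5 = a4 + ?v 4" and "a6 = a5 + ?v 5" and "a7 = a6 + ?v 6"
  have 1: "a1 \<in> set C \<and> a1 \<in> frame_section (m, n) 5" using next_square[OF a] by (simp add: a1_def)
  then have 2: "a2 \<in> set C \<and> a2 \<in> frame_section (m, n) 2" using next_square[of a1 5] by (simp add: a2_def)
  then have 3: "a3 \<in> set C \<and> a3 \<in> frame_section (m, n) 7" using next_square[of a2 2] by (simp add: a3_def)
  then have 4: "a4 \<in> set C \<and> a4 \<in> frame_section (m, n) 4" using next_square[of a3 7] by (simp add: a4_def)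
  then have 5: "a5 \<in> set C \<and> a5 \<in> frame_section (m, n) 1" using next_square[of a4 4] by (simp add: a5_def)
  then have 6: "a6 \<in> set C \<and> a6 \<in> frame_section (m, n) 6" using next_square[of a5 1] by (simp add: a6_def)
  then have 7: "a7 \<in> set C \<and> a7 \<in> frame_section (m, n) 3" using next_square[of a6 6] by (simp add: a7_def)
  have b: "b = [a, a1, a2, a3, a4, a5, a6, a7]"
    by (simp add: b_def a1_def a2_def a3_def a4_def a5_def a6_def a7_def step_simps)
  have pl: "placed (m, n) a 7 base_word"
    unfolding placed_def b_def[symmetric] b base_word_dirs using a 1 2 3 4 5 6 7 by simp
  have "distinct b" unfolding b_def by (rule placed_distinct[OF mn pl]) (unfold base_word_dirs, simp)
  then have "card (set b) = card (set C)"
    using len lc distinct_card[of C] by (simp add: b_def leaper_cycle_def distinct_card)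
  moreover have "set b \<subseteq> set C" unfolding b using a 1 2 3 4 5 6 7 by simp
  ultimately have "set C = set b" by (metis card_subset_eq finite_set)
  then show thesis using that pl by (simp add: b_def)
qed


section \<open>The first fundamental cycle\<close>

lemma dir_end_lift:
  assumes "d < 8"
  shows "dir_end (turn x d) (concat (map (phi x) ts)) = turn x (dir_end d ts)"
  using assms
proof (induction ts arbitrary: d)
  case (Cons t ts)
  then show ?case using lift_letter_sections(1)[OF Cons.prems, of x t] Cons.IH[of "step t d"] by simp
qed simp

lemma turn_quarter: "d < 8 \<Longrightarrow> turn x (quarter d) = quarter (turn x d)"
  by (cases x) (simp_all only: turn.simps step_quarter step_less)

lemma length_first_word: "length ts \<le> length (first_word e ts)"
proof (induction e)
  case (Cons x e)
  have "phi x t \<noteq> []" for t by (cases x) auto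
  then have "length us \<le> length (concat (map (phi x) us))" for us
    by (induction us) (auto simp: Suc_le_eq add_strict_increasing)
  then show ?case using Cons.IH le_trans by fastforce
qed simp

lemma first_trail_exists:
  assumes C: "shell_cycle (frame_of w) C" and F: "frame_of (e @ w) = (p, q)"
  shows "\<exists>a d. d < 8 \<and> placed (p, q) a d (first_word e base_word) \<and>
    set (squares (move_vec (p, q)) a d (first_word e base_word)) = lift_set_word e w (set C) \<and>
    dir_end d (first_word e base_word) = d \<and> sq_end (move_vec (p, q)) a d (first_word e base_word) = a \<and>
    distinct (squares (move_vec (p, q)) a d (first_word e base_word)) \<and> dir_end d (first_word e [True, False]) = quarter d"
  using F
proof (induction e arbitrary: p q)
  case Nil
  note mn = frame_of_skew(1,2)[OF Nil[simplified]]
  obtain a where a: "set C = set (squares (move_vec (p, q)) a 7 base_word)" "placed (p, q) a 7 base_word"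
    using shell_cycle_base[OF mn] C Nil by auto
  have "distinct (squares (move_vec (p, q)) a 7 base_word)"
    by (rule placed_distinct[OF mn a(2)]) (unfold base_word_dirs, simp)
  moreover have "dir_end 7 [True, False] = quarter 7" by (simp add: step_simps)
  ultimately show ?case
    using a(1)[symmetric] a(2) base_word_dirs(2) base_word_sq_end[of "(p, q)" a]
    unfolding first_word.simps lift_set_word.simps
    by (intro exI[of _ a] exI[of _ 7] conjI) (assumption | simp)+
next
  case (Cons x e)
  obtain m n where F: "frame_of (e @ w) = (m, n)" by fastforce
  note mn = frame_of_skew(1,2)[OF F]
  have pq: "lift_frame x (m, n) = (p, q)" using Cons.prems F by simp
  obtain a d where IH: "d < 8" "placed (m, n) a d (first_word e base_word)"
    "set (squares (move_vec (m, n)) a d (first_word e base_word)) = lift_set_word e w (set C)"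
    "dir_end d (first_word e base_word) = d" "sq_end (move_vec (m, n)) a d (first_word e base_word) = a"
    "distinct (squares (move_vec (m, n)) a d (first_word e base_word))" "dir_end d (first_word e [True, False]) = quarter d"
    using Cons.IH[OF F] by blast
  let ?a = "a + lift_shift x (m, n) (start_section x d)" and ?d = "turn x d"
  have P: "first_word (x # e) ts = concat (map (phi x) (first_word e ts))" for ts by simp
  note L = lift_trail[OF mn refl IH(1,2), of x, unfolded pq, folded P]
  show ?case
  proof (intro exI[of _ ?a] exI[of _ ?d] conjI)
    show "placed (p, q) ?a ?d (first_word (x # e) base_word)" by (rule L[THEN conjunct1])
    show "set (squares (move_vec (p, q)) ?a ?d (first_word (x # e) base_word)) = lift_set_word (x # e) w (set C)"
      using L[THEN conjunct2, THEN conjunct1] unfolding IH(3) lift_set_word.simps F .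
    show "dir_end ?d (first_word (x # e) base_word) = ?d"
      unfolding P dir_end_lift[OF IH(1)] IH(4) ..
    show "sq_end (move_vec (p, q)) ?a ?d (first_word (x # e) base_word) = ?a"
      using L[THEN conjunct2, THEN conjunct2, THEN conjunct2, THEN conjunct1] unfolding IH(4,5) .
    show "distinct (squares (move_vec (p, q)) ?a ?d (first_word (x # e) base_word))"
      using L[THEN conjunct2, THEN conjunct2, THEN conjunct2, THEN conjunct2] IH(6) by (rule mp)
    show "dir_end ?d (first_word (x # e) [True, False]) = quarter ?d"
      unfolding P dir_end_lift[OF IH(1)] IH(7) turn_quarter[OF IH(1)] ..
  qed simp
qed

lemma move_vec_leaper_moves: "k < 8 \<Longrightarrow> move_vec (m, n) k \<in> leaper_moves m n"
  unfolding below_eight leaper_moves_eq by (elim insertE emptyE) (simp_all add: move_vec_simps)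

lemma placed_in_section:
  assumes "placed F a d ts" "b \<in> set (squares (move_vec F) a d ts)"
  shows "\<exists>s<8. b \<in> frame_section F s"
  using assms sections_less[of _ d ts] unfolding placed_def list_all2_conv_all_nth in_set_conv_nth
  by (metis nth_mem)

lemma leaper_cycle_trail:
  assumes mn: "0 < m" "m < n" and pl: "placed (m, n) a d ts" and c: "sq_end (move_vec (m, n)) a d ts = a"
    and di: "distinct (squares (move_vec (m, n)) a d ts)" and len: "3 \<le> length ts"
  shows "leaper_cycle m n (board (m + n)) (squares (move_vec (m, n)) a d ts)"
proof -
  let ?xs = "squares (move_vec (m, n)) a d ts"
  have "set ?xs \<subseteq> board (m + n)"
    using placed_in_section[OF pl] frame_section_board[OF mn] by blast
  moreover have "y - x \<in> leaper_moves m n" if "(x, y) \<in> cyclic_arcs ?xs" for x y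
  proof -
    from that obtain k where k: "k < length ts" "x = ?xs ! k" "y = ?xs ! (Suc k mod length ts)"
      by (auto simp: cyclic_arcs_def)
    have "dirs d ts ! k < 8" using set_dirs[of d ts] k(1) by (metis length_dirs lessThan_iff nth_mem subsetD)
    then show ?thesis using squares_nth_cyclic[OF c k(1)] k move_vec_leaper_moves by simp
  qed
  ultimately show ?thesis using di len by (auto simp: leaper_cycle_def)
qed

lemma move_vec_eq: "move_vec (m, n) = dvec m n \<circ> first_label"
  by (simp add: move_vec_def)

lemma lifted_from_trail:
  assumes "lifted_from p q C e w C'"
  shows "\<exists>a d. closed_trail p q first_label a d (first_word e base_word) \<and> dir_end d (first_word e [True, False]) = quarter d \<and>
    extracted_graph p q C = extracted_graph p q (squares (dvec p q \<circ> first_label) a d (first_word e base_word))"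
proof -
  have C: "leaper_cycle p q (board (p + q)) C" "frame_of (e @ w) = (p, q)" "shell_cycle (frame_of w) C'"
    "set C = lift_set_word e w (set C')" using assms by (auto simp: lifted_from_def)
  note mn = frame_of_skew(1,2)[OF C(2)]
  obtain a d where t: "d < 8" "placed (p, q) a d (first_word e base_word)"
    "set (squares (move_vec (p, q)) a d (first_word e base_word)) = lift_set_word e w (set C')"
    "dir_end d (first_word e base_word) = d" "sq_end (move_vec (p, q)) a d (first_word e base_word) = a"
    "distinct (squares (move_vec (p, q)) a d (first_word e base_word))" "dir_end d (first_word e [True, False]) = quarter d"
    using first_trail_exists[OF C(3,2)] by blast
  have len: "3 \<le> length (first_word e base_word)" using length_first_word[of base_word e] by simp
  have "closed_trail p q first_label a d (first_word e base_word)"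
    unfolding closed_trail_def move_vec_eq[symmetric] using mn t len by blast
  moreover have "extracted_graph p q C = extracted_graph p q (squares (move_vec (p, q)) a d (first_word e base_word))"
  proof (rule extracted_graph_determined[OF mn C(1) leaper_cycle_trail[OF mn t(2,5,6) len]])
    show "set C = set (squares (move_vec (p, q)) a d (first_word e base_word))" using C(4) t(3) by (rule trans[OF _ sym])
    then show "\<forall>b\<in>set C. \<exists>s<8. b \<in> frame_section (p, q) s" using placed_in_section[OF t(2)] by blast
  qed
  ultimately show ?thesis using t(7) unfolding move_vec_eq by blast
qed

lemma lifted_from_exists:
  assumes C: "shell_cycle (frame_of w) C'" and F: "frame_of (e @ w) = (p, q)"
  shows "\<exists>C. lifted_from p q C e w C'"
proof -
  note mn = frame_of_skew(1,2)[OF F]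
  obtain a d where t: "placed (p, q) a d (first_word e base_word)"
    "set (squares (move_vec (p, q)) a d (first_word e base_word)) = lift_set_word e w (set C')"
    "sq_end (move_vec (p, q)) a d (first_word e base_word) = a" "distinct (squares (move_vec (p, q)) a d (first_word e base_word))"
    using first_trail_exists[OF C F] by blast
  have len: "3 \<le> length (first_word e base_word)" using length_first_word[of base_word e] by simp
  show ?thesis
    using leaper_cycle_trail[OF mn t(1,3,4) len] t(2) C F unfolding lifted_from_def by blast
qed

section \<open>Lifting second cycles\<close>

text \<open>The index of the opposite direction.\<close>

definition opp_index :: "nat \<Rightarrow> nat" where "opp_index k = (k + 4) mod 8"

text \<open>
  The path \<open>xs\<close> from \<open>a\<close>, entered with index \<open>d\<close>, has the types \<open>ts\<close>; it is left with index \<open>e\<close>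
  towards the square \<open>b\<close>.
\<close>

definition run ::
  "(nat \<Rightarrow> square) \<Rightarrow> square \<Rightarrow> nat \<Rightarrow> bool list \<Rightarrow> square list \<Rightarrow> square \<Rightarrow> nat \<Rightarrow> bool" where
  "run v a d ts xs b e \<longleftrightarrow> d < 8 \<and> xs = squares v a d ts \<and> sq_end v a d ts = b \<and> dir_end d ts = e"

lemma opp_index_less [simp]: "opp_index k < 8"
  by (simp add: opp_index_def)

lemma step_opp_index: "k < 8 \<Longrightarrow> step t (opp_index k) = opp_index (step t k)"
proof -
  have "\<forall>k<8. step t (opp_index k) = opp_index (step t k)"
    unfolding All_less_eight by (cases t) (simp_all add: opp_index_def step_simps)
  then show "k < 8 \<Longrightarrow> ?thesis" by blast
qed

lemma run_append:
  "run v a d ts xs b e \<Longrightarrow> run v b e ts' xs' c f \<Longrightarrow> run v a d (ts @ ts') (xs @ xs') c f"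
  by (auto simp: run_def squares_append sq_end_append)

lemma run_translate:
  "run v a d ts xs b e \<Longrightarrow> run v (a + c) d ts (map (\<lambda>x. x + c) xs) (b + c) e"
  by (auto simp: run_def squares_shift sq_end_shift)

lemma run_rev:
  assumes v: "\<forall>k<8. v (opp_index k) = - v k" and "run v a d ts xs b e"
  shows "run v (b - v e) (opp_index e) (rev ts) (rev xs) (a - v d) (opp_index d)"
proof -
  have "d < 8 \<Longrightarrow> run v (sq_end v a d ts - v (dir_end d ts)) (opp_index (dir_end d ts)) (rev ts)
      (rev (squares v a d ts)) (a - v d) (opp_index d)"
  proof (induction ts arbitrary: a d)
    case Nil
    then show ?case by (simp add: run_def)
  next
    case (Cons t ts)
    let ?e = "step t d" and ?b = "a + v (step t d)"
    have "run v a (opp_index ?e) [t] [a] (a - v d) (opp_index d)"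
      using v Cons.prems by (simp add: run_def step_opp_index)
    then have "run v (?b - v ?e) (opp_index ?e) [t] [a] (a - v d) (opp_index d)" by simp
    with Cons.IH[of ?e ?b] show ?case using run_append by simp
  qed
  then show ?thesis using assms(2) by (simp add: run_def)
qed

lemma run_change_first:
  assumes "run v a d (t # ts) xs b e" "step t' d' = step t d" "d' < 8"
  shows "run v a d' (t' # ts) xs b e"
  using assms by (simp add: run_def)

lemma run_change_last:
  assumes "run v a d (ts @ [t]) xs b e" "step t' e' = step t e" "e' < 8"
  shows "run v a d (ts @ [t']) xs (b - v e + v e') e'"
proof -
  have d: "dir_end d ts < 8" using assms(1) by (simp add: run_def dir_end_less)
  have e: "e = step t (dir_end d ts)" using assms(1) by (simp add: run_def)
  then have "step t' e' = dir_end d ts" using assms(2) d by simp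
  then have "step t' (dir_end d ts) = e'" using assms(3) by (metis step_step)
  then show ?thesis using assms(1) e by (auto simp: run_def squares_append sq_end_append)
qed

text \<open>
  The index of the move from the path of the section \<open>i\<close> to the next one. It is \<open>i\<close>, or its neighbour
  of type \<open>True\<close> if \<open>b\<close> holds; \<open>b\<close> changes with every lift of type \<open>LH\<close>.
\<close>

definition junction :: "bool \<Rightarrow> nat \<Rightarrow> nat" where
  "junction b i = (if b then step True i else i)"

lemma junction_less [simp]: "i < 8 \<Longrightarrow> junction b i < 8"
  by (simp add: junction_def)

text \<open>
  The part of the displacement between the starts of the paths of the sections \<open>i\<close> and \<open>i + 2\<close>
  which depends on the frame.
\<close>

fun edge :: "int \<times> int \<Rightarrow> nat \<Rightarrow> square" where
  "edge (m, n) i = [(- m, n), (- n, m), (- n, - m), (- m, - n), (m, - n), (n, - m), (n, m), (m, n)] ! i"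

text \<open>
  The state of a second cycle split into the paths \<open>A i\<close>, which start at \<open>s i\<close>: their types \<open>T\<close>
  depend only on the parity of the section. The displacements \<open>s (i + 2) - s i\<close> are recorded because
  they are what the junctions of the lifted paths depend on.
\<close>

definition frame_runs ::
  "int \<times> int \<Rightarrow> (nat \<Rightarrow> square) \<Rightarrow> bool \<Rightarrow> (bool \<Rightarrow> bool list) \<Rightarrow> (nat \<Rightarrow> square list) \<Rightarrow> (nat \<Rightarrow> square) \<Rightarrow> bool" where
  "frame_runs F v b T A s \<longleftrightarrow>
     (\<forall>i<8. run v (s i) (junction b ((i + 7) mod 8)) (T (even i)) (A i) (s ((i + 1) mod 8)) (junction b i) \<and>
        s ((i + 2) mod 8) - s i = edge F i - v (junction b ((i + 7) mod 8)) \<and>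
        set (A i) \<subseteq> frame_section F i \<and> distinct (A i))"

lemma junction_boundary:
  assumes "i < 8"
  shows "step (even i = b) (junction b ((i + 1) mod 8)) = step (even i \<noteq> b) (junction b ((i + 7) mod 8))"
proof -
  have "\<forall>i<8. step (even i = b) (junction b ((i + 1) mod 8)) = step (even i \<noteq> b) (junction b ((i + 7) mod 8))"
    unfolding All_less_eight by (cases b) (simp_all add: junction_def step_simps del: One_nat_def)
  then show ?thesis using assms by blast
qed

lemma junction_opp_index: "i < 8 \<Longrightarrow> opp_index (junction b i) = junction b ((i + 4) mod 8)"
proof -
  have "\<forall>i<8. opp_index (junction b i) = junction b ((i + 4) mod 8)"
    unfolding All_less_eight by (cases b) (simp_all add: junction_def step_simps opp_index_def)
  then show "i < 8 \<Longrightarrow> ?thesis" by blast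
qed

lemma lift_shift_simps:
  "lift_shift LF (m, n) 0 = (m + n, 0)" "lift_shift LF (m, n) 1 = (m, m)"
  "lift_shift LF (m, n) 2 = (0, m + n)" "lift_shift LF (m, n) 3 = (- m, m)"
  "lift_shift LF (m, n) 4 = (- (m + n), 0)" "lift_shift LF (m, n) 5 = (- m, - m)"
  "lift_shift LF (m, n) 6 = (0, - (m + n))" "lift_shift LF (m, n) 7 = (m, - m)"
  "lift_shift LG (m, n) 0 = (n - m, 0)" "lift_shift LG (m, n) 1 = (n, n)"
  "lift_shift LG (m, n) 2 = (0, n - m)" "lift_shift LG (m, n) 3 = (- n, n)"
  "lift_shift LG (m, n) 4 = (- (n - m), 0)" "lift_shift LG (m, n) 5 = (- n, - n)"
  "lift_shift LG (m, n) 6 = (0, - (n - m))" "lift_shift LG (m, n) 7 = (n, - n)"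
  "lift_shift LH (m, n) 0 = (m + n, 0)" "lift_shift LH (m, n) 1 = (n, n)"
  "lift_shift LH (m, n) 2 = (0, m + n)" "lift_shift LH (m, n) 3 = (- n, n)"
  "lift_shift LH (m, n) 4 = (- (m + n), 0)" "lift_shift LH (m, n) 5 = (- n, - n)"
  "lift_shift LH (m, n) 6 = (0, - (m + n))" "lift_shift LH (m, n) 7 = (n, - n)"
  by (simp_all add: scale_def unit_dir_simps)

lemma edge_simps:
  "edge (m, n) 0 = (- m, n)" "edge (m, n) 1 = (- n, m)" "edge (m, n) 2 = (- n, - m)"
  "edge (m, n) 3 = (- m, - n)" "edge (m, n) 4 = (m, - n)" "edge (m, n) 5 = (n, - m)"
  "edge (m, n) 6 = (n, m)" "edge (m, n) 7 = (m, n)"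
  by simp_all

lemma edge_shift:
  assumes "i < 8"
  shows "lift_shift x F ((i + 1) mod 8) = lift_shift x F i +
    edge F (case x of LF \<Rightarrow> if even i then (i + 1) mod 8 else (i + 7) mod 8
      | LG \<Rightarrow> if even i then (i + 7) mod 8 else (i + 1) mod 8 | LH \<Rightarrow> i)"
    and "edge (lift_frame x F) i = lift_shift x F ((i + 2) mod 8) - lift_shift x F i +
    edge F (case x of LF \<Rightarrow> if even i then (i + 6) mod 8 else i
      | LG \<Rightarrow> if even i then i else (i + 6) mod 8 | LH \<Rightarrow> (i + 7) mod 8)"
proof -
  obtain m n where F: "F = (m, n)" by (cases F)
  have "(\<forall>i<8. lift_shift x (m, n) ((i + 1) mod 8) = lift_shift x (m, n) i +
    edge (m, n) (case x of LF \<Rightarrow> if even i then (i + 1) mod 8 else (i + 7) mod 8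
      | LG \<Rightarrow> if even i then (i + 7) mod 8 else (i + 1) mod 8 | LH \<Rightarrow> i))"
    unfolding All_less_eight
    by (cases x; hypsubst; simp add: lift_shift_simps edge_simps del: lift_shift.simps edge.simps One_nat_def)
  then show "lift_shift x F ((i + 1) mod 8) = lift_shift x F i +
    edge F (case x of LF \<Rightarrow> if even i then (i + 1) mod 8 else (i + 7) mod 8
      | LG \<Rightarrow> if even i then (i + 7) mod 8 else (i + 1) mod 8 | LH \<Rightarrow> i)"
    using assms unfolding F by (elim allE impE)
  have "(\<forall>i<8. edge (lift_frame x (m, n)) i = lift_shift x (m, n) ((i + 2) mod 8) - lift_shift x (m, n) i +
    edge (m, n) (case x of LF \<Rightarrow> if even i then (i + 6) mod 8 else i
      | LG \<Rightarrow> if even i then i else (i + 6) mod 8 | LH \<Rightarrow> (i + 7) mod 8))"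
    unfolding All_less_eight
    by (cases x; hypsubst; simp add: lift_shift_simps edge_simps numeral_2_eq_2[symmetric]
      del: lift_shift.simps edge.simps One_nat_def)
  then show "edge (lift_frame x F) i = lift_shift x F ((i + 2) mod 8) - lift_shift x F i +
    edge F (case x of LF \<Rightarrow> if even i then (i + 6) mod 8 else i
      | LG \<Rightarrow> if even i then i else (i + 6) mod 8 | LH \<Rightarrow> (i + 7) mod 8)"
    using assms unfolding F by (elim allE impE)
qed

lemma run_surround:
  assumes r: "run v a d (wa @ wb @ wa) xs b e" and ne: "wa \<noteq> []" "wb \<noteq> []" and pal: "rev wa = wa"
    and first: "step (hd wb) d' = step (hd wa) d" "d' < 8" and last: "step (hd wb) e' = step (hd wa) e" "e' < 8"
  shows "run v a d' (surround wa wb) xs (b - v e + v e') e'"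
proof -
  obtain z w where w: "wa = z # w" using ne by (cases wa) auto
  have "wa = butlast wa @ [last wa]" using ne by simp
  moreover have "last wa = z" using pal ne w by (metis hd_rev list.sel(1))
  ultimately have w': "wa = butlast wa @ [z]" by simp
  have "wa @ wb @ wa = (wa @ wb @ butlast wa) @ [z]" by (simp flip: w')
  with r have "run v a d ((wa @ wb @ butlast wa) @ [z]) xs b e" by (simp only:)
  then have "run v a d ((wa @ wb @ butlast wa) @ [hd wb]) xs (b - v e + v e') e'"
    by (rule run_change_last) (use last w in simp_all)
  then have "run v a d (z # w @ wb @ butlast wa @ [hd wb]) xs (b - v e + v e') e'" by (simp add: w)
  then have "run v a d' (hd wb # w @ wb @ butlast wa @ [hd wb]) xs (b - v e + v e') e'"
    by (rule run_change_first) (use first w in simp_all)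
  then show ?thesis by (simp add: surround_def w)
qed


text \<open>Index arithmetic modulo 8, kept opaque so that indices have a normal form.\<close>

definition ix :: "nat \<Rightarrow> nat \<Rightarrow> nat" where "ix i k = (i + k) mod 8"

lemma ix_less [simp]: "ix i k < 8"
  by (simp add: ix_def)

lemma ix_ix [simp]: "ix (ix i k) j = ix i ((k + j) mod 8)"
  by (simp add: ix_def mod_simps add.assoc)

lemma ix_0 [simp]: "i < 8 \<Longrightarrow> ix i 0 = i"
  by (simp add: ix_def)

lemma even_ix [simp]: "even (ix i k) \<longleftrightarrow> (even i \<longleftrightarrow> even k)"
proof -
  have "even (ix i k) \<longleftrightarrow> even (i + k)" unfolding ix_def by presburger
  then show ?thesis by simp
qed

lemma step_True_ix:
  assumes "i < 8"
  shows "even i \<Longrightarrow> step True i = ix i 7" "odd i \<Longrightarrow> step True i = ix i 1"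
    "even i \<Longrightarrow> step True (ix i 7) = i" "odd i \<Longrightarrow> step True (ix i 7) = ix i 6"
proof -
  have "\<forall>i<8. (even i \<longrightarrow> step True i = ix i 7 \<and> step True (ix i 7) = i) \<and>
      (odd i \<longrightarrow> step True i = ix i 1 \<and> step True (ix i 7) = ix i 6)"
    unfolding All_less_eight by (simp add: ix_def step_simps)
  then show "even i \<Longrightarrow> step True i = ix i 7" "odd i \<Longrightarrow> step True i = ix i 1"
    "even i \<Longrightarrow> step True (ix i 7) = i" "odd i \<Longrightarrow> step True (ix i 7) = ix i 6"
    using assms by blast+
qed

lemma junction_Not: "k < 8 \<Longrightarrow> junction (\<not> b) k = junction b (step True k)"
  by (simp add: junction_def)

lemma join_paths_ix:
  "join_paths LF A i = (if even i then rev (A (ix i 5)) @ rev (A (ix i 4)) @ rev (A (ix i 3)) else A i)"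
  "join_paths LG A i = (if even i then A i else rev (A (ix i 5)) @ rev (A (ix i 4)) @ rev (A (ix i 3)))"
  "join_paths LH A i = (if even i then rev (A (ix i 6)) @ rev (A (ix i 5)) @ rev (A (ix i 4)) @
     rev (A (ix i 3)) @ rev (A (ix i 2)) else A (ix i 7) @ A i @ A (ix i 1))"
  by (simp_all only: join_paths.simps ix_def)

lemma set_join_paths: "set (join_paths x A i) = (\<Union>j\<in>set (sources x i). set (A j))"
  by (cases x) auto

lemma sources_distinct:
  assumes "i < 8"
  shows "distinct (sources x i)" "set (sources x i) \<subseteq> {..<8}"
proof -
  have "\<forall>i<8. distinct (sources x i)"
    unfolding All_less_eight by (cases x) simp_all
  then show "distinct (sources x i)" using assms by blast
  show "set (sources x i) \<subseteq> {..<8}" using assms by (cases x) auto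
qed

lemma distinct_join_paths:
  assumes "i < 8" "\<And>j. j < 8 \<Longrightarrow> distinct (A j)" "\<And>j k. j < 8 \<Longrightarrow> k < 8 \<Longrightarrow> j \<noteq> k \<Longrightarrow> set (A j) \<inter> set (A k) = {}"
  shows "distinct (join_paths x A i)"
proof -
  have "distinct (concat (map A js))" if "distinct js" "set js \<subseteq> {..<8}" for js
    using that assms(2,3) by (induction js) force+
  moreover have "distinct (concat (map (\<lambda>j. rev (A j)) js))" if "distinct js" "set js \<subseteq> {..<8}" for js
    using that assms(2,3) by (induction js) force+
  moreover have "join_paths x A i = concat (map A (sources x i)) \<or>
      join_paths x A i = concat (map (\<lambda>j. rev (A j)) (sources x i))"
    by (cases x) auto
  ultimately show ?thesis using sources_distinct[OF assms(1)] by metis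
qed

text \<open>The starts of the joined paths before they are translated.\<close>

fun lift_start :: "lift_type \<Rightarrow> (nat \<Rightarrow> square) \<Rightarrow> bool \<Rightarrow> (nat \<Rightarrow> square) \<Rightarrow> nat \<Rightarrow> square" where
  "lift_start LF v b s i = (if even i then s (ix i 6) - v (junction b (ix i 5)) else s i)"
| "lift_start LG v b s i = (if even i then s i else s (ix i 6) - v (junction b (ix i 5)))"
| "lift_start LH v b s i = (if even i then s (ix i 7) - v (junction b (ix i 6)) else s (ix i 7))"

lemma frame_runs_lift:
  fixes x :: lift_type
  assumes mn: "0 < m" "m < n" and F: "F = (m, n)" and v: "\<forall>k<8. v (opp_index k) = - v k"
    and runs: "frame_runs F v b T A s"
    and T: "\<And>t. T t \<noteq> []" "\<And>t. rev (T t) = T t" "\<And>t. hd (T t) = (t \<noteq> b)"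
  shows "frame_runs (lift_frame x F) v (if x = LH then \<not> b else b) (join_word x T) (lift_paths x F A)
    (\<lambda>i. lift_start x v b s i + lift_shift x F i)"
proof -
  let ?q = "junction b"
  have R: "run v (s j) (?q (ix j 7)) (T (even j)) (A j) (s (ix j 1)) (?q j)" if "j < 8" for j
    using runs that by (simp add: frame_runs_def ix_def)
  have E: "s (ix j 2) = s j + edge F j - v (?q (ix j 7))" if "j < 8" for j
  proof -
    have "s (ix j 2) - s j = edge F j - v (?q (ix j 7))"
      using runs that by (simp add: frame_runs_def ix_def)
    then show ?thesis by (simp add: algebra_simps)
  qed
  have A: "set (A j) \<subseteq> frame_section F j" "distinct (A j)" if "j < 8" for j
    using runs that by (simp_all add: frame_runs_def)
  have O: "opp_index (?q j) = ?q (ix j 4)" if "j < 8" for j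
    using junction_opp_index[OF that] by (simp add: ix_def)
  have vO: "v (?q (ix j 4)) = - v (?q j)" if "j < 8" for j
    using v O[OF that] junction_less[OF that] by metis
  have B: "step (even j = b) (?q (ix j 1)) = step (even j \<noteq> b) (?q (ix j 7))" if "j < 8" for j
    using junction_boundary[OF that, of b] by (simp add: ix_def)
  have RR: "run v (s (ix j 1) - v (?q j)) (?q (ix j 4)) (T (even j)) (rev (A j))
      (s j - v (?q (ix j 7))) (?q (ix j 3))" if "j < 8" for j
    using run_rev[OF v R[OF that]] that by (simp add: T(2) O)
  \<comment> \<open>the lifted path of a section, before translation, if it is made of three old paths\<close>
  have three: "run v (s (ix i 6) - v (?q (ix i 5))) (?q (ix i 7)) (surround (T (odd i)) (T (even i)))
      (rev (A (ix i 5)) @ rev (A (ix i 4)) @ rev (A (ix i 3))) (s (ix i 3) + v (?q i)) (?q i)"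
    if i: "i < 8" for i
  proof -
    have r5: "run v (s (ix i 6) - v (?q (ix i 5))) (?q (ix i 1)) (T (odd i)) (rev (A (ix i 5)))
        (s (ix i 5) - v (?q (ix i 4))) (?q i)"
      using RR[of "ix i 5"] i by simp
    have r4: "run v (s (ix i 5) - v (?q (ix i 4))) (?q i) (T (even i)) (rev (A (ix i 4)))
        (s (ix i 4) - v (?q (ix i 3))) (?q (ix i 7))"
      using RR[of "ix i 4"] i by simp
    have r3: "run v (s (ix i 4) - v (?q (ix i 3))) (?q (ix i 7)) (T (odd i)) (rev (A (ix i 3)))
        (s (ix i 3) - v (?q (ix i 2))) (?q (ix i 6))"
      using RR[of "ix i 3"] i by simp
    note r = run_append[OF r5 run_append[OF r4 r3]]
    have "run v (s (ix i 6) - v (?q (ix i 5))) (?q (ix i 7)) (surround (T (odd i)) (T (even i)))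
      (rev (A (ix i 5)) @ rev (A (ix i 4)) @ rev (A (ix i 3)))
      (s (ix i 3) - v (?q (ix i 2)) - v (?q (ix i 6)) + v (?q i)) (?q i)"
    proof (rule run_surround[OF r T(1) T(1) T(2)])
      show "step (hd (T (even i))) (?q (ix i 7)) = step (hd (T (odd i))) (?q (ix i 1))"
        using B[OF i] by (simp add: T(3))
      show "step (hd (T (even i))) (?q i) = step (hd (T (odd i))) (?q (ix i 6))"
      proof -
        have "(even i \<noteq> b) = (odd i = b)" "(odd i \<noteq> b) = (even i = b)" by auto
        moreover have "step (odd i = b) (?q i) = step (even i = b) (?q (ix i 6))"
          using B[of "ix i 7"] i by simp
        ultimately show ?thesis unfolding T(3) by (simp only:)
      qed
    qed (use i in simp_all)
    then show ?thesis using vO[of "ix i 2"] by simp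
  qed
  have sh: "lift_shift x F (ix i 1) = lift_shift x F i +
    edge F (case x of LF \<Rightarrow> if even i then ix i 1 else ix i 7
      | LG \<Rightarrow> if even i then ix i 7 else ix i 1 | LH \<Rightarrow> i)" if "i < 8" for i
    using edge_shift(1)[OF that, of x F] by (simp only: ix_def)
  have ed: "edge (lift_frame x F) i = lift_shift x F (ix i 2) - lift_shift x F i +
    edge F (case x of LF \<Rightarrow> if even i then ix i 6 else i
      | LG \<Rightarrow> if even i then i else ix i 6 | LH \<Rightarrow> ix i 7)" if "i < 8" for i
    using edge_shift(2)[OF that, of x F] by (simp only: ix_def)
  let ?b = "if x = LH then \<not> b else b" and ?s = "\<lambda>i. lift_start x v b s i + lift_shift x F i"
  have main: "run v (?s i) (junction ?b (ix i 7)) (join_word x T (even i)) (lift_paths x F A i) (?s (ix i 1)) (junction ?b i)"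
    if i: "i < 8" for i
  proof -
    obtain c where c: "run v (lift_start x v b s i) (junction ?b (ix i 7)) (join_word x T (even i))
        (join_paths x A i) c (junction ?b i)" "c + lift_shift x F i = ?s (ix i 1)"
    proof (cases x)
      case LF
      show thesis
      proof (cases "even i")
        case True
        then show thesis using that[of "s (ix i 3) + v (?q i)"] three[OF i] LF i sh[OF i] E[of "ix i 1"]
          by (simp add: join_paths_ix del: join_paths.simps)
      next
        case False
        then show thesis using that[of "s (ix i 1)"] R[OF i] LF i sh[OF i] E[of "ix i 7"]
          by (simp add: join_paths_ix del: join_paths.simps)
      qed
    next
      case LG
      show thesis
      proof (cases "even i")
        case True
        then show thesis using that[of "s (ix i 1)"] R[OF i] LG i sh[OF i] E[of "ix i 7"]
          by (simp add: join_paths_ix del: join_paths.simps)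
      next
        case False
        then show thesis using that[of "s (ix i 3) + v (?q i)"] three[OF i] LG i sh[OF i] E[of "ix i 1"]
          by (simp add: join_paths_ix del: join_paths.simps)
      qed
    next
      case LH
      show thesis
      proof (cases "even i")
        case True
        have r6: "run v (s (ix i 7) - v (?q (ix i 6))) (?q (ix i 2)) (T True) (rev (A (ix i 6)))
            (s (ix i 6) - v (?q (ix i 5))) (?q (ix i 1))"
          using RR[of "ix i 6"] i True by simp
        have r5: "run v (s (ix i 6) - v (?q (ix i 5))) (?q (ix i 1)) (T False) (rev (A (ix i 5)))
            (s (ix i 5) - v (?q (ix i 4))) (?q i)"
          using RR[of "ix i 5"] i True by simp
        have r4: "run v (s (ix i 5) - v (?q (ix i 4))) (?q i) (T True) (rev (A (ix i 4)))
            (s (ix i 4) - v (?q (ix i 3))) (?q (ix i 7))"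
          using RR[of "ix i 4"] i True by simp
        have r3: "run v (s (ix i 4) - v (?q (ix i 3))) (?q (ix i 7)) (T False) (rev (A (ix i 3)))
            (s (ix i 3) - v (?q (ix i 2))) (?q (ix i 6))"
          using RR[of "ix i 3"] i True by simp
        have r2: "run v (s (ix i 3) - v (?q (ix i 2))) (?q (ix i 6)) (T True) (rev (A (ix i 2)))
            (s (ix i 2) - v (?q (ix i 1))) (?q (ix i 5))"
          using RR[of "ix i 2"] i True by simp
        note r = run_append[OF r6 run_append[OF run_append[OF r5 run_append[OF r4 r3]] r2]]
        have h: "hd (T False @ T True @ T False) = hd (T False)" using T(1) by simp
        have "run v (s (ix i 7) - v (?q (ix i 6))) (?q i) (surround (T True) (T False @ T True @ T False))
            (rev (A (ix i 6)) @ (rev (A (ix i 5)) @ rev (A (ix i 4)) @ rev (A (ix i 3))) @ rev (A (ix i 2)))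
            (s (ix i 2) - v (?q (ix i 1)) - v (?q (ix i 5)) + v (?q (ix i 7))) (?q (ix i 7))"
        proof (rule run_surround[OF r T(1) _ T(2)], unfold h)
          show "step (hd (T False)) (?q i) = step (hd (T True)) (?q (ix i 2))"
            using B[of "ix i 1"] i True by (simp add: T(3) del: One_nat_def)
          show "step (hd (T False)) (?q (ix i 7)) = step (hd (T True)) (?q (ix i 5))"
            using B[of "ix i 6"] i True by (simp add: T(3))
        qed (use i T(1) in simp_all)
        moreover have "surround (T True) (T False @ T True @ T False) = join_word LH T True"
          using h by (simp add: surround_def)
        ultimately show thesis
          using that[of "s (ix i 2) + v (?q (ix i 7))"] LH i True sh[OF i] E[OF i] vO[of "ix i 1"]
            step_True_ix[OF i] by (simp add: junction_Not join_paths_ix del: join_word.simps join_paths.simps)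
      next
        case False
        have r1: "run v (s (ix i 7)) (?q (ix i 6)) (T True) (A (ix i 7)) (s i) (?q (ix i 7))"
          using R[of "ix i 7"] i False by simp
        have r2: "run v (s i) (?q (ix i 7)) (T False) (A i) (s (ix i 1)) (?q i)"
          using R[OF i] False by simp
        have r3: "run v (s (ix i 1)) (?q i) (T True) (A (ix i 1)) (s (ix i 2)) (?q (ix i 1))"
          using R[of "ix i 1"] i False by (simp del: One_nat_def)
        show thesis using that[of "s (ix i 2)"] run_append[OF r1 run_append[OF r2 r3]] LH i False sh[OF i] E[OF i]
            step_True_ix[OF i] by (simp add: junction_Not join_paths_ix del: join_paths.simps)
      qed
    qed
    then show ?thesis using run_translate[OF c(1), of "lift_shift x F i"] by (simp only: lift_paths_def)
  qed
  have edges: "?s (ix i 2) - ?s i = edge (lift_frame x F) i - v (junction ?b (ix i 7))" if i: "i < 8" for i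
  proof -
    have v15: "v (?q (ix i 5)) = - v (?q (ix i 1))" using vO[of "ix i 1"] by (simp del: One_nat_def)
    have v26: "v (?q (ix i 6)) = - v (?q (ix i 2))" using vO[of "ix i 2"] by simp
    have v37: "v (?q (ix i 7)) = - v (?q (ix i 3))" using vO[of "ix i 3"] by simp
    have v04: "v (?q (ix i 4)) = - v (?q i)" using vO[OF i] .
    have E6: "s i = s (ix i 6) + edge F (ix i 6) - v (?q (ix i 5))" using E[of "ix i 6"] i by simp
    have E7: "s (ix i 1) = s (ix i 7) + edge F (ix i 7) - v (?q (ix i 6))" using E[of "ix i 7"] i by simp
    have LS: "lift_start LF v b s (ix i 2) = (if even i then s i - v (?q (ix i 7)) else s (ix i 2))"
      "lift_start LG v b s (ix i 2) = (if even i then s (ix i 2) else s i - v (?q (ix i 7)))"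
      "lift_start LH v b s (ix i 2) = (if even i then s (ix i 1) - v (?q i) else s (ix i 1))"
      using i by simp_all
    show ?thesis
    proof (cases x)
      case LF
      then show ?thesis
        using ed[OF i] E[OF i] E6 v37 v15 LS by (simp add: algebra_simps)
    next
      case LG
      then show ?thesis
        using ed[OF i] E[OF i] E6 v37 v15 LS by (simp add: algebra_simps)
    next
      case LH
      then show ?thesis
        using ed[OF i] E7 v04 v26 LS step_True_ix[OF i]
        by (cases "even i") (simp_all add: algebra_simps junction_Not)
    qed
  qed
  have sect: "set (lift_paths x F A i) \<subseteq> frame_section (lift_frame x F) i" if i: "i < 8" for i
  proof
    fix c
    assume "c \<in> set (lift_paths x F A i)"
    then obtain j a where j: "j \<in> set (sources x i)" "a \<in> set (A j)" "c = a + lift_shift x F i"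
      by (auto simp: lift_paths_def set_join_paths)
    then have "j < 8" using sources_distinct(2)[OF i] by blast
    then show "c \<in> frame_section (lift_frame x F) i"
      using lift_in_section_iff[OF mn, of a j i x] A(1)[of j] j i F by blast
  qed
  have dist: "distinct (lift_paths x F A i)" if i: "i < 8" for i
  proof -
    have "set (A j) \<inter> set (A k) = {}" if "j < 8" "k < 8" "j \<noteq> k" for j k
      using A(1)[of j] A(1)[of k] that frame_section_disjoint[OF mn, of j k] F by blast
    from distinct_join_paths[OF i A(2) this] show ?thesis
      by (simp add: lift_paths_def distinct_map inj_on_def)
  qed
  show ?thesis
    unfolding frame_runs_def
    by (intro allI impI conjI main[unfolded ix_def] edges[unfolded ix_def] sect dist)
qed

section \<open>The second fundamental cycles\<close>

text \<open>The parity of the number of lifts of type \<open>LH\<close>.\<close>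

primrec swapped :: "lift_type list \<Rightarrow> bool" where
  "swapped [] = False"
| "swapped (x # e) = (if x = LH then \<not> swapped e else swapped e)"

lemma hd_second_word: "hd (second_word e t) = (t \<noteq> swapped e)"
proof (induction e arbitrary: t)
  case (Cons x e)
  show ?case
    by (cases x; cases t) (simp_all add: surround_def Cons.IH second_word_ne)
qed simp

text \<open>
  The moves of the canonical second leaper between consecutive sections, in terms of the frame
  \<open>(m, n)\<close> of the shell cycle. Its proportions are \<open>\<bar>2m - n\<bar>\<close> and \<open>m\<close>, where
  \<open>2m - n\<close> is positive for the origin g and negative for h.
\<close>

definition second_vectors :: "int \<times> int \<Rightarrow> (nat \<Rightarrow> square) \<Rightarrow> bool" where
  "second_vectors F v \<longleftrightarrow> (case F of (m, n) \<Rightarrow>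
     map v [0..<8] = [(2 * m - n, m), (- m, n - 2 * m), (- m, 2 * m - n), (2 * m - n, - m),
       (n - 2 * m, - m), (m, 2 * m - n), (m, n - 2 * m), (n - 2 * m, m)])"

lemma upt_eight: "[0..<8] = [0, 1, 2, 3, 4, 5, 6, 7::nat]"
  by (simp add: upt_rec)

lemma second_vectors_simps:
  assumes "second_vectors (m, n) v"
  shows "v 0 = (2 * m - n, m)" "v 1 = (- m, n - 2 * m)" "v (Suc 0) = (- m, n - 2 * m)"
    "v 2 = (- m, 2 * m - n)" "v 3 = (2 * m - n, - m)" "v 4 = (n - 2 * m, - m)"
    "v 5 = (m, 2 * m - n)" "v 6 = (m, n - 2 * m)" "v 7 = (n - 2 * m, m)"
  using assms by (simp_all add: second_vectors_def upt_eight)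

lemma second_vectors_opp_index:
  assumes "second_vectors F v"
  shows "\<forall>k<8. v (opp_index k) = - v k"
proof (cases F)
  case (Pair m n)
  then show ?thesis using second_vectors_simps[of m n v] assms
    unfolding All_less_eight by (simp add: opp_index_def)
qed

lemma base_word_frame_runs:
  assumes C: "shell_cycle F C" and F: "F = (m, n)" and mn: "0 < m" "m < n" and v: "second_vectors F v"
  shows "\<exists>s. frame_runs F v False (\<lambda>t. [t]) (section_paths F (set C)) s"
proof -
  obtain a where a: "set C = set (squares (move_vec F) a 7 base_word)" "placed F a 7 base_word"
    using shell_cycle_base[OF mn C[unfolded F]] unfolding F .
  define xs where "xs = squares (move_vec F) a 7 base_word"
  have len: "length xs = 8" by (simp add: xs_def)
  have sec: "xs ! k \<in> frame_section F (5 * k mod 8)" if "k < 8" for k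
  proof -
    have "\<forall>k<8. [0, 5, 2, 7, 4, 1, 6, 3] ! k = 5 * k mod (8::nat)"
      unfolding All_less_eight by simp
    moreover have "\<forall>k<8. xs ! k \<in> frame_section F ([0, 5, 2, 7, 4, 1, 6, 3] ! k)"
      using a(2) len unfolding placed_def base_word_dirs xs_def[symmetric] list_all2_conv_all_nth by simp
    ultimately show ?thesis using that by simp
  qed
  have five: "\<forall>i<8. 5 * (5 * i mod 8) mod 8 = (i::nat)"
    unfolding All_less_eight by simp
  \<comment> \<open>the walk visits the sections in steps of 5, and 5 is its own inverse modulo 8\<close>
  define s where "s i = xs ! (5 * i mod 8)" for i
  have s: "s i \<in> frame_section F i" if "i < 8" for i
  proof -
    have "5 * (5 * i mod 8) mod 8 = i" using five that by blast
    moreover have "5 * i mod 8 < 8" by simp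
    ultimately show ?thesis using sec[of "5 * i mod 8"] unfolding s_def by (simp only:)
  qed
  have path: "section_paths F (set C) i = [s i]" if i: "i < 8" for i
  proof -
    have "b = s i" if b: "b \<in> set C" "b \<in> frame_section F i" for b
    proof -
      obtain k where k: "k < 8" "b = xs ! k"
        using b(1) unfolding a(1) xs_def[symmetric] in_set_conv_nth len by blast
      have b': "b \<in> frame_section (m, n) (5 * k mod 8)"
        using sec[OF k(1)] unfolding k(2) F .
      have "5 * k mod 8 = i"
        by (rule frame_section_disjoint[OF mn _ i b' b(2)[unfolded F]]) simp
      moreover have "5 * (5 * k mod 8) mod 8 = k" using five k(1) by blast
      ultimately have "5 * i mod 8 = k" by (simp only:)
      then show ?thesis unfolding s_def k(2) by (simp only:)
    qed
    moreover have "s i \<in> set C"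
      unfolding a(1) xs_def[symmetric] s_def by (rule nth_mem) (simp add: len)
    ultimately have "(THE b. b \<in> set C \<inter> frame_section F i) = s i"
      using s[OF i] by (intro the_equality IntI) blast+
    then show ?thesis by (simp add: section_paths_def)
  qed
  obtain x y where xy: "a = (x, y)" by (cases a)
  note vs = second_vectors_simps[OF v[unfolded F]]
  have "xs = [(x, y), (x - n, y - m), (x - n + m, y + n - m), (x - n + 2 * m, y - m), (x + 2 * m - 2 * n, y),
      (x + 2 * m - n, y + m), (x + m - n, y + m - n), (x - n, y + m)]"
    by (simp add: xs_def step_simps move_vec_simps F xy)
  then have ss: "s 0 = (x, y)" "s 1 = (x + 2 * m - n, y + m)" "s 2 = (x - n + m, y + n - m)"
    "s 3 = (x - n, y + m)" "s 4 = (x + 2 * m - 2 * n, y)" "s 5 = (x - n, y - m)"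
    "s 6 = (x + m - n, y + m - n)" "s 7 = (x - n + 2 * m, y - m)"
    by (simp_all add: s_def)
  have rel1: "\<forall>i<8. s ((i + 1) mod 8) = s i + v i"
    unfolding All_less_eight
    by (simp add: ss vs numeral_2_eq_2[symmetric] del: One_nat_def)
  have rel2: "\<forall>i<8. s ((i + 2) mod 8) - s i = edge F i - v ((i + 7) mod 8)"
    unfolding All_less_eight F
    by (simp add: ss vs edge_simps numeral_2_eq_2[symmetric] del: One_nat_def edge.simps)
  have st: "\<forall>i<8. step (even i) ((i + 7) mod 8) = i"
    unfolding All_less_eight by (simp add: step_simps)
  have "frame_runs F v False (\<lambda>t. [t]) (section_paths F (set C)) s"
    unfolding frame_runs_def
  proof (intro allI impI)
    fix i :: nat
    assume i: "i < 8"
    have "run v (s i) ((i + 7) mod 8) [even i] [s i] (s ((i + 1) mod 8)) i"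
      unfolding run_def using st[rule_format, OF i] rel1[rule_format, OF i] by simp
    then show "run v (s i) (junction False ((i + 7) mod 8)) [even i] (section_paths F (set C) i)
          (s ((i + 1) mod 8)) (junction False i) \<and>
        s ((i + 2) mod 8) - s i = edge F i - v (junction False ((i + 7) mod 8)) \<and>
        set (section_paths F (set C) i) \<subseteq> frame_section F i \<and> distinct (section_paths F (set C) i)"
      unfolding path[OF i] junction_def if_False using rel2[rule_format, OF i] s[OF i]
      by (intro conjI) simp_all
  qed
  then show ?thesis by blast
qed

lemma second_frame_runs:
  assumes C: "shell_cycle (frame_of w) C" and v: "second_vectors (frame_of w) v"
  shows "\<exists>s. frame_runs (frame_of (e @ w)) v (swapped e) (second_word e) (second_paths e w (set C)) s"
proof (induction e)
  case Nil
  obtain m n where F: "frame_of w = (m, n)" by fastforce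
  show ?case using base_word_frame_runs[OF C F frame_of_skew(1,2)[OF F] v] by simp
next
  case (Cons x e)
  then obtain s where s: "frame_runs (frame_of (e @ w)) v (swapped e) (second_word e) (second_paths e w (set C)) s"
    by blast
  obtain m n where F: "frame_of (e @ w) = (m, n)" by fastforce
  show ?case
    using frame_runs_lift[OF frame_of_skew(1,2)[OF F] F second_vectors_opp_index[OF v] s second_word_ne second_word_pal hd_second_word, of x]
    by (auto simp del: join_word.simps)
qed

lemma second_cycle_trail:
  assumes C: "lifted_from p q C e w C'" and rs: "0 < r" "r < s"
    and v: "second_vectors (frame_of w) (dvec r s \<circ> lab)"
  defines "d \<equiv> junction (swapped e) 7" and "ts \<equiv> concat (replicate 4 (second_word e True @ second_word e False))"
  shows "\<exists>a. closed_trail r s lab a d ts \<and> second_cycle e w C' = squares (dvec r s \<circ> lab) a d ts"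
    and "dir_end d (second_word e True @ second_word e False) = quarter d"
proof -
  let ?v = "dvec r s \<circ> lab" and ?T = "second_word e" and ?A = "second_paths e w (set C')" and ?q = "junction (swapped e)"
  have sh: "shell_cycle (frame_of w) C'" using C by (simp add: lifted_from_def)
  obtain a where fr: "frame_runs (frame_of (e @ w)) ?v (swapped e) ?T ?A a"
    using second_frame_runs[OF sh v] by blast
  obtain m n where F: "frame_of (e @ w) = (m, n)" by fastforce
  note mn = frame_of_skew(1,2)[OF F]
  have R: "run ?v (a i) (?q ((i + 7) mod 8)) (?T (even i)) (?A i) (a ((i + 1) mod 8)) (?q i)"
    and S: "set (?A i) \<subseteq> frame_section (m, n) i" "distinct (?A i)" if "i < 8" for i
    using fr that F by (simp_all add: frame_runs_def)
  have r: "run ?v (a 0) (?q 7) (?T True) (?A 0) (a 1) (?q 0)"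
    "run ?v (a 1) (?q 0) (?T False) (?A 1) (a 2) (?q 1)" "run ?v (a 2) (?q 1) (?T True) (?A 2) (a 3) (?q 2)"
    "run ?v (a 3) (?q 2) (?T False) (?A 3) (a 4) (?q 3)" "run ?v (a 4) (?q 3) (?T True) (?A 4) (a 5) (?q 4)"
    "run ?v (a 5) (?q 4) (?T False) (?A 5) (a 6) (?q 5)" "run ?v (a 6) (?q 5) (?T True) (?A 6) (a 7) (?q 6)"
    "run ?v (a 7) (?q 6) (?T False) (?A 7) (a 0) (?q 7)"
    using R[of 0] R[of 1] R[of 2] R[of 3] R[of 4] R[of 5] R[of 6] R[of 7] by (simp_all add: numeral_2_eq_2[symmetric])
  have cyc: "second_cycle e w C' = ?A 0 @ ?A 1 @ ?A 2 @ ?A 3 @ ?A 4 @ ?A 5 @ ?A 6 @ ?A 7"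
    by (simp add: second_cycle_def upt_eight)
  have ts: "ts = ?T True @ ?T False @ ?T True @ ?T False @ ?T True @ ?T False @ ?T True @ ?T False"
    by (simp add: ts_def numeral_eq_Suc)
  have all: "run ?v (a 0) d ts (second_cycle e w C') (a 0) d"
    unfolding cyc ts d_def
    by (rule run_append[OF r(1) run_append[OF r(2) run_append[OF r(3) run_append[OF r(4)
      run_append[OF r(5) run_append[OF r(6) run_append[OF r(7) r(8)]]]]]]])
  have disj: "set (?A j) \<inter> set (?A k) = {}" if "j < 8" "k < 8" "j \<noteq> k" for j k
    using S(1)[OF that(1)] S(1)[OF that(2)] frame_section_disjoint[OF mn that(1,2)] that(3) by blast
  have dist: "distinct (concat (map ?A js))" if "distinct js" "set js \<subseteq> {..<8}" for js
    using that S(2) disj by (induction js) force+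
  have "distinct [0..<8::nat]" "set [0..<8::nat] \<subseteq> {..<8}" by auto
  from dist[OF this] have "distinct (second_cycle e w C')" by (simp only: second_cycle_def)
  moreover have "3 \<le> length ts"
  proof -
    have "1 \<le> length (?T t)" for t using second_word_ne[of e t] by (cases "?T t") auto
    from this[of True] this[of False] show ?thesis unfolding ts by simp
  qed
  ultimately have "closed_trail r s lab (a 0) d ts \<and> second_cycle e w C' = squares ?v (a 0) d ts"
    using all rs by (auto simp: run_def closed_trail_def)
  then show "\<exists>a. closed_trail r s lab a d ts \<and> second_cycle e w C' = squares ?v a d ts" by blast
  have "dir_end (?q 7) (?T True @ ?T False) = ?q 1" using r(1,2) by (simp add: run_def)
  also have "\<dots> = quarter (?q 7)" by (simp add: junction_def step_simps)
  finally show "dir_end d (second_word e True @ second_word e False) = quarter d" by (simp only: d_def)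
qed

section \<open>Existence and equivalence\<close>

lemma shell_iff:
  "(x, y) \<in> shell (m, n) \<longleftrightarrow> (\<exists>(u, v)\<in>{(x, y), (y, - x), (- x, - y), (- y, x)}.
     if n \<le> 2 * m
     then 3 * m - n < 2 * u \<and> 2 * u < m + n \<and> 3 * m - n < 2 * v \<and> 2 * v < m + n \<or>
       n - m < 2 * u \<and> 2 * u < 3 * (n - m) \<and> 2 * \<bar>v\<bar> < n - m
     else 3 * n - 5 * m < 2 * u \<and> 2 * u < m + n \<and> 2 * \<bar>v\<bar> < 3 * m - n \<or>
       n - m < 2 * u \<and> 2 * u < 5 * m - n \<and> n - m < 2 * v \<and> 2 * v < 5 * m - n)"
proof -
  have "{..<4::nat} = {0, 1, 2, 3}" by auto
  then have "(x, y) \<in> (\<Union>k<4. (rot90 ^^ k) ` S) \<longleftrightarrow>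
      (\<exists>(u, v)\<in>{(x, y), (y, - x), (- x, - y), (- y, x)}. (u, v) \<in> S)" for S
    by (simp add: rot90_image_iff rot90_power_image_iff)
  then show ?thesis unfolding shell.simps by auto
qed

lemma shell_cycle_trail:
  assumes mn: "0 < m" "m < n" "n \<le> 3 * m" and pl: "placed (m, n) a 7 base_word"
    and sh: "set (squares (move_vec (m, n)) a 7 base_word) \<subseteq> shell (m, n)"
  shows "shell_cycle (m, n) (squares (move_vec (m, n)) a 7 base_word)"
proof -
  have "distinct (squares (move_vec (m, n)) a 7 base_word)"
    by (rule placed_distinct[OF mn(1,2) pl]) (unfold base_word_dirs, simp)
  from leaper_cycle_trail[OF mn(1,2) pl base_word_sq_end this] show ?thesis
    using mn(3) sh by (auto simp: leaper_cycle_def)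
qed

lemma shell_cycle_exists:
  "\<exists>C. shell_cycle (1, 2) C" "\<exists>C. shell_cycle (2, 3) C" "\<exists>C. shell_cycle (2, 5) C"
proof -
  have "shell_cycle (1, 2) (squares (move_vec (1, 2)) (1, 0) 7 base_word)"
    by (rule shell_cycle_trail) (simp_all add: placed_def step_simps sect_simps move_vec_simps shell_iff
      in_frame_section unit_dir_simps strip_def del: shell.simps)
  then show "\<exists>C. shell_cycle (1, 2) C" by blast
  have "shell_cycle (2, 3) (squares (move_vec (2, 3)) (1, 0) 7 base_word)"
    by (rule shell_cycle_trail) (simp_all add: placed_def step_simps sect_simps move_vec_simps shell_iff
      in_frame_section unit_dir_simps strip_def del: shell.simps)
  then show "\<exists>C. shell_cycle (2, 3) C" by blast
  have "shell_cycle (2, 5) (squares (move_vec (2, 5)) (3, 0) 7 base_word)"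
    by (rule shell_cycle_trail) (simp_all add: placed_def step_simps sect_simps move_vec_simps shell_iff
      in_frame_section unit_dir_simps strip_def del: shell.simps)
  then show "\<exists>C. shell_cycle (2, 5) C" by blast
qed

lemma frame_of_leaper:
  assumes "frame_of e = (p, q)"
  shows "skew_leaper p q" "basic_leaper p q" "p < q"
  using frame_of_skew[OF assms] by (simp_all add: skew_leaper_def basic_leaper_def)

lemma fundamental_exists: "\<exists>\<Phi>. is_fundamental e \<Phi>"
proof -
  obtain p q where F: "frame_of (e @ []) = (p, q)" by fastforce
  obtain C' where "shell_cycle (frame_of []) C'" using shell_cycle_exists(1) by auto
  from lifted_from_exists[OF this F] show ?thesis
    using frame_of_leaper[OF F] unfolding is_fundamental_def cycle_descent_def by blast
qed

lemma second_fundamental_exists: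
  assumes "org \<in> {LG, LH}"
  shows "\<exists>\<Psi>. is_second_fundamental org e \<Psi>"
proof -
  obtain p q where F: "frame_of (e @ [org]) = (p, q)" by fastforce
  have "frame_of [org] \<in> {(2, 3), (2, 5)}" using assms by auto
  then obtain C' where "shell_cycle (frame_of [org]) C'" using shell_cycle_exists(2,3) by auto
  from lifted_from_exists[OF this F] obtain C where "lifted_from p q C e [org] C'" by blast
  then have "is_second_fundamental org e (extracted_graph 1 2 (second_cycle e [org] C'))"
    using frame_of_leaper[OF F] frame_of_leaper[of "[]"] unfolding is_second_fundamental_def by fastforce
  then show ?thesis by blast
qed

lemma second_fundamentalE:
  assumes "is_second_fundamental org e \<Psi>" and org: "org = LG \<and> lab = second_label_g \<or> org = LH \<and> lab = second_label_h"
  obtains r s a where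
    "closed_trail r s lab a (junction (swapped e) 7) (concat (replicate 4 (second_word e True @ second_word e False)))"
    "\<Psi> = extracted_graph r s
      (squares (dvec r s \<circ> lab) a (junction (swapped e) 7) (concat (replicate 4 (second_word e True @ second_word e False))))"
    "dir_end (junction (swapped e) 7) (second_word e True @ second_word e False) = quarter (junction (swapped e) 7)"
proof -
  obtain p q C w C' r s where
    L: "lifted_from p q C e w C'" "w \<noteq> []" "hd w = org" "second_leaper w = (r, s)" "skew_leaper r s" "r < s"
      "\<Psi> = extracted_graph r s (second_cycle e w C')"
    using assms(1) unfolding is_second_fundamental_def by blast
  obtain w' where w: "w = org # w'" using L(2,3) by (cases w) auto
  then have "frame_of w' = (r, s)" using L(4) by simp
  then have "second_vectors (frame_of w) (dvec r s \<circ> lab)"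
    using org w by (auto simp: second_vectors_def upt_eight label_defs dvec_def)
  note S = second_cycle_trail[OF L(1) _ L(6) this]
  have "0 < r" using L(5) by (simp add: skew_leaper_def)
  with S that L(7) show thesis by metis
qed

theorem theorem12:
  fixes e' e'' :: "lift_type list"
  assumes "e'' = flip e'"
  shows "(\<exists>\<Phi>. is_fundamental e' \<Phi>) \<and>
    (\<exists>\<Psi>. is_second_fundamental LG e'' \<Psi>) \<and>
    (\<exists>\<Psi>. is_second_fundamental LH e'' \<Psi>) \<and>
    (\<forall>\<Phi> \<Psi>\<^sub>g \<Psi>\<^sub>h.
       is_fundamental e' \<Phi> \<and> is_second_fundamental LG e'' \<Psi>\<^sub>g \<and> is_second_fundamental LH e'' \<Psi>\<^sub>h \<longrightarrow>
       equivalent_graphs \<Phi> \<Psi>\<^sub>g \<and> equivalent_graphs \<Phi> \<Psi>\<^sub>h \<and> equivalent_graphs \<Psi>\<^sub>g \<Psi>\<^sub>h)"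
proof (intro conjI allI impI)
  show "\<exists>\<Phi>. is_fundamental e' \<Phi>" by (rule fundamental_exists)
  show "\<exists>\<Psi>. is_second_fundamental LG e'' \<Psi>" "\<exists>\<Psi>. is_second_fundamental LH e'' \<Psi>"
    by (simp_all add: second_fundamental_exists)
  fix \<Phi> \<Psi>\<^sub>g \<Psi>\<^sub>h
  assume "is_fundamental e' \<Phi> \<and> is_second_fundamental LG e'' \<Psi>\<^sub>g \<and> is_second_fundamental LH e'' \<Psi>\<^sub>h"
  then have \<Phi>: "is_fundamental e' \<Phi>" and \<Psi>\<^sub>g: "is_second_fundamental LG e'' \<Psi>\<^sub>g"
    and \<Psi>\<^sub>h: "is_second_fundamental LH e'' \<Psi>\<^sub>h" by blast+
  define ts d where "ts = concat (replicate 4 (second_word e'' True @ second_word e'' False))" and "d = junction (swapped e'') 7"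
  have d: "d < 8" by (simp add: d_def)
  have base4: "concat (replicate 4 [True, False]) = base_word" by (simp add: numeral_eq_Suc)
  obtain k where k: "ts = map Not (rotate k (first_word e' base_word))"
    using second_word_rotation[of 4 e'] unfolding ts_def assms base4 by blast
  obtain p q C w C' where C: "lifted_from p q C e' w C'" "\<Phi> = extracted_graph p q C"
    using \<Phi> unfolding is_fundamental_def cycle_descent_def by blast
  obtain a c where T: "closed_trail p q first_label a c (first_word e' base_word)" "dir_end c (first_word e' [True, False]) = quarter c"
    and \<Phi>': "\<Phi> = extracted_graph p q (squares (dvec p q \<circ> first_label) a c (first_word e' base_word))"
    using lifted_from_trail[OF C(1)] C(2) by auto
  have c: "c < 8" using T(1) by (simp add: closed_trail_def)
  have Z: "(\<Sum>k\<leftarrow>dirs c (first_word e' base_word). dir_matrix (first_label k)) = 0"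
    using sum_fourfold[OF _ c T(2), of first_label] unfolding first_word_replicate[symmetric] base4 by simp
  obtain r s b where G: "closed_trail r s second_label_g b d ts" "\<Psi>\<^sub>g = extracted_graph r s (squares (dvec r s \<circ> second_label_g) b d ts)"
    and q: "dir_end d (second_word e'' True @ second_word e'' False) = quarter d"
    using second_fundamentalE[OF \<Psi>\<^sub>g, of second_label_g] unfolding ts_def d_def by blast
  obtain r' s' b' where H: "closed_trail r' s' second_label_h b' d ts"
    "\<Psi>\<^sub>h = extracted_graph r' s' (squares (dvec r' s' \<circ> second_label_h) b' d ts)"
    using second_fundamentalE[OF \<Psi>\<^sub>h, of second_label_h] unfolding ts_def d_def by blast
  show "equivalent_graphs \<Phi> \<Psi>\<^sub>g"
    unfolding \<Phi>' G(2) k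
    by (rule equivalent_first_second[OF T(1) G(1)[unfolded k] bij_label(2) labelling_equiv_g Z])
  show "equivalent_graphs \<Phi> \<Psi>\<^sub>h"
    unfolding \<Phi>' H(2) k
    by (rule equivalent_first_second[OF T(1) H(1)[unfolded k] bij_label(3) labelling_equiv_h Z])
  have Z': "(\<Sum>k\<leftarrow>dirs d ts. dir_matrix (second_label_g k)) = 0"
    using sum_fourfold[OF _ d q, of second_label_g] unfolding ts_def by simp
  show "equivalent_graphs \<Psi>\<^sub>g \<Psi>\<^sub>h"
    using equivalent_trails[where \<kappa> = id and \<nu> = id, OF G(1) _ bij_label(2,3) _ labelling_equiv_gh _ Z', of r' s' b'] H(1)
    unfolding G(2) H(2) by simp
qed

end
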